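(* Let $N=N(n)$ be a sequence of integers with $N/n\to c\in(0,\infty)$ as $n\to\infty$, and assume the following. (A-1) The random variables $(X_{ij}^n;\,1\le i\le N,\,1\le j\le n,\,n\ge1)$ are real, independent and identically distributed, centered, with $\mathbb{E}(X_{ij}^n)^2=1$, and there exists $\varepsilon>0$ such that $\mathbb{E}|X_{ij}^n|^{4+\varepsilon}<\infty$. (A-2) The real numbers $\sigma_{ij}(n)$ satisfy $\sup_{n\ge1}\max_{1\le i\le N,1\le j\le n}|\sigma_{ij}(n)|\le\sigma_{\max}<\infty$. (A-3) $A_n$ is a real deterministic $N\times n$ matrix whose columns $\mathbf a_k^n$ and rows $\tilde{\mathbf a}_\ell^n$ satisfy $\sup_{n\ge1}\max(\|\mathbf a_k^n\|,\|\tilde{\mathbf a}_\ell^n\|;\,1\le k\le n,\,1\le\ell\le N)<\infty$. Let $Y_{ij}^n=\frac{\sigma_{ij}(n)}{\sqrt n}X_{ij}^n$ and $\Sigma_n=Y_n+A_n$. For $\sigma^2>0$ let $$C_n(\sigma^2)=\frac1N\mathbb{E}\log\det\left(I_N+\frac{\Sigma_n\Sigma_n^T}{\sigma^2}\right),\qquad \overline C_n(\sigma^2)=\int_{\sigma^2}^{+\infty}\left(\frac1\omega-\frac1N\mathrm{Tr}\,T_n(-\omega)\right)d\omega,$$ where $T=T_n$ (and $\tilde T,\Psi,\tilde\Psi$) are as in the context. Then for every $\sigma^2>0$, $$C_n(\sigma^2)-\overline C_n(\sigma^2)\xrightarrow[n\to+\infty,\,N/n\to c]{}0.$$ Moreover,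 writing $A=A_n$ and $\sigma_{ij}=\sigma_{ij}(n)$, $$\overline C_n(\sigma^2)=\frac1N\log\det\left[\frac{\Psi(-\sigma^2)^{-1}}{\sigma^2}+A\tilde\Psi(-\sigma^2)A^T\right]+\frac1N\log\det\frac{\tilde\Psi(-\sigma^2)^{-1}}{\sigma^2}-\frac{\sigma^2}{nN}\sum_{\substack{1\le i\le N\\1\le j\le n}}\sigma_{ij}^2\,T_{ii}(-\sigma^2)\,\tilde T_{jj}(-\sigma^2).$$
   Context: $\mathbb{R}^+=[0,\infty)$; $\mathcal{S}(\mathbb{R}^+)$ is the set of Stieltjes transforms $f(z)=\int_{\mathbb{R}^+}\frac{\nu(d\lambda)}{\lambda-z}$ of probability measures $\nu$ on $\mathbb{R}^+$, viewed as analytic functions on $\mathbb{C}-\mathbb{R}^+$. The scalar $\sigma^2$ is a parameter unrelated to the variance profile $\sigma_{ij}(n)$. Definition of $\Psi,\tilde\Psi,T=T_n,\tilde T=\tilde T_n$: let $D_j=\mathrm{diag}(\sigma_{ij}^2;1\le i\le N)$, $\tilde D_i=\mathrm{diag}(\sigma_{ij}^2;1\le j\le n)$. The system $$\psi_i(z)=\frac{-1}{z(1+\frac1n\mathrm{Tr}\,\tilde D_i\tilde T(z))}\ (1\le i\le N),\qquad \tilde\psi_j(z)=\frac{-1}{z(1+\frac1n\mathrm{Tr}\,D_jT(z))}\ (1\le j\le n),$$ with $\Psi=\mathrm{diag}(\psi_i)$, $\tilde\Psi=\mathrm{diag}(\tilde\psi_j)$, $T(z)=(\Psi^{-1}(z)-zA\tilde\Psi(z)A^T)^{-1}$,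 $\tilde T(z)=(\tilde\Psi^{-1}(z)-zA^T\Psi(z)A)^{-1}$, has a unique solution $(\psi_1,\dots,\psi_N,\tilde\psi_1,\dots,\tilde\psi_n)\in\mathcal{S}(\mathbb{R}^+)^{N+n}$; $\Psi,\tilde\Psi,T,\tilde T$ are the matrices associated with this solution. *)

theory Defs
  imports
    "HOL-Probability.Probability"
    "HOL-Library.Nonpos_Ints"
    "Jordan_Normal_Form.Determinant"
    "Jordan_Normal_Form.Gauss_Jordan_Elimination"
begin

text \<open>
  Matrices have sizes depending on \<open>n\<close>, hence the explicit-dimension type \<open>'a mat\<close> of
  Jordan_Normal_Form. All indices start at \<open>0\<close>: \<open>i < N\<close> and \<open>j < n\<close> stand for
  \<open>1 \<le> i \<le> N\<close> and \<open>1 \<le> j \<le> n\<close>. Matrices that depend on the deterministic equivalent are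
  complex, and real data are embedded with \<open>complex_of_real\<close>.
\<close>

definition mat_tr :: "'a::comm_monoid_add mat \<Rightarrow> 'a" where
  "mat_tr B = (\<Sum>i<dim_row B. B $$ (i, i))"

definition mat_inv :: "'a::field mat \<Rightarrow> 'a mat" where
  "mat_inv B = the (mat_inverse B)"

definition vec_eucl_norm :: "real Matrix.vec \<Rightarrow> real" where
  "vec_eucl_norm v = sqrt (scalar_prod v v)"

definition cmat :: "real mat \<Rightarrow> complex mat" where
  "cmat B = map_mat complex_of_real B"

text \<open>
  Stieltjes transforms of probability measures on \<open>[0, \<infinity>)\<close>. An element is a total function of
  which only the values on the complement of \<open>[0, \<infinity>)\<close> are constrained.
\<close>

definition stieltjes_class :: "(complex \<Rightarrow> complex) set" where
  "stieltjes_class = {f. \<exists>\<nu>. real_distribution \<nu> \<and> emeasure \<nu> {0..} = 1 \<and>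
     (\<forall>z. z \<notin> \<real>\<^sub>\<ge>\<^sub>0 \<longrightarrow> f z = (LINT l|\<nu>. 1 / (complex_of_real l - z)))}"

subsection \<open>The deterministic equivalent\<close>

text \<open>
  The arguments \<open>psi\<close> and \<open>psit\<close> are the two families of functions, \<open>A\<close> is the \<open>N \<times> n\<close> matrix.
\<close>

definition T_mat ::
  "nat \<Rightarrow> nat \<Rightarrow> real mat \<Rightarrow> (nat \<Rightarrow> complex \<Rightarrow> complex) \<Rightarrow> (nat \<Rightarrow> complex \<Rightarrow> complex)
    \<Rightarrow> complex \<Rightarrow> complex mat" where
  "T_mat N n A psi psit z =
     mat_inv (mat_inv (mat_diag N (\<lambda>i. psi i z))
       - z \<cdot>\<^sub>m (cmat A * mat_diag n (\<lambda>j. psit j z) * transpose_mat (cmat A)))"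

definition Tt_mat ::
  "nat \<Rightarrow> nat \<Rightarrow> real mat \<Rightarrow> (nat \<Rightarrow> complex \<Rightarrow> complex) \<Rightarrow> (nat \<Rightarrow> complex \<Rightarrow> complex)
    \<Rightarrow> complex \<Rightarrow> complex mat" where
  "Tt_mat N n A psi psit z =
     mat_inv (mat_inv (mat_diag n (\<lambda>j. psit j z))
       - z \<cdot>\<^sub>m (transpose_mat (cmat A) * mat_diag N (\<lambda>i. psi i z) * cmat A))"

definition D_mat :: "nat \<Rightarrow> (nat \<Rightarrow> nat \<Rightarrow> real) \<Rightarrow> nat \<Rightarrow> complex mat" where
  "D_mat N sig j = mat_diag N (\<lambda>i. complex_of_real ((sig i j)\<^sup>2))"

definition Dt_mat :: "nat \<Rightarrow> (nat \<Rightarrow> nat \<Rightarrow> real) \<Rightarrow> nat \<Rightarrow> complex mat" where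
  "Dt_mat n sig i = mat_diag n (\<lambda>j. complex_of_real ((sig i j)\<^sup>2))"

text \<open>
  For \<open>z\<close> off the half-line, Stieltjes transforms do not vanish at \<open>z\<close> and (by the sign of
  imaginary parts, or by positive definiteness when \<open>z < 0\<close>) the matrices inverted in \<open>T_mat\<close>
  and \<open>Tt_mat\<close> are invertible, so no conventional value of \<open>mat_inv\<close> or of division
  by zero plays a role in this system.
\<close>

definition solves_system ::
  "nat \<Rightarrow> nat \<Rightarrow> real mat \<Rightarrow> (nat \<Rightarrow> nat \<Rightarrow> real) \<Rightarrow> (nat \<Rightarrow> complex \<Rightarrow> complex)
    \<Rightarrow> (nat \<Rightarrow> complex \<Rightarrow> complex) \<Rightarrow> bool" where
  "solves_system N n A sig psi psit \<longleftrightarrow>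
     (\<forall>i<N. psi i \<in> stieltjes_class) \<and> (\<forall>j<n. psit j \<in> stieltjes_class) \<and>
     (\<forall>z. z \<notin> \<real>\<^sub>\<ge>\<^sub>0 \<longrightarrow>
       (\<forall>i<N. psi i z =
          -1 / (z * (1 + 1 / of_nat n * mat_tr (Dt_mat n sig i * Tt_mat N n A psi psit z)))) \<and>
       (\<forall>j<n. psit j z =
          -1 / (z * (1 + 1 / of_nat n * mat_tr (D_mat N sig j * T_mat N n A psi psit z)))))"

definition Cbar_integrand ::
  "nat \<Rightarrow> nat \<Rightarrow> real mat \<Rightarrow> (nat \<Rightarrow> complex \<Rightarrow> complex) \<Rightarrow> (nat \<Rightarrow> complex \<Rightarrow> complex)
    \<Rightarrow> real \<Rightarrow> complex" where
  "Cbar_integrand N n A psi psit w =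
     1 / complex_of_real w - 1 / of_nat N * mat_tr (T_mat N n A psi psit (- complex_of_real w))"

text \<open>Here and below the parameter \<open>s\<close> is the scalar written \<open>\<sigma>\<^sup>2\<close> in the mathematics.\<close>

definition Cbar ::
  "nat \<Rightarrow> nat \<Rightarrow> real mat \<Rightarrow> (nat \<Rightarrow> complex \<Rightarrow> complex) \<Rightarrow> (nat \<Rightarrow> complex \<Rightarrow> complex)
    \<Rightarrow> real \<Rightarrow> complex" where
  "Cbar N n A psi psit s = (CLBINT w:{s..}. Cbar_integrand N n A psi psit w)"

subsection \<open>The random matrix model\<close>

definition Sigma_mat ::
  "nat \<Rightarrow> nat \<Rightarrow> real mat \<Rightarrow> (nat \<Rightarrow> nat \<Rightarrow> real) \<Rightarrow> (nat \<Rightarrow> nat \<Rightarrow> 'w \<Rightarrow> real) \<Rightarrow> 'w \<Rightarrow> real mat"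
  where
  "Sigma_mat N n A sig X \<omega> =
     Matrix.mat N n (\<lambda>(i, j). sig i j / sqrt (real n) * X i j \<omega>) + A"

definition log_det ::
  "nat \<Rightarrow> nat \<Rightarrow> real mat \<Rightarrow> (nat \<Rightarrow> nat \<Rightarrow> real) \<Rightarrow> (nat \<Rightarrow> nat \<Rightarrow> 'w \<Rightarrow> real) \<Rightarrow> real \<Rightarrow> 'w \<Rightarrow> real"
  where
  "log_det N n A sig X s \<omega> =
     ln (Determinant.det (1\<^sub>m N +
       (1 / s) \<cdot>\<^sub>m (Sigma_mat N n A sig X \<omega> * transpose_mat (Sigma_mat N n A sig X \<omega>))))"

definition C_cap ::
  "'w measure \<Rightarrow> nat \<Rightarrow> nat \<Rightarrow> real mat \<Rightarrow> (nat \<Rightarrow> nat \<Rightarrow> real) \<Rightarrow> (nat \<Rightarrow> nat \<Rightarrow> 'w \<Rightarrow> real)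
    \<Rightarrow> real \<Rightarrow> real" where
  "C_cap M N n A sig X s = 1 / real N * (LINT \<omega>|M. log_det N n A sig X s \<omega>)"

definition index_set :: "(nat \<Rightarrow> nat) \<Rightarrow> (nat \<times> nat \<times> nat) set" where
  "index_set N = {(n, i, j). 1 \<le> n \<and> i < N n \<and> j < n}"

end

theory Submission
  imports Defs
begin

text \<open>
  Put \<open>r = sqrt s\<close>, \<open>m = N + n\<close>, and let \<open>H\<close> be the real \<open>m \<times> m\<close> matrix with diagonal \<open>r\<close> and
  off-diagonal blocks \<open>\<Sigma>\<close> and \<open>- \<Sigma>\<^sup>T\<close>. Then \<open>det H = r\<^sup>m det (I + \<Sigma> \<Sigma>\<^sup>T / s)\<close>, and since the
  off-diagonal part is antisymmetric, \<open>G = H\<^sup>-\<^sup>1\<close> has norm at most \<open>1 / r\<close>. In these terms the system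
  at \<open>z = - s\<close> reads \<open>t = diag ((r + diag (S t) + B)\<^sup>-\<^sup>1)\<close>, where \<open>B\<close> has the
  off-diagonal blocks \<open>A\<close> and \<open>- A\<^sup>T\<close>, and \<open>S\<close> is the matrix of variances.

  Expanding the resolvent in single entries and bounding variances by the Efron--Stein inequality
  shows that the diagonal of \<open>E G\<close> solves this equation up to a small error. The equation is stable,
  whence \<open>E tr G - \<Sum> t = O(sqrt n)\<close>. Now \<open>E ln det H\<close> has derivative \<open>E tr G\<close> in \<open>r\<close>, and
  \<open>\<Lambda>(r) = ln det (r + diag (S t) + B) - t\<^sup>T S t / 2\<close>, being stationary in \<open>t\<close>, has derivative \<open>\<Sum> t\<close>.
  Both are \<open>m ln r + O(m / r\<^sup>2)\<close>, so integrating from \<open>r\<close> to a large \<open>r1\<close>, dividing by \<open>N\<close>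
  and letting first \<open>n\<close> and then \<open>r1\<close> tend to infinity gives the limit. The closed form is the
  fundamental theorem of calculus for \<open>(\<Lambda>(sqrt s) - m ln (sqrt s)) / N\<close>.
\<close>

subsection \<open>Determinants and inverses of matrices given by functions\<close>

text \<open>Only the negative axis \<open>z = - r^2\<close> is visited. There the symmetric part of
  the linearised matrix is \<open>r I\<close> for every value of the noise, so the bound 1 / r is
  sure and nothing is truncated. The dictionary is \<open>T_ii = t_i / r\<close> and
  \<open>psi_i = 1 / (r (r + (S t)_i))\<close>. The orders are m = O(n), variances O(1/n), third
  absolute moments O(n^(-3/2)). An error O(sqrt n) for sums with bounded weights says nothing about
  a single diagonal entry of E G, so the approximate equation is stated only after averaging:
  against a row of S, whose entries are O(1/n), the error is O(n^(-1/2)), and that is what the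
  stability argument can digest. The trace error O(sqrt n) disappears on division by N. Stationarity
  of \<Lambda> in t has a practical side: the Stieltjes representation gives differentiability of S
  t directly, and this together with continuity of t is enough. The trace error is bounded by a
  constant on [r, r1], so its integral grows with r1, while the tail beyond r1 is small only for
  large r1; hence two successive limits.\<close>

lemma mat_inv_unique:
  fixes B C :: "'a::field mat"
  assumes B: "B \<in> carrier_mat n n" and C: "C \<in> carrier_mat n n" and BC: "B * C = 1\<^sub>m n"
  shows "mat_inv B = C"
proof -
  have CB: "C * B = 1\<^sub>m n"
    using mat_mult_left_right_inverse[OF B C BC] .
  have "B \<in> Units (ring_mat TYPE('a) n ())"
    using B C BC CB unfolding Units_def ring_mat_def by auto
  then obtain D where D: "mat_inverse B = Some D"
    using mat_inverse(1)[OF B, where b="()"] by (cases "mat_inverse B") auto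
  have D': "D * B = 1\<^sub>m n" "D \<in> carrier_mat n n"
    using mat_inverse(2)[OF B D] by auto
  have "D = D * (B * C)" using D' BC by simp
  also have "\<dots> = D * B * C" using B C D' by (intro assoc_mult_mat[symmetric]) auto
  also have "\<dots> = C" using D' C by simp
  finally show ?thesis by (simp add: mat_inv_def D)
qed

lemma mat_inv_inverse:
  fixes B :: "'a::field mat"
  assumes B: "B \<in> carrier_mat n n" and det: "Determinant.det B \<noteq> 0"
  shows "mat_inv B \<in> carrier_mat n n" "B * mat_inv B = 1\<^sub>m n" "mat_inv B * B = 1\<^sub>m n"
proof -
  have "B \<in> Units (ring_mat TYPE('a) n ())"
    using det_non_zero_imp_unit[OF B det] .
  then obtain D where D: "mat_inverse B = Some D"
    using mat_inverse(1)[OF B, where b="()"] by (cases "mat_inverse B") auto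
  show "mat_inv B \<in> carrier_mat n n" "B * mat_inv B = 1\<^sub>m n" "mat_inv B * B = 1\<^sub>m n"
    using mat_inverse(2)[OF B D] by (auto simp: mat_inv_def D)
qed

text \<open>Matrices are handled as plain functions of two indices, with the size \<open>m\<close>
  passed to \<open>fdet\<close> and \<open>finv\<close>. Entries can then be modified by
  \<open>if\<close>, and measurability, limits and derivatives are stated entry by entry.\<close>

definition fmat :: "nat \<Rightarrow> (nat \<Rightarrow> nat \<Rightarrow> 'a) \<Rightarrow> 'a mat" where
  "fmat m h = Matrix.mat m m (\<lambda>(i, j). h i j)"

definition fdet :: "nat \<Rightarrow> (nat \<Rightarrow> nat \<Rightarrow> 'a::comm_ring_1) \<Rightarrow> 'a" where
  "fdet m h = Determinant.det (fmat m h)"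

definition finv :: "nat \<Rightarrow> (nat \<Rightarrow> nat \<Rightarrow> 'a::field) \<Rightarrow> nat \<Rightarrow> nat \<Rightarrow> 'a" where
  "finv m h i j = mat_inv (fmat m h) $$ (i, j)"

lemma fmat_carrier [simp]: "fmat m h \<in> carrier_mat m m"
  by (simp add: fmat_def)

lemma fmat_dim [simp]: "dim_row (fmat m h) = m" "dim_col (fmat m h) = m"
  by (simp_all add: fmat_def)

lemma fmat_index [simp]: "i < m \<Longrightarrow> j < m \<Longrightarrow> fmat m h $$ (i, j) = h i j"
  by (simp add: fmat_def)

lemma fmat_cong:
  "(\<And>i j. i < m \<Longrightarrow> j < m \<Longrightarrow> h i j = h' i j) \<Longrightarrow> fmat m h = fmat m h'"
  by (intro eq_matI) auto

lemma fdet_cong: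
  "(\<And>i j. i < m \<Longrightarrow> j < m \<Longrightarrow> h i j = h' i j) \<Longrightarrow> fdet m h = fdet m h'"
  unfolding fdet_def using fmat_cong[of m h h'] by simp

lemma finv_cong:
  "(\<And>i j. i < m \<Longrightarrow> j < m \<Longrightarrow> h i j = h' i j) \<Longrightarrow> finv m h = finv m h'"
  unfolding finv_def using fmat_cong[of m h h'] by (intro ext) simp

lemma permutes_less:
  assumes "p permutes {0..<m::nat}" "j < m"
  shows "p j < m"
  using permutes_in_image[OF assms(1), of j] assms(2) by simp

text \<open>The Leibniz formula exhibits the determinant as a polynomial in the entries;
  measurability, continuity and differentiability below all come from it.\<close>

lemma fdet_leibniz:
  "fdet m h = (\<Sum>p | p permutes {0..<m}. signof p * (\<Prod>j<m. h (p j) j))"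
  unfolding fdet_def det_col[OF fmat_carrier]
  by (intro sum.cong refl arg_cong2[where f="(*)"] prod.cong)
     (auto simp: permutes_less)

lemma mult_mat_entry:
  assumes "A \<in> carrier_mat a b" "B \<in> carrier_mat b c" "i < a" "j < c"
  shows "(A * B) $$ (i, j) = (\<Sum>k<b. A $$ (i, k) * B $$ (k, j))"
  using assms by (auto simp: scalar_prod_def atLeast0LessThan intro!: sum.cong)

lemma finv_right:
  assumes "fdet m h \<noteq> 0" "i < m" "j < m"
  shows "(\<Sum>k<m. h i k * finv m h k j) = (if i = j then 1 else 0)"
proof -
  note I = mat_inv_inverse[OF fmat_carrier, of m h]
  have "(fmat m h * mat_inv (fmat m h)) $$ (i, j) = (\<Sum>k<m. h i k * finv m h k j)"
    using assms I by (subst mult_mat_entry[of _ m m _ m]) (auto simp: fdet_def finv_def)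
  then show ?thesis using I assms by (auto simp: fdet_def)
qed

lemma finv_left:
  assumes "fdet m h \<noteq> 0" "i < m" "j < m"
  shows "(\<Sum>k<m. finv m h i k * h k j) = (if i = j then 1 else 0)"
proof -
  note I = mat_inv_inverse[OF fmat_carrier, of m h]
  have "(mat_inv (fmat m h) * fmat m h) $$ (i, j) = (\<Sum>k<m. finv m h i k * h k j)"
    using assms I by (subst mult_mat_entry[of _ m m _ m]) (auto simp: fdet_def finv_def)
  then show ?thesis using I assms by (auto simp: fdet_def)
qed

text \<open>Cramer's rule for the system \<open>h u = v\<close>. A unit vector \<open>v\<close>
  gives the entries of the inverse, and the derivative of a column gives Jacobi's formula.\<close>

lemma finv_replace_col:
  assumes det: "fdet m h \<noteq> 0" and i: "i < m"
  shows "fdet m (\<lambda>a b. if b = i then v a else h a b) = (\<Sum>k<m. finv m h i k * v k) * fdet m h"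
proof -
  define x where "x = Matrix.vec m (\<lambda>i. \<Sum>k<m. finv m h i k * v k)"
  have x: "x \<in> carrier_vec m" by (simp add: x_def)
  have hx: "(fmat m h *\<^sub>v x) $ a = v a" if a: "a < m" for a
  proof -
    have "(fmat m h *\<^sub>v x) $ a = (\<Sum>b<m. h a b * (\<Sum>k<m. finv m h b k * v k))"
      using a by (auto simp: x_def scalar_prod_def atLeast0LessThan intro!: sum.cong)
    also have "\<dots> = (\<Sum>b<m. \<Sum>k<m. h a b * finv m h b k * v k)"
      by (simp add: sum_distrib_left mult.assoc)
    also have "\<dots> = (\<Sum>k<m. (\<Sum>b<m. h a b * finv m h b k) * v k)"
      by (subst sum.swap) (simp add: sum_distrib_right)
    also have "\<dots> = (\<Sum>k<m. (if a = k then 1 else 0) * v k)"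
      by (intro sum.cong refl) (simp add: finv_right[OF det a])
    also have "\<dots> = v a" using a by (simp add: sum.delta' if_distrib[of "\<lambda>x. x * _"] cong: if_cong)
    finally show ?thesis .
  qed
  have "replace_col (fmat m h) (fmat m h *\<^sub>v x) i = fmat m (\<lambda>a b. if b = i then v a else h a b)"
    unfolding replace_col_def using hx by (intro eq_matI) auto
  then show ?thesis
    using cramer_lemma_mat[OF fmat_carrier x i, of h] i by (simp add: fdet_def x_def)
qed

lemma finv_cramer:
  assumes "fdet m h \<noteq> 0" "i < m" "j < m"
  shows "finv m h i j = fdet m (\<lambda>a b. if b = i then (if a = j then 1 else 0) else h a b) / fdet m h"
proof -
  have "(\<Sum>k<m. finv m h i k * (if k = j then 1 else 0)) = finv m h i j"
    using assms by (simp add: if_distrib[of "\<lambda>x. _ * x"] cong: if_cong)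
  then show ?thesis
    using finv_replace_col[OF assms(1,2), of "\<lambda>a. if a = j then 1 else 0"] assms by simp
qed

lemma finv_unique:
  assumes inv: "\<And>i j. i < m \<Longrightarrow> j < m \<Longrightarrow> (\<Sum>k<m. h i k * c k j) = (if i = j then 1 else 0)"
    and "i < m" "j < m"
  shows "finv m h i j = c i j"
proof -
  have "fmat m h * fmat m c = 1\<^sub>m m"
    by (intro eq_matI) (auto simp: inv mult_mat_entry[of _ m m _ m] simp del: index_mult_mat(1))
  from mat_inv_unique[OF fmat_carrier fmat_carrier this] show ?thesis
    using assms by (simp add: finv_def)
qed

text \<open>In \<open>h^-1 (h' - h) h'^-1\<close> the term with \<open>h'\<close> contracts on the
  right and the term with \<open>h\<close> on the left.\<close>

lemma resolvent_identity:
  assumes d: "fdet m h \<noteq> 0" and d': "fdet m h' \<noteq> 0" and ab: "a < m" "b < m"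
  shows "finv m h a b - finv m h' a b
    = (\<Sum>k<m. \<Sum>l<m. finv m h a k * (h' k l - h k l) * finv m h' l b)"
proof -
  have "(\<Sum>k<m. \<Sum>l<m. finv m h a k * h' k l * finv m h' l b)
      = (\<Sum>k<m. finv m h a k * (if k = b then 1 else 0))"
    by (intro sum.cong refl) (simp add: mult.assoc sum_distrib_left[symmetric] finv_right[OF d'] ab)
  also have "\<dots> = finv m h a b"
    using ab by (simp add: if_distrib[of "\<lambda>x. _ * x"] cong: if_cong)
  finally have 1: "(\<Sum>k<m. \<Sum>l<m. finv m h a k * h' k l * finv m h' l b) = finv m h a b" .
  have "(\<Sum>k<m. \<Sum>l<m. finv m h a k * h k l * finv m h' l b)
      = (\<Sum>l<m. (if a = l then 1 else 0) * finv m h' l b)"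
    by (subst sum.swap, intro sum.cong refl) (simp add: sum_distrib_right[symmetric] finv_left[OF d] ab)
  also have "\<dots> = finv m h' a b"
    using ab by (simp add: sum.delta' if_distrib[of "\<lambda>x. x * _"] cong: if_cong)
  finally have 2: "(\<Sum>k<m. \<Sum>l<m. finv m h a k * h k l * finv m h' l b) = finv m h' a b" .
  show ?thesis
    unfolding right_diff_distrib left_diff_distrib sum_subtractf 1 2 ..
qed

lemma fdet_measurable:
  fixes h :: "'x \<Rightarrow> nat \<Rightarrow> nat \<Rightarrow> real"
  assumes "\<And>i j. i < m \<Longrightarrow> j < m \<Longrightarrow> (\<lambda>x. h x i j) \<in> borel_measurable M"
  shows "(\<lambda>x. fdet m (h x)) \<in> borel_measurable M"
  unfolding fdet_leibniz
  by (intro borel_measurable_sum borel_measurable_times borel_measurable_const borel_measurable_prod assms)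
     (auto simp: permutes_less)

text \<open>By Cramer's rule an entry of the inverse is a quotient of two polynomials in the
  entries.\<close>

lemma finv_measurable:
  fixes h :: "'x \<Rightarrow> nat \<Rightarrow> nat \<Rightarrow> real"
  assumes meas: "\<And>i j. i < m \<Longrightarrow> j < m \<Longrightarrow> (\<lambda>x. h x i j) \<in> borel_measurable M"
    and det: "\<And>x. fdet m (h x) \<noteq> 0" and ij: "i < m" "j < m"
  shows "(\<lambda>x. finv m (h x) i j) \<in> borel_measurable M"
  unfolding finv_cramer[OF det ij]
proof (intro borel_measurable_divide fdet_measurable meas)
  fix a b assume "a < m" "b < m"
  then show "(\<lambda>x. if b = i then if a = j then 1 else 0 else h x a b) \<in> borel_measurable M"
    using meas by (cases "b = i") auto
qed auto

lemma fdet_tendsto: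
  fixes h :: "'x \<Rightarrow> nat \<Rightarrow> nat \<Rightarrow> real"
  assumes "\<And>i j. i < m \<Longrightarrow> j < m \<Longrightarrow> ((\<lambda>x. h x i j) \<longlongrightarrow> h0 i j) F"
  shows "((\<lambda>x. fdet m (h x)) \<longlongrightarrow> fdet m h0) F"
  unfolding fdet_leibniz
  by (intro tendsto_sum tendsto_mult tendsto_const tendsto_prod assms)
     (auto simp: permutes_less)

text \<open>Jacobi's formula. Differentiating the Leibniz sum replaces one column at a time by its
  derivative, and \<open>finv_replace_col\<close> evaluates each resulting determinant.\<close>

lemma fdet_has_derivative:
  fixes h :: "real \<Rightarrow> nat \<Rightarrow> nat \<Rightarrow> real"
  assumes deriv: "\<And>i j. i < m \<Longrightarrow> j < m \<Longrightarrow> ((\<lambda>x. h x i j) has_real_derivative h' i j) (at x)"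
    and det: "fdet m (h x) \<noteq> 0"
  shows "((\<lambda>x. fdet m (h x)) has_real_derivative
     (\<Sum>k<m. \<Sum>l<m. finv m (h x) k l * h' l k) * fdet m (h x)) (at x)"
proof -
  let ?P = "{p. p permutes {0..<m}}"
  have *: "((\<lambda>x. \<Sum>p\<in>?P. signof p * (\<Prod>j<m. h x (p j) j)) has_real_derivative
     (\<Sum>p\<in>?P. signof p * (\<Sum>k<m. h' (p k) k * (\<Prod>j\<in>{..<m} - {k}. h x (p j) j)))) (at x)"
  proof (intro DERIV_sum DERIV_cmult)
    fix p assume "p \<in> ?P"
    then have "((\<lambda>x. \<Prod>j<m. h x (p j) j) has_real_derivative
       (\<Sum>k<m. h' (p k) k * (\<Prod>j\<in>{..<m} - {k}. h x (p j) j))) (at x)"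
      by (intro has_field_derivative_prod deriv) (auto simp: permutes_less)
    then show "((\<lambda>x. \<Prod>j<m. h x (p j) j) has_real_derivative
       (\<Sum>k<m. h' (p k) k * (\<Prod>j\<in>{..<m} - {k}. h x (p j) j))) (at x)" .
  qed
  have "(\<Sum>p\<in>?P. signof p * (\<Sum>k<m. h' (p k) k * (\<Prod>j\<in>{..<m} - {k}. h x (p j) j)))
     = (\<Sum>k<m. \<Sum>p\<in>?P. signof p * (h' (p k) k * (\<Prod>j\<in>{..<m} - {k}. h x (p j) j)))"
    by (subst sum.swap) (simp add: sum_distrib_left)
  also have "\<dots> = (\<Sum>k<m. fdet m (\<lambda>a b. if b = k then h' a k else h x a b))"
  proof (intro sum.cong refl)
    fix k assume k: "k \<in> {..<m}"
    have "h' (p k) k * (\<Prod>j\<in>{..<m} - {k}. h x (p j) j)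
        = (\<Prod>j<m. if j = k then h' (p j) k else h x (p j) j)" for p
    proof -
      have "(\<Prod>j<m. if j = k then h' (p j) k else h x (p j) j)
         = h' (p k) k * (\<Prod>j\<in>{..<m} - {k}. if j = k then h' (p j) k else h x (p j) j)"
        using k by (subst prod.remove[of _ k]) auto
      then show ?thesis by (auto intro!: arg_cong2[where f="(*)"] prod.cong)
    qed
    then show "(\<Sum>p\<in>?P. signof p * (h' (p k) k * (\<Prod>j\<in>{..<m} - {k}. h x (p j) j)))
        = fdet m (\<lambda>a b. if b = k then h' a k else h x a b)"
      unfolding fdet_leibniz by simp
  qed
  also have "\<dots> = (\<Sum>k<m. \<Sum>l<m. finv m (h x) k l * h' l k) * fdet m (h x)"
    by (simp add: finv_replace_col[OF det] sum_distrib_right)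
  finally have "(\<Sum>p\<in>?P. signof p * (\<Sum>k<m. h' (p k) k * (\<Prod>j\<in>{..<m} - {k}. h x (p j) j)))
    = (\<Sum>k<m. \<Sum>l<m. finv m (h x) k l * h' l k) * fdet m (h x)" .
  moreover have "(\<lambda>x. fdet m (h x)) = (\<lambda>x. \<Sum>p\<in>?P. signof p * (\<Prod>j<m. h x (p j) j))"
    by (rule ext, rule fdet_leibniz)
  ultimately show ?thesis using * by (simp only:)
qed

subsection \<open>Matrices with antisymmetric off-diagonal part\<close>

text \<open>The symmetric part of such a matrix is its diagonal, so the quadratic form is coercive.
  Only a lower bound is fixed, so that adding a nonnegative diagonal such as \<open>S t\<close>
  stays in the class.\<close>

definition skew_diag :: "nat \<Rightarrow> real \<Rightarrow> (nat \<Rightarrow> nat \<Rightarrow> real) \<Rightarrow> bool" where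
  "skew_diag m r h \<longleftrightarrow> (\<forall>i<m. r \<le> h i i) \<and> (\<forall>i<m. \<forall>j<m. i \<noteq> j \<longrightarrow> h i j = - h j i)"

lemma skew_diagI:
  "(\<And>i. i < m \<Longrightarrow> r \<le> h i i) \<Longrightarrow> (\<And>i j. i < m \<Longrightarrow> j < m \<Longrightarrow> i \<noteq> j \<Longrightarrow> h i j = - h j i)
    \<Longrightarrow> skew_diag m r h"
  unfolding skew_diag_def by blast

lemma skew_diag_ge: "skew_diag m r h \<Longrightarrow> i < m \<Longrightarrow> r \<le> h i i"
  unfolding skew_diag_def by blast

lemma skew_diag_skew: "skew_diag m r h \<Longrightarrow> i < m \<Longrightarrow> j < m \<Longrightarrow> i \<noteq> j \<Longrightarrow> h i j = - h j i"
  unfolding skew_diag_def by blast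

text \<open>Off the diagonal, the terms at (i, j) and (j, i) cancel in the quadratic form. All
  resolvent bounds rest on this identity.\<close>

lemma skew_diag_quadratic:
  assumes "skew_diag m r h"
  shows "(\<Sum>i<m. u i * (\<Sum>j<m. h i j * u j)) = (\<Sum>i<m. h i i * (u i)\<^sup>2)"
proof -
  let ?S = "\<Sum>i<m. \<Sum>j<m. u i * h i j * u j"
  have sw: "?S = (\<Sum>i<m. \<Sum>j<m. u j * h j i * u i)" by (rule sum.swap)
  have "?S + ?S = (\<Sum>i<m. \<Sum>j<m. u i * h i j * u j + u j * h j i * u i)"
    by (subst (2) sw) (simp only: sum.distrib)
  also have "\<dots> = (\<Sum>i<m. \<Sum>j<m. if i = j then 2 * (h i i * (u i)\<^sup>2) else 0)"
  proof (intro sum.cong refl)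
    fix i j assume ij: "i \<in> {..<m}" "j \<in> {..<m}"
    have "h i j = - h j i" if "i \<noteq> j"
      using skew_diag_skew[OF assms, of i j] ij that by blast
    then show "u i * h i j * u j + u j * h j i * u i
        = (if i = j then 2 * (h i i * (u i)\<^sup>2) else 0)"
      by (cases "i = j") (simp_all add: power2_eq_square)
  qed
  also have "\<dots> = 2 * (\<Sum>i<m. h i i * (u i)\<^sup>2)"
    by (simp add: sum_distrib_left)
  finally have "?S = (\<Sum>i<m. h i i * (u i)\<^sup>2)" by linarith
  then show ?thesis by (simp add: sum_distrib_left mult.assoc)
qed

lemma skew_diag_transpose: "skew_diag m r h \<Longrightarrow> skew_diag m r (\<lambda>i j. h j i)"
  by (rule skew_diagI, erule (1) skew_diag_ge, rule skew_diag_skew) auto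

lemma skew_diag_mono: "skew_diag m r h \<Longrightarrow> r' \<le> r \<Longrightarrow> skew_diag m r' h"
  by (rule skew_diagI, rule order_trans, assumption, erule (1) skew_diag_ge, rule skew_diag_skew) auto

text \<open>A kernel vector \<open>v\<close> would satisfy
  \<open>0 = v^T h v >= r |v|^2\<close>.\<close>

lemma skew_diag_det_nonzero:
  assumes h: "skew_diag m r h" and r: "0 < r"
  shows "fdet m h \<noteq> 0"
proof
  assume "fdet m h = 0"
  then obtain v where v: "v \<in> carrier_vec m" "v \<noteq> 0\<^sub>v m" "fmat m h *\<^sub>v v = 0\<^sub>v m"
    unfolding fdet_def det_0_iff_vec_prod_zero_field[OF fmat_carrier] by auto
  have "(\<Sum>j<m. h i j * v $ j) = 0" if "i < m" for i
  proof -
    have "(fmat m h *\<^sub>v v) $ i = (\<Sum>j<m. h i j * v $ j)"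
      using that v(1) by (auto simp: scalar_prod_def atLeast0LessThan intro!: sum.cong)
    then show ?thesis using v(3) that by simp
  qed
  then have "(\<Sum>i<m. h i i * (v $ i)\<^sup>2) = 0"
    using skew_diag_quadratic[OF h, of "\<lambda>i. v $ i"] by simp
  moreover have "r * (v $ i)\<^sup>2 \<le> h i i * (v $ i)\<^sup>2" if "i < m" for i
    using skew_diag_ge[OF h that] by (intro mult_right_mono) auto
  then have "(\<Sum>i<m. r * (v $ i)\<^sup>2) \<le> (\<Sum>i<m. h i i * (v $ i)\<^sup>2)"
    by (intro sum_mono) auto
  ultimately have "r * (\<Sum>i<m. (v $ i)\<^sup>2) \<le> 0" by (simp add: sum_distrib_left)
  then have "(\<Sum>i<m. (v $ i)\<^sup>2) \<le> 0" using r by (simp add: mult_le_0_iff)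
  then have "(\<Sum>i<m. (v $ i)\<^sup>2) = 0"
    by (intro order_antisym sum_nonneg) auto
  then have "\<forall>i<m. v $ i = 0" by (subst (asm) sum_nonneg_eq_0_iff) auto
  then have "v = 0\<^sub>v m" using v(1) by (intro eq_vecI) auto
  with v show False by simp
qed

lemma fdet_diag:
  fixes h :: "nat \<Rightarrow> nat \<Rightarrow> real"
  assumes "\<And>i j. i < m \<Longrightarrow> j < m \<Longrightarrow> i \<noteq> j \<Longrightarrow> h i j = 0"
  shows "fdet m h = (\<Prod>i<m. h i i)"
proof -
  have "upper_triangular (fmat m h)"
    using assms by (auto simp: upper_triangular_def)
  from det_upper_triangular[OF this fmat_carrier] show ?thesis
    by (simp add: fdet_def diag_mat_def prod.distinct_set_conv_list[symmetric] atLeast0LessThan)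
qed

text \<open>Shrink the off-diagonal part by a factor \<open>x\<close>. The matrices
  \<open>k x\<close> stay in the class, so their determinant never vanishes and keeps the sign it
  has for the diagonal matrix \<open>k 0\<close>.\<close>

lemma skew_diag_det_pos:
  assumes h: "skew_diag m r h" and r: "0 < r"
  shows "0 < fdet m h"
proof (rule ccontr)
  define k where "k = (\<lambda>x i j. if i = j then h i j else x * h i j)"
  assume neg: "\<not> 0 < fdet m h"
  have k1: "fdet m (k 1) = fdet m h" by (rule fdet_cong) (auto simp: k_def)
  have "skew_diag m r (k x)" for x
  proof (rule skew_diagI)
    fix i j assume "i < m" "j < m" "i \<noteq> j"
    from skew_diag_skew[OF h this] show "k x i j = - k x j i"
      using \<open>i \<noteq> j\<close> by (simp add: k_def)
  qed (simp add: k_def skew_diag_ge[OF h])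
  then have nz: "fdet m (k x) \<noteq> 0" for x using skew_diag_det_nonzero r by blast
  have "fdet m (k 0) = (\<Prod>i<m. h i i)" by (subst fdet_diag) (auto simp: k_def)
  also have "\<dots> > 0" using skew_diag_ge[OF h] r by (intro prod_pos) (auto intro: less_le_trans)
  finally have k0: "0 < fdet m (k 0)" .
  have cont: "isCont (\<lambda>x. fdet m (k x)) x" for x
    unfolding isCont_def by (rule fdet_tendsto) (auto simp: k_def intro!: tendsto_eq_intros)
  have "\<exists>x\<ge>0. x \<le> 1 \<and> fdet m (k x) = 0"
    by (rule IVT2) (use neg k0 k1 cont in auto)
  then show False using nz by blast
qed

context
  fixes m :: nat and r :: real and h :: "nat \<Rightarrow> nat \<Rightarrow> real"
  assumes h: "skew_diag m r h" and r: "0 < r"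
begin

lemma skew_diag_nz: "fdet m h \<noteq> 0"
  using skew_diag_det_nonzero[OF h r] .

lemma finv_transpose:
  assumes "i < m" "j < m"
  shows "finv m (\<lambda>i j. h j i) i j = finv m h j i"
  by (rule finv_unique[OF _ assms]) (use finv_left[OF skew_diag_nz] in \<open>auto simp: mult.commute\<close>)

text \<open>Evaluate the quadratic form of \<open>h\<close> at column \<open>k\<close> of the
  inverse, which \<open>h\<close> maps to the unit vector \<open>k\<close>. This analogue of the
  Ward identity is an equality, and the stability argument uses it as such.\<close>

lemma finv_diag_col:
  assumes k: "k < m"
  shows "finv m h k k = (\<Sum>l<m. h l l * (finv m h l k)\<^sup>2)"
proof -
  have "(\<Sum>l<m. h l l * (finv m h l k)\<^sup>2) = (\<Sum>i<m. finv m h i k * (\<Sum>j<m. h i j * finv m h j k))"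
    using skew_diag_quadratic[OF h, of "\<lambda>l. finv m h l k"] by simp
  also have "\<dots> = (\<Sum>i<m. finv m h i k * (if i = k then 1 else 0))"
    by (intro sum.cong refl) (simp add: finv_right[OF skew_diag_nz] k)
  also have "\<dots> = finv m h k k"
    using k by (simp add: if_distrib[of "\<lambda>x. _ * x"] cong: if_cong)
  finally show ?thesis by simp
qed

end

context
  fixes m :: nat and r :: real and h :: "nat \<Rightarrow> nat \<Rightarrow> real"
  assumes h: "skew_diag m r h" and r: "0 < r"
begin

text \<open>The transpose has the same diagonal, and its inverse is the transposed inverse.\<close>

lemma finv_diag_row:
  assumes k: "k < m"
  shows "finv m h k k = (\<Sum>l<m. h l l * (finv m h k l)\<^sup>2)"
  using finv_diag_col[OF skew_diag_transpose[OF h] r k] k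
  by (simp add: finv_transpose[OF h r])

lemma finv_diag_ge:
  assumes k: "k < m"
  shows "r * (\<Sum>l<m. (finv m h l k)\<^sup>2) \<le> finv m h k k"
  unfolding finv_diag_col[OF h r k] sum_distrib_left
  using skew_diag_ge[OF h] by (intro sum_mono mult_right_mono) auto

lemma finv_diag_nonneg:
  assumes k: "k < m"
  shows "0 \<le> finv m h k k"
proof -
  have "0 \<le> r * (\<Sum>l<m. (finv m h l k)\<^sup>2)"
    using r by (intro mult_nonneg_nonneg sum_nonneg) auto
  then show ?thesis using finv_diag_ge[OF k] by linarith
qed

text \<open>Keeping only the diagonal term of the column sum leaves \<open>r * G^2 <= G\<close> for
  the entry \<open>G = finv m h k k\<close>.\<close>

lemma finv_diag_le:
  assumes k: "k < m"
  shows "finv m h k k \<le> 1 / r"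
proof -
  have "r * (finv m h k k)\<^sup>2 \<le> r * (\<Sum>l<m. (finv m h l k)\<^sup>2)"
    using r k by (intro mult_left_mono member_le_sum) auto
  also note finv_diag_ge[OF k]
  finally have *: "r * (finv m h k k)\<^sup>2 \<le> finv m h k k" .
  show ?thesis
  proof (cases "finv m h k k = 0")
    case False
    then have "0 < finv m h k k" using finv_diag_nonneg[OF k] by simp
    with * show ?thesis using r by (simp add: power2_eq_square field_simps)
  qed (use r in simp)
qed

lemma finv_col_bound:
  assumes k: "k < m"
  shows "(\<Sum>l<m. (finv m h l k)\<^sup>2) \<le> 1 / r\<^sup>2"
proof -
  have "r * (\<Sum>l<m. (finv m h l k)\<^sup>2) \<le> 1 / r"
    using finv_diag_ge[OF k] finv_diag_le[OF k] by linarith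
  then show ?thesis using r by (simp add: power2_eq_square field_simps)
qed

end

context
  fixes m :: nat and r :: real and h :: "nat \<Rightarrow> nat \<Rightarrow> real"
  assumes h: "skew_diag m r h" and r: "0 < r"
begin

lemma finv_row_bound:
  assumes k: "k < m"
  shows "(\<Sum>l<m. (finv m h k l)\<^sup>2) \<le> 1 / r\<^sup>2"
  using finv_col_bound[OF skew_diag_transpose[OF h] r k] k
  by (simp add: finv_transpose[OF h r])

lemma finv_abs_le:
  assumes "a < m" "b < m"
  shows "\<bar>finv m h a b\<bar> \<le> 1 / r"
proof -
  have "(finv m h a b)\<^sup>2 \<le> (\<Sum>l<m. (finv m h l b)\<^sup>2)"
    using assms by (intro member_le_sum) auto
  also have "\<dots> \<le> (1 / r)\<^sup>2" using finv_col_bound[OF h r] assms by (simp add: power_divide)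
  finally show ?thesis using r abs_le_square_iff[of "finv m h a b" "1/r"] by simp
qed

text \<open>With \<open>u = h^-1 b\<close> the form equals \<open>u^T h u\<close>, which is at least
  \<open>r |u|^2\<close>. This gives the lower bound at once and, through Young's inequality, the
  upper one.\<close>

lemma finv_quadratic_bound:
  "0 \<le> (\<Sum>i<m. \<Sum>j<m. b i * finv m h i j * b j)"
  "(\<Sum>i<m. \<Sum>j<m. b i * finv m h i j * b j) \<le> (\<Sum>i<m. (b i)\<^sup>2) / r"
proof -
  define u where "u = (\<lambda>i. \<Sum>j<m. finv m h i j * b j)"
  have hu: "(\<Sum>k<m. h i k * u k) = b i" if i: "i < m" for i
  proof -
    have "(\<Sum>k<m. h i k * u k) = (\<Sum>j<m. (\<Sum>k<m. h i k * finv m h k j) * b j)"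
      unfolding u_def sum_distrib_left sum_distrib_right by (subst sum.swap) (simp add: mult.assoc)
    also have "\<dots> = (\<Sum>j<m. (if i = j then 1 else 0) * b j)"
      by (intro sum.cong refl) (simp add: finv_right[OF skew_diag_nz[OF h r] i])
    also have "\<dots> = b i" using i by (simp add: sum.delta' if_distrib[of "\<lambda>x. x * _"] cong: if_cong)
    finally show ?thesis .
  qed
  have eq: "(\<Sum>i<m. \<Sum>j<m. b i * finv m h i j * b j) = (\<Sum>i<m. b i * u i)"
    by (simp add: u_def sum_distrib_left mult.assoc)
  also have "\<dots> = (\<Sum>i<m. h i i * (u i)\<^sup>2)"
    using skew_diag_quadratic[OF h, of u] hu by (simp add: mult.commute)
  finally have eq2: "(\<Sum>i<m. b i * u i) = (\<Sum>i<m. h i i * (u i)\<^sup>2)" using eq by simp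
  have ge: "r * (\<Sum>i<m. (u i)\<^sup>2) \<le> (\<Sum>i<m. b i * u i)"
    unfolding eq2 sum_distrib_left using skew_diag_ge[OF h]
    by (intro sum_mono mult_right_mono) auto
  show "0 \<le> (\<Sum>i<m. \<Sum>j<m. b i * finv m h i j * b j)"
  proof -
    have "0 \<le> r * (\<Sum>i<m. (u i)\<^sup>2)"
      using r by (intro mult_nonneg_nonneg sum_nonneg) auto
    then show ?thesis unfolding eq using ge by linarith
  qed
  \<comment> \<open>Young's inequality with weight \<open>r\<close>: the term in \<open>u\<close> is
    then at most half of the form itself.\<close>
  have "b i * u i \<le> r / 2 * (u i)\<^sup>2 + 1 / (2 * r) * (b i)\<^sup>2" for i
  proof -
    have "0 \<le> (r * u i - b i)\<^sup>2 / (2 * r)" using r by simp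
    also have "\<dots> = r / 2 * (u i)\<^sup>2 + 1 / (2 * r) * (b i)\<^sup>2 - b i * u i"
      using r by (simp add: power2_eq_square field_simps)
    finally show ?thesis by simp
  qed
  then have "(\<Sum>i<m. b i * u i) \<le> r / 2 * (\<Sum>i<m. (u i)\<^sup>2) + 1 / (2 * r) * (\<Sum>i<m. (b i)\<^sup>2)"
    unfolding sum_distrib_left sum.distrib[symmetric] by (intro sum_mono)
  then show "(\<Sum>i<m. \<Sum>j<m. b i * finv m h i j * b j) \<le> (\<Sum>i<m. (b i)\<^sup>2) / r"
    unfolding eq using ge by simp
qed

text \<open>Let \<open>b\<close> be row \<open>k\<close> without its diagonal entry. Expanding along
  row \<open>k\<close> and then along column \<open>k\<close> gives
  \<open>1 / h k k - finv m h k k = q / (h k k)\<^sup>2\<close> with \<open>q = b^T h^-1 b\<close>,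
  and \<open>finv_quadratic_bound\<close> applies to \<open>q\<close>. The correction is thus of
  second order in the off-diagonal entries.\<close>

lemma finv_diag_approx:
  assumes k: "k < m"
  shows "finv m h k k \<le> 1 / h k k"
    and "1 / h k k - finv m h k k \<le> (\<Sum>j<m. if j = k then 0 else (h k j)\<^sup>2) / r ^ 3"
proof -
  define b where "b = (\<lambda>j. if j = k then 0 else h k j)"
  have nz: "fdet m h \<noteq> 0" using skew_diag_nz[OF h r] .
  have hk: "r \<le> h k k" using skew_diag_ge[OF h k] .
  have hkp: "0 < h k k" using hk r by simp
  have g: "finv m h k k * h k k = 1 - (\<Sum>j<m. b j * finv m h j k)"
  proof -
    have "1 = (\<Sum>j<m. h k j * finv m h j k)" using finv_right[OF nz k k] by simp
    also have "\<dots> = (\<Sum>j<m. (if j = k then h k k * finv m h k k else 0) + b j * finv m h j k)"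
      by (intro sum.cong refl) (auto simp: b_def)
    also have "\<dots> = h k k * finv m h k k + (\<Sum>j<m. b j * finv m h j k)"
      using k by (simp add: sum.distrib)
    finally show ?thesis by (simp add: mult.commute)
  qed
  \<comment> \<open>Antisymmetry makes column \<open>k\<close> equal to \<open>- b\<close> off the
    diagonal, so that the second expansion produces the quadratic form in one and the same
    vector.\<close>
  have col: "finv m h j k * h k k = (\<Sum>l<m. finv m h j l * b l)" if "j < m" "j \<noteq> k" for j
  proof -
    have skew: "h l k = - h k l" if "l < m" "l \<noteq> k" for l
      using skew_diag_skew[OF h \<open>l < m\<close> k \<open>l \<noteq> k\<close>] .
    have "0 = (\<Sum>l<m. finv m h j l * h l k)" using finv_left[OF nz \<open>j < m\<close> k] \<open>j \<noteq> k\<close> by simp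
    also have "\<dots> = (\<Sum>l<m. (if l = k then finv m h j k * h k k else 0) - finv m h j l * b l)"
    proof (intro sum.cong refl)
      fix l assume "l \<in> {..<m}"
      then show "finv m h j l * h l k = (if l = k then finv m h j k * h k k else 0) - finv m h j l * b l"
        using skew[of l] by (cases "l = k") (simp_all add: b_def)
    qed
    also have "\<dots> = finv m h j k * h k k - (\<Sum>l<m. finv m h j l * b l)"
      using k by (simp add: sum_subtractf)
    finally show ?thesis by simp
  qed
  define q where "q = (\<Sum>i<m. \<Sum>j<m. b i * finv m h i j * b j)"
  have "(\<Sum>j<m. b j * finv m h j k) * h k k = q"
    unfolding q_def sum_distrib_right
  proof (intro sum.cong refl)
    fix j assume j: "j \<in> {..<m}"
    show "b j * finv m h j k * h k k = (\<Sum>l<m. b j * finv m h j l * b l)"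
    proof (cases "j = k")
      case False
      then show ?thesis using col[of j] j by (simp add: sum_distrib_left mult.assoc)
    qed (simp add: b_def)
  qed
  then have q: "(\<Sum>j<m. b j * finv m h j k) = q / h k k" using hkp by (simp add: field_simps)
  have "finv m h k k = (1 - q / h k k) / h k k"
    using g hkp unfolding q by (simp add: eq_divide_eq)
  then have diff: "1 / h k k - finv m h k k = q / (h k k)\<^sup>2"
    by (simp add: diff_divide_distrib power2_eq_square)
  have q0: "0 \<le> q" "q \<le> (\<Sum>i<m. (b i)\<^sup>2) / r"
    using finv_quadratic_bound[of b] by (auto simp: q_def)
  have "0 \<le> q / (h k k)\<^sup>2" using q0 by simp
  then show "finv m h k k \<le> 1 / h k k" using diff by linarith
  have "r\<^sup>2 \<le> (h k k)\<^sup>2" using r hk by (intro power_mono) auto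
  then have "q / (h k k)\<^sup>2 \<le> ((\<Sum>i<m. (b i)\<^sup>2) / r) / r\<^sup>2"
    using q0 r by (intro frac_le) auto
  also have "\<dots> = (\<Sum>i<m. (b i)\<^sup>2) / r ^ 3"
    by (simp add: power2_eq_square power3_eq_cube)
  also have "(\<Sum>i<m. (b i)\<^sup>2) = (\<Sum>j<m. if j = k then 0 else (h k j)\<^sup>2)"
    by (intro sum.cong refl) (simp add: b_def)
  finally show "1 / h k k - finv m h k k \<le> (\<Sum>j<m. if j = k then 0 else (h k j)\<^sup>2) / r ^ 3"
    unfolding diff .
qed

end

lemma ln_fdet_has_derivative:
  fixes h :: "real \<Rightarrow> nat \<Rightarrow> nat \<Rightarrow> real"
  assumes deriv: "\<And>i j. i < m \<Longrightarrow> j < m \<Longrightarrow> ((\<lambda>x. h x i j) has_real_derivative h' i j) (at x)"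
    and h: "skew_diag m r (h x)" and r: "0 < r"
  shows "((\<lambda>x. ln (fdet m (h x))) has_real_derivative
     (\<Sum>k<m. \<Sum>l<m. finv m (h x) k l * h' l k)) (at x)"
proof -
  have p: "0 < fdet m (h x)" using skew_diag_det_pos[OF h r] .
  then have nz: "fdet m (h x) \<noteq> 0" by simp
  have D: "((\<lambda>x. fdet m (h x)) has_real_derivative
     (\<Sum>k<m. \<Sum>l<m. finv m (h x) k l * h' l k) * fdet m (h x)) (at x)"
    by (rule fdet_has_derivative[OF deriv nz])
  have cancel: "inverse a * (b * a) = b" if "a \<noteq> 0" for a b :: real
    using that by simp
  show ?thesis
    using DERIV_chain2[OF DERIV_ln[OF p] D] unfolding cancel[OF nz] .
qed

subsection \<open>The Efron--Stein inequality\<close>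

lemma (in prob_space) bounded_integrable:
  fixes g :: "'a \<Rightarrow> real"
  assumes "g \<in> borel_measurable M" "\<And>x. \<bar>g x\<bar> \<le> B"
  shows "integrable M g"
  using assms by (intro integrable_const_bound[of _ B]) auto

lemma (in prob_space) abs_integral_le:
  fixes g :: "'a \<Rightarrow> real"
  assumes "\<And>x. \<bar>g x\<bar> \<le> B"
  shows "\<bar>integral\<^sup>L M g\<bar> \<le> B"
proof (cases "integrable M g")
  case True
  have "\<bar>integral\<^sup>L M g\<bar> \<le> (\<integral>x. \<bar>g x\<bar> \<partial>M)" by (rule integral_abs_bound)
  also have "\<dots> \<le> (\<integral>x. B \<partial>M)" using True assms by (intro integral_mono) auto
  finally show ?thesis by (simp add: prob_space)
next
  case False
  then show ?thesis
    using assms[of undefined] by (simp add: not_integrable_integral_eq)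
qed

lemma (in prob_space) second_moment_decomp:
  fixes g :: "'a \<Rightarrow> real"
  assumes "g \<in> borel_measurable M" "\<And>x. \<bar>g x\<bar> \<le> B"
  shows "(\<integral>x. (g x - a)\<^sup>2 \<partial>M) = (\<integral>x. (g x - integral\<^sup>L M g)\<^sup>2 \<partial>M) + (integral\<^sup>L M g - a)\<^sup>2"
proof -
  have i1: "integrable M g" by (rule bounded_integrable[OF assms])
  have "(g x)\<^sup>2 \<le> B\<^sup>2" for x
    using power_mono[OF assms(2)[of x] abs_ge_zero, of 2] by simp
  then have i2: "integrable M (\<lambda>x. (g x)\<^sup>2)"
    using assms(1) by (intro bounded_integrable[of _ "B\<^sup>2"]) auto
  have *: "(\<integral>x. (g x - c)\<^sup>2 \<partial>M) = (\<integral>x. (g x)\<^sup>2 \<partial>M) - 2 * c * integral\<^sup>L M g + c\<^sup>2" for c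
  proof -
    have "(\<integral>x. (g x - c)\<^sup>2 \<partial>M) = (\<integral>x. (g x)\<^sup>2 - 2 * c * g x + c\<^sup>2 \<partial>M)"
      by (intro Bochner_Integration.integral_cong refl) (simp add: power2_diff)
    then show ?thesis using i1 i2 by (simp add: prob_space)
  qed
  show ?thesis unfolding * by (simp add: power2_eq_square algebra_simps)
qed

lemma (in prob_space) second_moment_min:
  fixes g :: "'a \<Rightarrow> real"
  assumes "g \<in> borel_measurable M" "\<And>x. \<bar>g x\<bar> \<le> B"
  shows "(\<integral>x. (g x - integral\<^sup>L M g)\<^sup>2 \<partial>M) \<le> (\<integral>x. (g x - a)\<^sup>2 \<partial>M)"
  using second_moment_decomp[OF assms, of a] by simp

lemma (in prob_space) square_integral_le:
  fixes g :: "'a \<Rightarrow> real"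
  assumes "g \<in> borel_measurable M" "\<And>x. \<bar>g x\<bar> \<le> B"
  shows "(integral\<^sup>L M g)\<^sup>2 \<le> (\<integral>x. (g x)\<^sup>2 \<partial>M)"
proof -
  have "0 \<le> (\<integral>x. (g x - integral\<^sup>L M g)\<^sup>2 \<partial>M)" by (intro integral_nonneg_AE) auto
  then show ?thesis using second_moment_decomp[OF assms, of 0] by simp
qed

text \<open>Every index carries a distribution, also outside the finite set over which products are
  later formed, because product measures are set up for a family indexed by the whole type.\<close>

locale real_noise =
  fixes \<mu> :: "'i \<Rightarrow> real measure"
  assumes noise: "\<And>i. real_distribution (\<mu> i)"

sublocale real_noise \<subseteq> product_sigma_finite \<mu>
proof (unfold product_sigma_finite_def, intro allI)
  fix i
  interpret real_distribution "\<mu> i" by (rule noise)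
  show "sigma_finite_measure (\<mu> i)" by (rule sigma_finite_measure_axioms)
qed

context real_noise
begin

lemma noise_sets [simp, measurable_cong]: "sets (\<mu> i) = sets borel"
  using noise[of i] by (simp add: real_distribution_def real_distribution_axioms_def)

lemma noise_prob: "prob_space (\<mu> i)"
  using noise[of i] by (simp add: real_distribution_def)

lemma noise_space [simp]: "space (\<mu> i) = UNIV"
  using sets_eq_imp_space_eq[OF noise_sets[of i]] by simp

lemma Pi_noise_prob: "prob_space (PiM I \<mu>)"
  by (rule prob_space_PiM) (rule noise_prob)

lemma fun_upd_measurable:
  assumes f: "f \<in> borel_measurable (PiM (insert i J) \<mu>)"
  shows "(\<lambda>(x, y). f (x(i := y))) \<in> borel_measurable (PiM J \<mu> \<Otimes>\<^sub>M \<mu> i)"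
  using measurable_compose[OF measurable_add_dim f] by (simp add: case_prod_beta')

lemma fun_upd_measurable_snd:
  assumes f: "f \<in> borel_measurable (PiM (insert i J) \<mu>)" and x: "x \<in> space (PiM J \<mu>)"
  shows "(\<lambda>y. f (x(i := y))) \<in> borel_measurable (\<mu> i)"
  using measurable_Pair2[OF fun_upd_measurable[OF f] x] by simp

lemma integral_upd_measurable:
  fixes f :: "('i \<Rightarrow> real) \<Rightarrow> real"
  assumes f: "f \<in> borel_measurable (PiM (insert i J) \<mu>)"
  shows "(\<lambda>x. \<integral>y. f (x(i := y)) \<partial>\<mu> i) \<in> borel_measurable (PiM J \<mu>)"
  using sigma_finite_measure.borel_measurable_lebesgue_integral[OF sigma_finite_measures fun_upd_measurable[OF f]]
  by simp

lemma coordinate_measurable: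
  assumes "p \<in> I"
  shows "(\<lambda>x. x p) \<in> borel_measurable (PiM I \<mu>)"
  using measurable_component_singleton[OF assms, of \<mu>] measurable_cong_sets[OF refl noise_sets[of p]]
  by blast

text \<open>\<open>F k\<close> may be any bounded measurable function that ignores coordinate
  \<open>k\<close>, since conditional means minimise the second moment; later that coordinate is
  just set to \<open>0\<close>. In the induction the variance splits into the part from the new
  coordinate \<open>i\<close> and the variance of the average \<open>h\<close> over it, to which the
  hypothesis applies with the averaged functions \<open>H k\<close>.\<close>

lemma efron_stein:
  fixes f :: "('i \<Rightarrow> real) \<Rightarrow> real" and F :: "'i \<Rightarrow> ('i \<Rightarrow> real) \<Rightarrow> real"
  assumes "finite I"
    and "f \<in> borel_measurable (PiM I \<mu>)" "\<And>x. \<bar>f x\<bar> \<le> B"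
    and "\<And>k. k \<in> I \<Longrightarrow> F k \<in> borel_measurable (PiM I \<mu>)"
    and "\<And>k x. k \<in> I \<Longrightarrow> \<bar>F k x\<bar> \<le> B"
    and "\<And>k x y. k \<in> I \<Longrightarrow> F k (x(k := y)) = F k x"
  shows "(\<integral>x. (f x - (\<integral>x. f x \<partial>PiM I \<mu>))\<^sup>2 \<partial>PiM I \<mu>) \<le> (\<Sum>k\<in>I. \<integral>x. (f x - F k x)\<^sup>2 \<partial>PiM I \<mu>)"
  using assms
proof (induction I arbitrary: f F rule: finite_induct)
  case empty
  interpret prob_space "PiM {} \<mu>" by (rule Pi_noise_prob)
  have f0: "f x = f (\<lambda>_. undefined)" if "x \<in> space (PiM {} \<mu>)" for x
    using that by (simp add: space_PiM_empty)
  have "(\<integral>x. f x \<partial>PiM {} \<mu>) = (\<integral>x. f (\<lambda>_. undefined) \<partial>PiM {} \<mu>)"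
    by (intro Bochner_Integration.integral_cong refl f0)
  then have c: "(\<integral>x. f x \<partial>PiM {} \<mu>) = f (\<lambda>_. undefined)" by (simp add: prob_space)
  have "(f x - (\<integral>x. f x \<partial>PiM {} \<mu>))\<^sup>2 = 0" if "x \<in> space (PiM {} \<mu>)" for x
    using f0[OF that] c by simp
  then have "(\<integral>x. (f x - (\<integral>x. f x \<partial>PiM {} \<mu>))\<^sup>2 \<partial>PiM {} \<mu>) = (\<integral>x. 0 \<partial>PiM {} \<mu>)"
    by (intro Bochner_Integration.integral_cong refl)
  then show ?case by simp
next
  case (insert i J)
  note f = insert.prems(1,2) and F = insert.prems(3,4,5)
  interpret I: prob_space "PiM (insert i J) \<mu>" by (rule Pi_noise_prob)
  interpret J: prob_space "PiM J \<mu>" by (rule Pi_noise_prob)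
  interpret U: prob_space "\<mu> i" by (rule noise_prob)
  have B: "0 \<le> B" using f(2)[of undefined] by (meson abs_ge_zero order_trans)
  have sq: "\<bar>(u - v)\<^sup>2\<bar> \<le> (2 * B)\<^sup>2" if "\<bar>u\<bar> \<le> B" "\<bar>v\<bar> \<le> B" for u v :: real
  proof -
    have "\<bar>u - v\<bar> \<le> 2 * B" using that by linarith
    then have "\<bar>u - v\<bar>\<^sup>2 \<le> (2 * B)\<^sup>2" by (intro power_mono) auto
    then show ?thesis by simp
  qed
  define h where "h = (\<lambda>x. \<integral>y. f (x(i := y)) \<partial>\<mu> i)"
  define H where "H = (\<lambda>k x. \<integral>y. F k (x(i := y)) \<partial>\<mu> i)"
  have h_meas: "h \<in> borel_measurable (PiM J \<mu>)"
    unfolding h_def by (rule integral_upd_measurable[OF f(1)])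
  have H_meas: "H k \<in> borel_measurable (PiM J \<mu>)" if "k \<in> insert i J" for k
    unfolding H_def by (rule integral_upd_measurable[OF F(1)[OF that]])
  have h_bound: "\<bar>h x\<bar> \<le> B" for x unfolding h_def by (rule U.abs_integral_le[OF f(2)])
  have H_bound: "\<bar>H k x\<bar> \<le> B" if "k \<in> insert i J" for k x
    unfolding H_def by (rule U.abs_integral_le[OF F(2)[OF that]])
  have H_inv: "H k (x(k := y)) = H k x" if k: "k \<in> J" for k x y
  proof -
    have "k \<noteq> i" using k insert.hyps by auto
    then have "F k ((x(k := y))(i := u)) = F k (x(i := u))" for u
      using F(3)[of k "x(i := u)" y] k by (simp only: fun_upd_twist[OF \<open>k \<noteq> i\<close>] insertI2)
    then show ?thesis unfolding H_def by (simp only:)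
  qed
  have fub: "(\<integral>x. g x \<partial>PiM (insert i J) \<mu>) = (\<integral>x. \<integral>y. g (x(i := y)) \<partial>\<mu> i \<partial>PiM J \<mu>)"
    if "g \<in> borel_measurable (PiM (insert i J) \<mu>)" "\<And>x. \<bar>g x\<bar> \<le> K" for g :: "('i \<Rightarrow> real) \<Rightarrow> real" and K
    by (rule product_integral_insert[OF insert.hyps I.bounded_integrable[OF that]])
  have iter: "integrable (PiM J \<mu>) (\<lambda>x. \<integral>y. g (x(i := y)) \<partial>\<mu> i)"
    if "g \<in> borel_measurable (PiM (insert i J) \<mu>)" "\<And>x. \<bar>g x\<bar> \<le> K" for g :: "('i \<Rightarrow> real) \<Rightarrow> real" and K
    by (rule J.bounded_integrable[OF integral_upd_measurable[OF that(1)] U.abs_integral_le[OF that(2)]])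
  define c where "c = (\<integral>x. f x \<partial>PiM (insert i J) \<mu>)"
  have c: "c = (\<integral>x. h x \<partial>PiM J \<mu>)" unfolding c_def h_def by (rule fub[OF f])
  have c_bound: "\<bar>c\<bar> \<le> B" unfolding c_def by (rule I.abs_integral_le[OF f(2)])
  have fm: "(\<lambda>x. (f x - a)\<^sup>2) \<in> borel_measurable (PiM (insert i J) \<mu>)" for a
    using f(1) by measurable
  have Fm: "(\<lambda>x. (f x - F k x)\<^sup>2) \<in> borel_measurable (PiM (insert i J) \<mu>)" if "k \<in> insert i J" for k
    using f(1) F(1)[OF that] by measurable
  have hm: "(\<lambda>x. (h x - a)\<^sup>2) \<in> borel_measurable (PiM J \<mu>)" for a using h_meas by measurable
  have hHm: "(\<lambda>x. (h x - H k x)\<^sup>2) \<in> borel_measurable (PiM J \<mu>)" if "k \<in> insert i J" for k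
    using h_meas H_meas[OF that] by measurable
  \<comment> \<open>Variance decomposition in coordinate \<open>i\<close> with the others frozen.
    Replacing the mean \<open>h x\<close> by \<open>F i\<close>, which is constant in that
    coordinate, can only increase the second moment.\<close>
  have step1: "(\<integral>y. (f (x(i := y)) - c)\<^sup>2 \<partial>\<mu> i)
      \<le> (\<integral>y. (f (x(i := y)) - F i (x(i := y)))\<^sup>2 \<partial>\<mu> i) + (h x - c)\<^sup>2"
    if x: "x \<in> space (PiM J \<mu>)" for x
  proof -
    note m = fun_upd_measurable_snd[OF f(1) x]
    have "(\<integral>y. (f (x(i := y)) - c)\<^sup>2 \<partial>\<mu> i)
        = (\<integral>y. (f (x(i := y)) - h x)\<^sup>2 \<partial>\<mu> i) + (h x - c)\<^sup>2"
      unfolding h_def by (rule U.second_moment_decomp[OF m f(2)])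
    moreover have "(\<integral>y. (f (x(i := y)) - h x)\<^sup>2 \<partial>\<mu> i) \<le> (\<integral>y. (f (x(i := y)) - F i x)\<^sup>2 \<partial>\<mu> i)"
      unfolding h_def by (rule U.second_moment_min[OF m f(2)])
    moreover have "F i (x(i := y)) = F i x" for y by (rule F(3)) simp
    ultimately show ?thesis by simp
  qed
  \<comment> \<open>Jensen's inequality for the average over coordinate \<open>i\<close>.\<close>
  have step2: "(h x - H k x)\<^sup>2 \<le> (\<integral>y. (f (x(i := y)) - F k (x(i := y)))\<^sup>2 \<partial>\<mu> i)"
    if x: "x \<in> space (PiM J \<mu>)" and k: "k \<in> insert i J" for x k
  proof -
    note m = fun_upd_measurable_snd[OF f(1) x] fun_upd_measurable_snd[OF F(1)[OF k] x]
    have "h x - H k x = (\<integral>y. f (x(i := y)) - F k (x(i := y)) \<partial>\<mu> i)"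
      unfolding h_def H_def
      by (rule Bochner_Integration.integral_diff[symmetric])
         (rule U.bounded_integrable[OF m(1) f(2)], rule U.bounded_integrable[OF m(2) F(2)[OF k]])
    moreover have "(\<integral>y. f (x(i := y)) - F k (x(i := y)) \<partial>\<mu> i)\<^sup>2
        \<le> (\<integral>y. (f (x(i := y)) - F k (x(i := y)))\<^sup>2 \<partial>\<mu> i)"
    proof (rule U.square_integral_le)
      show "(\<lambda>y. f (x(i := y)) - F k (x(i := y))) \<in> borel_measurable (\<mu> i)" using m by measurable
      show "\<bar>f (x(i := y)) - F k (x(i := y))\<bar> \<le> 2 * B" for y
        using f(2)[of "x(i := y)"] F(2)[OF k, of "x(i := y)"] by linarith
    qed
    ultimately show ?thesis by simp
  qed
  have "(\<integral>x. (f x - c)\<^sup>2 \<partial>PiM (insert i J) \<mu>) = (\<integral>x. \<integral>y. (f (x(i := y)) - c)\<^sup>2 \<partial>\<mu> i \<partial>PiM J \<mu>)"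
    by (rule fub[OF fm sq[OF f(2) c_bound]])
  also have "\<dots> \<le> (\<integral>x. (\<integral>y. (f (x(i := y)) - F i (x(i := y)))\<^sup>2 \<partial>\<mu> i) + (h x - c)\<^sup>2 \<partial>PiM J \<mu>)"
  proof (rule integral_mono)
    show "integrable (PiM J \<mu>) (\<lambda>x. \<integral>y. (f (x(i := y)) - c)\<^sup>2 \<partial>\<mu> i)"
      by (rule iter[OF fm sq[OF f(2) c_bound]])
    show "integrable (PiM J \<mu>) (\<lambda>x. (\<integral>y. (f (x(i := y)) - F i (x(i := y)))\<^sup>2 \<partial>\<mu> i) + (h x - c)\<^sup>2)"
      by (intro Bochner_Integration.integrable_add iter[OF Fm sq[OF f(2) F(2)]]
          J.bounded_integrable[OF hm sq[OF h_bound c_bound]]) auto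
  qed (rule step1)
  also have "\<dots> = (\<integral>x. (\<integral>y. (f (x(i := y)) - F i (x(i := y)))\<^sup>2 \<partial>\<mu> i) \<partial>PiM J \<mu>)
      + (\<integral>x. (h x - c)\<^sup>2 \<partial>PiM J \<mu>)"
    by (intro Bochner_Integration.integral_add iter[OF Fm sq[OF f(2) F(2)]]
        J.bounded_integrable[OF hm sq[OF h_bound c_bound]]) auto
  also have "(\<integral>x. (\<integral>y. (f (x(i := y)) - F i (x(i := y)))\<^sup>2 \<partial>\<mu> i) \<partial>PiM J \<mu>)
      = (\<integral>x. (f x - F i x)\<^sup>2 \<partial>PiM (insert i J) \<mu>)"
    by (rule fub[symmetric, OF Fm sq[OF f(2) F(2)]]) auto
  also have "(\<integral>x. (h x - c)\<^sup>2 \<partial>PiM J \<mu>) \<le> (\<Sum>k\<in>J. \<integral>x. (h x - H k x)\<^sup>2 \<partial>PiM J \<mu>)"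
    unfolding c by (rule insert.IH[OF h_meas h_bound H_meas H_bound H_inv]) auto
  also have "\<dots> \<le> (\<Sum>k\<in>J. \<integral>x. (f x - F k x)\<^sup>2 \<partial>PiM (insert i J) \<mu>)"
  proof (rule sum_mono)
    fix k assume "k \<in> J"
    then have k: "k \<in> insert i J" by simp
    have "(\<integral>x. (h x - H k x)\<^sup>2 \<partial>PiM J \<mu>)
        \<le> (\<integral>x. (\<integral>y. (f (x(i := y)) - F k (x(i := y)))\<^sup>2 \<partial>\<mu> i) \<partial>PiM J \<mu>)"
      by (rule integral_mono[OF J.bounded_integrable[OF hHm[OF k] sq[OF h_bound H_bound[OF k]]]
            iter[OF Fm[OF k] sq[OF f(2) F(2)[OF k]]] step2[OF _ k]])
    also have "\<dots> = (\<integral>x. (f x - F k x)\<^sup>2 \<partial>PiM (insert i J) \<mu>)"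
      by (rule fub[symmetric, OF Fm[OF k] sq[OF f(2) F(2)[OF k]]])
    finally show "(\<integral>x. (h x - H k x)\<^sup>2 \<partial>PiM J \<mu>) \<le> (\<integral>x. (f x - F k x)\<^sup>2 \<partial>PiM (insert i J) \<mu>)" .
  qed
  finally show ?case using insert.hyps by (simp add: c_def)
qed

lemma coordinate_integrable:
  fixes g :: "real \<Rightarrow> real"
  assumes I: "finite I" "p \<in> I" and g: "integrable (\<mu> p) g"
  shows "integrable (PiM I \<mu>) (\<lambda>x. g (x p))" "(\<integral>x. g (x p) \<partial>PiM I \<mu>) = (\<integral>u. g u \<partial>\<mu> p)"
proof -
  have d: "distr (PiM I \<mu>) (\<mu> p) (\<lambda>x. x p) = \<mu> p"
    using distr_PiM_component[of I \<mu> p] I noise_prob by auto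
  have m: "(\<lambda>x. x p) \<in> measurable (PiM I \<mu>) (\<mu> p)"
    using I by (intro measurable_component_singleton)
  show "integrable (PiM I \<mu>) (\<lambda>x. g (x p))"
    using integrable_distr_eq[OF m, of g] g unfolding d by auto
  show "(\<integral>x. g (x p) \<partial>PiM I \<mu>) = (\<integral>u. g u \<partial>\<mu> p)"
    using integral_distr[OF m, of g] g unfolding d by auto
qed

lemma integrable_coordinate_times:
  fixes g :: "real \<Rightarrow> real"
  assumes I: "finite I" "p \<in> I" and g: "integrable (\<mu> p) g"
    and f: "f \<in> borel_measurable (PiM I \<mu>)" "\<And>x. \<bar>f x\<bar> \<le> B"
  shows "integrable (PiM I \<mu>) (\<lambda>x. g (x p) * f x)"
proof (rule Bochner_Integration.integrable_bound)
  show "integrable (PiM I \<mu>) (\<lambda>x. B * g (x p))"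
    using coordinate_integrable[OF I g] by simp
  show "(\<lambda>x. g (x p) * f x) \<in> borel_measurable (PiM I \<mu>)"
    using coordinate_integrable[OF I g] f by auto
  have "\<bar>g (x p) * f x\<bar> \<le> \<bar>B * g (x p)\<bar>" for x
    using mult_left_mono[OF f(2)[of x] abs_ge_zero[of "g (x p)"]] f(2)[of x] by (simp add: abs_mult mult.commute)
  then show "AE x in PiM I \<mu>. norm (g (x p) * f x) \<le> norm (B * g (x p))" by simp
qed

text \<open>Fubini in coordinate \<open>p\<close>, in which \<open>f\<close> is constant.\<close>

lemma integral_coordinate_indep:
  fixes g :: "real \<Rightarrow> real"
  assumes I: "finite I" "p \<in> I" and g: "integrable (\<mu> p) g"
    and f: "f \<in> borel_measurable (PiM I \<mu>)" "\<And>x. \<bar>f x\<bar> \<le> B" and inv: "\<And>x y. f (x(p := y)) = f x"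
  shows "(\<integral>x. g (x p) * f x \<partial>PiM I \<mu>) = (\<integral>u. g u \<partial>\<mu> p) * (\<integral>x. f x \<partial>PiM I \<mu>)"
proof -
  define J where "J = I - {p}"
  have J: "finite J" "p \<notin> J" "insert p J = I" using I by (auto simp: J_def)
  interpret prob_space "PiM I \<mu>" by (rule Pi_noise_prob)
  interpret U: prob_space "\<mu> p" by (rule noise_prob)
  have "(\<integral>x. g (x p) * f x \<partial>PiM I \<mu>) = (\<integral>x. \<integral>y. g y * f (x(p := y)) \<partial>\<mu> p \<partial>PiM J \<mu>)"
    using product_integral_insert[OF J(1,2), of "\<lambda>x. g (x p) * f x"]
      integrable_coordinate_times[OF I g f] by (simp add: J)
  also have "\<dots> = (\<integral>u. g u \<partial>\<mu> p) * (\<integral>x. f x \<partial>PiM J \<mu>)"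
    by (simp add: inv)
  also have "(\<integral>x. f x \<partial>PiM J \<mu>) = (\<integral>x. f x \<partial>PiM I \<mu>)"
    using product_integral_insert[OF J(1,2), of f] bounded_integrable[OF f]
    using U.prob_space by (simp add: J inv)
  finally show ?thesis .
qed

end

subsection \<open>Stability of the self-consistent equation\<close>

lemma sum_abs_mult_le:
  fixes f g :: "'b \<Rightarrow> real"
  assumes "(\<Sum>i\<in>A. (f i)\<^sup>2) \<le> a\<^sup>2" "(\<Sum>i\<in>A. (g i)\<^sup>2) \<le> b\<^sup>2" "0 \<le> a" "0 \<le> b"
  shows "(\<Sum>i\<in>A. \<bar>f i\<bar> * \<bar>g i\<bar>) \<le> a * b"
proof -
  have "(\<Sum>i\<in>A. \<bar>f i\<bar> * \<bar>g i\<bar>) \<le> L2_set f A * L2_set g A" by (rule L2_set_mult_ineq)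
  also have "\<dots> \<le> a * b"
    using assms by (intro mult_mono) (auto simp: L2_set_def intro!: real_le_lsqrt sum_nonneg)
  finally show ?thesis .
qed

definition add_diag :: "(nat \<Rightarrow> nat \<Rightarrow> real) \<Rightarrow> (nat \<Rightarrow> real) \<Rightarrow> nat \<Rightarrow> nat \<Rightarrow> real" where
  "add_diag h e i j = h i j + (if i = j then e i else 0)"

lemma skew_diag_add_diag:
  assumes "skew_diag m r h" "\<And>i. i < m \<Longrightarrow> 0 \<le> e i"
  shows "skew_diag m r (add_diag h e)"
proof (rule skew_diagI)
  fix i assume "i < m"
  then show "r \<le> add_diag h e i i"
    using skew_diag_ge[OF assms(1), of i] assms(2)[of i] by (simp add: add_diag_def)
next
  fix i j assume "i < m" "j < m" "i \<noteq> j"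
  then show "add_diag h e i j = - add_diag h e j i"
    using skew_diag_skew[OF assms(1), of i j] by (simp add: add_diag_def)
qed

lemma finv_add_diag_diff:
  assumes h: "skew_diag m r h" and r: "0 < r"
    and e: "\<And>i. i < m \<Longrightarrow> 0 \<le> e i" and f: "\<And>i. i < m \<Longrightarrow> 0 \<le> f i" and k: "k < m"
  shows "finv m (add_diag h e) k k - finv m (add_diag h f) k k
    = (\<Sum>l<m. finv m (add_diag h e) k l * (f l - e l) * finv m (add_diag h f) l k)"
proof -
  have "finv m (add_diag h e) k k - finv m (add_diag h f) k k
    = (\<Sum>i<m. \<Sum>l<m. finv m (add_diag h e) k i * (add_diag h f i l - add_diag h e i l) * finv m (add_diag h f) l k)"
    by (intro resolvent_identity k skew_diag_nz[OF _ r] skew_diag_add_diag[OF h] e f)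
  also have "\<dots> = (\<Sum>i<m. \<Sum>l<m. if l = i then finv m (add_diag h e) k i * (f i - e i) * finv m (add_diag h f) i k else 0)"
    by (intro sum.cong refl) (auto simp: add_diag_def)
  finally show ?thesis by simp
qed

text \<open>With \<open>a = r + S g\<close>, \<open>b = r + S t\<close> one has \<open>R\<^sub>k\<^sub>k = \<Sum>\<^sub>l a\<^sub>l R\<^sub>k\<^sub>l\<^sup>2\<close> for
  \<open>R = (h + diag (S g))\<^sup>-\<^sup>1\<close>, and likewise for \<open>t\<close>, so that by the Cauchy--Schwarz inequality the
  linearised map is a contraction in the norm \<open>max \<bar>e\<^sub>i\<bar> / sqrt (a\<^sub>i b\<^sub>i)\<close>.\<close>

lemma fixed_point_stability:
  fixes S :: "nat \<Rightarrow> nat \<Rightarrow> real" and g t rr :: "nat \<Rightarrow> real"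
  assumes h: "skew_diag m r h" and diag: "\<And>i. i < m \<Longrightarrow> h i i = r" and r: "0 < r"
    and S0: "\<And>i j. 0 \<le> S i j" and S1: "\<And>i. i < m \<Longrightarrow> (\<Sum>j<m. S i j) \<le> K"
    and g: "\<And>i. i < m \<Longrightarrow> 0 \<le> g i" "\<And>i. i < m \<Longrightarrow> g i \<le> 1 / r"
    and t: "\<And>i. i < m \<Longrightarrow> 0 \<le> t i"
      "\<And>i. i < m \<Longrightarrow> t i = finv m (add_diag h (\<lambda>i. \<Sum>j<m. S i j * t j)) i i"
    and rr: "\<And>i. i < m \<Longrightarrow> rr i = finv m (add_diag h (\<lambda>i. \<Sum>j<m. S i j * g j)) i i"
    and eta: "\<And>i. i < m \<Longrightarrow> \<bar>\<Sum>j<m. S i j * (g j - rr j)\<bar> \<le> \<eta>" and eta_le: "\<eta> \<le> r / 2"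
    and i: "i < m"
  shows "\<bar>\<Sum>j<m. S i j * (g j - t j)\<bar> \<le> 2 * (r + K / r)\<^sup>2 * \<eta> / r\<^sup>2"
    and "\<bar>rr i - t i\<bar> \<le> 2 * (r + K / r)\<^sup>2 * \<eta> / r ^ 4"
proof -
  define p where "p = r + K / r"
  define Sg where "Sg = (\<lambda>i. \<Sum>j<m. S i j * g j)"
  define St where "St = (\<lambda>i. \<Sum>j<m. S i j * t j)"
  define hR where "hR = add_diag h Sg"
  define hT where "hT = add_diag h St"
  define R where "R = finv m hR"
  define T where "T = finv m hT"
  define a where "a = (\<lambda>i. r + Sg i)"
  define b where "b = (\<lambda>i. r + St i)"
  define e where "e = (\<lambda>i. \<Sum>j<m. S i j * (g j - t j))"
  have Sg0: "0 \<le> Sg i" if "i < m" for i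
    unfolding Sg_def using S0 g(1) by (intro sum_nonneg mult_nonneg_nonneg) auto
  have St0: "0 \<le> St i" if "i < m" for i
    unfolding St_def using S0 t(1) by (intro sum_nonneg mult_nonneg_nonneg) auto
  have hR: "skew_diag m r hR" unfolding hR_def by (rule skew_diag_add_diag[OF h Sg0])
  have hT: "skew_diag m r hT" unfolding hT_def by (rule skew_diag_add_diag[OF h St0])
  have rrR: "rr k = R k k" if "k < m" for k using rr[OF that] by (simp add: R_def hR_def Sg_def)
  have tT: "t k = T k k" if "k < m" for k
    using t(2)[OF that] by (simp add: T_def hT_def St_def)
  have rr0: "0 \<le> rr k" if "k < m" for k
    using finv_diag_nonneg[OF hR r that] rrR[OF that] by (simp add: R_def)
  have tle: "t k \<le> 1 / r" if "k < m" for k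
    using finv_diag_le[OF hT r that] tT[OF that] by (simp add: T_def)
  have bound: "(\<Sum>j<m. S i j * x j) \<le> K / r" if "i < m" "\<And>j. j < m \<Longrightarrow> x j \<le> 1 / r" for i x
  proof -
    have "(\<Sum>j<m. S i j * x j) \<le> (\<Sum>j<m. S i j * (1 / r))"
      using S0 that by (intro sum_mono mult_left_mono) auto
    also have "\<dots> = (\<Sum>j<m. S i j) * (1 / r)" by (simp only: sum_distrib_right)
    also have "\<dots> \<le> K * (1 / r)" using S1[OF that(1)] r by (intro mult_right_mono) auto
    finally show ?thesis by simp
  qed
  have a: "r \<le> a k" "a k \<le> p" if "k < m" for k
    using Sg0[OF that] bound[OF that, of g] g(2) by (auto simp: a_def p_def Sg_def)
  have b: "r \<le> b k" "b k \<le> p" if "k < m" for k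
    using St0[OF that] bound[OF that, of t] tle by (auto simp: b_def p_def St_def)
  have p: "r \<le> p" "0 < p" using a[OF i] r by auto
  have R_diag: "rr k = (\<Sum>l<m. a l * (R k l)\<^sup>2)" if "k < m" for k
    unfolding rrR[OF that] R_def finv_diag_row[OF hR r that]
    by (intro sum.cong refl) (simp add: hR_def add_diag_def a_def diag)
  have T_diag: "t k = (\<Sum>l<m. b l * (T l k)\<^sup>2)" if "k < m" for k
    unfolding tT[OF that] T_def finv_diag_col[OF hT r that]
    by (intro sum.cong refl) (simp add: hT_def add_diag_def b_def diag)
  have diff: "\<bar>rr k - t k\<bar> \<le> (\<Sum>l<m. \<bar>R k l\<bar> * \<bar>e l\<bar> * \<bar>T l k\<bar>)" if k: "k < m" for k
  proof -
    have "rr k - t k = (\<Sum>l<m. R k l * (St l - Sg l) * T l k)"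
      unfolding rrR[OF k] tT[OF k] R_def T_def hR_def hT_def
      by (rule finv_add_diag_diff[OF h r Sg0 St0 k])
    also have "\<bar>\<dots>\<bar> \<le> (\<Sum>l<m. \<bar>R k l * (St l - Sg l) * T l k\<bar>)" by (rule sum_abs)
    also have "\<dots> = (\<Sum>l<m. \<bar>R k l\<bar> * \<bar>e l\<bar> * \<bar>T l k\<bar>)"
    proof (intro sum.cong refl)
      fix l
      have "e l = - (St l - Sg l)" by (simp add: e_def St_def Sg_def sum_subtractf right_diff_distrib)
      then have "\<bar>e l\<bar> = \<bar>St l - Sg l\<bar>" by linarith
      then show "\<bar>R k l * (St l - Sg l) * T l k\<bar> = \<bar>R k l\<bar> * \<bar>e l\<bar> * \<bar>T l k\<bar>" by (simp add: abs_mult)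
    qed
    finally show ?thesis .
  qed
  \<comment> \<open>\<open>x\<close> is a weighted maximum norm of \<open>e\<close>. The weight is
    the geometric mean of the two diagonals, so that \<open>R_diag\<close> and \<open>T_diag\<close>
    can be used at the same time.\<close>
  define c where "c = (\<lambda>k. sqrt (a k * b k))"
  define x where "x = Max ((\<lambda>i. \<bar>e i\<bar> / c i) ` {..<m})"
  have c_ge: "r \<le> c k" if "k < m" for k
  proof -
    have "r * r \<le> a k * b k" using a[OF that] b[OF that] r by (intro mult_mono) auto
    then show ?thesis unfolding c_def by (intro real_le_rsqrt) (simp add: power2_eq_square)
  qed
  have c_le: "c k \<le> p" if "k < m" for k
  proof -
    have "a k * b k \<le> p * p" using a[OF that] b[OF that] r p by (intro mult_mono) auto
    then show ?thesis using p unfolding c_def by (intro real_le_lsqrt) (auto simp: power2_eq_square)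
  qed
  have e_le: "\<bar>e k\<bar> \<le> x * c k" if "k < m" for k
  proof -
    have "\<bar>e k\<bar> / c k \<le> x" unfolding x_def using that by (intro Max_ge) auto
    moreover have "0 < c k" using c_ge[OF that] r by linarith
    ultimately show ?thesis by (simp only: pos_divide_le_eq)
  qed
  have "0 \<le> \<bar>e i\<bar> / c i" using c_ge[OF i] r by simp
  also have "\<dots> \<le> x" unfolding x_def using i by (intro Max_ge) auto
  finally have x0: "0 \<le> x" .
  \<comment> \<open>The weight \<open>c l = sqrt (a l) * sqrt (b l)\<close> is split over the
    factors \<open>R k l\<close> and \<open>T l k\<close>; Cauchy-Schwarz then reproduces the two
    diagonal entries exactly.\<close>
  have diff2: "\<bar>rr k - t k\<bar> \<le> x * (sqrt (rr k) * sqrt (t k))" if k: "k < m" for k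
  proof -
    have "(\<Sum>l<m. \<bar>R k l\<bar> * \<bar>e l\<bar> * \<bar>T l k\<bar>)
        \<le> (\<Sum>l<m. x * (\<bar>sqrt (a l) * R k l\<bar> * \<bar>sqrt (b l) * T l k\<bar>))"
    proof (intro sum_mono)
      fix l assume "l \<in> {..<m}"
      then have l: "l < m" by simp
      have "\<bar>R k l\<bar> * \<bar>e l\<bar> * \<bar>T l k\<bar> \<le> \<bar>R k l\<bar> * (x * c l) * \<bar>T l k\<bar>"
        by (intro mult_right_mono mult_left_mono e_le[OF l]) auto
      also have "\<dots> = x * (\<bar>sqrt (a l) * R k l\<bar> * \<bar>sqrt (b l) * T l k\<bar>)"
        using a[OF l] b[OF l] r by (simp add: abs_mult real_sqrt_mult c_def)
      finally show "\<bar>R k l\<bar> * \<bar>e l\<bar> * \<bar>T l k\<bar> \<le> x * (\<bar>sqrt (a l) * R k l\<bar> * \<bar>sqrt (b l) * T l k\<bar>)" .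
    qed
    also have "\<dots> = x * (\<Sum>l<m. \<bar>sqrt (a l) * R k l\<bar> * \<bar>sqrt (b l) * T l k\<bar>)"
      by (simp add: sum_distrib_left)
    also have "\<dots> \<le> x * (sqrt (rr k) * sqrt (t k))"
    proof (intro mult_left_mono x0 sum_abs_mult_le)
      have "(\<Sum>l<m. (sqrt (a l) * R k l)\<^sup>2) = rr k"
        unfolding R_diag[OF k] using a r
        by (intro sum.cong refl) (simp add: power_mult_distrib order_trans[of 0 r])
      then show "(\<Sum>l<m. (sqrt (a l) * R k l)\<^sup>2) \<le> (sqrt (rr k))\<^sup>2" using rr0[OF k] by simp
      have "(\<Sum>l<m. (sqrt (b l) * T l k)\<^sup>2) = t k"
        unfolding T_diag[OF k] using b r
        by (intro sum.cong refl) (simp add: power_mult_distrib order_trans[of 0 r])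
      then show "(\<Sum>l<m. (sqrt (b l) * T l k)\<^sup>2) \<le> (sqrt (t k))\<^sup>2" using t(1)[OF k] by simp
    qed (use rr0[OF k] t(1)[OF k] in auto)
    finally show ?thesis using diff[OF k] by linarith
  qed
  \<comment> \<open>The contraction gap. As \<open>a\<close> and \<open>b\<close> are at most
    \<open>p\<close>, one has \<open>\<kappa> * a k \<le> r / 2\<close>, so
    \<open>a k - r + \<eta> \<le> (1 - \<kappa>) * a k\<close> once
    \<open>\<eta> \<le> r / 2\<close>, and likewise for \<open>b\<close>. Half of \<open>r\<close>
    pays for the defect of \<open>g\<close>.\<close>
  define \<kappa> where "\<kappa> = r / (2 * p)"
  have \<kappa>: "0 < \<kappa>" "\<kappa> \<le> 1" using r p by (auto simp: \<kappa>_def)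
  have main: "\<bar>e k\<bar> \<le> \<eta> + x * ((1 - \<kappa>) * c k)" if k: "k < m" for k
  proof -
    have "e k = (\<Sum>j<m. S k j * (g j - rr j)) + (\<Sum>j<m. S k j * (rr j - t j))"
      unfolding e_def sum.distrib[symmetric] by (intro sum.cong refl) (simp add: algebra_simps)
    moreover have "\<bar>\<Sum>j<m. S k j * (rr j - t j)\<bar> \<le> (\<Sum>j<m. S k j * (x * (sqrt (rr j) * sqrt (t j))))"
      by (rule order_trans[OF sum_abs]) (auto intro!: sum_mono mult_left_mono diff2 S0 simp: abs_mult S0)
    moreover have "(\<Sum>j<m. S k j * (x * (sqrt (rr j) * sqrt (t j))))
        = x * (\<Sum>j<m. \<bar>sqrt (S k j) * sqrt (rr j)\<bar> * \<bar>sqrt (S k j) * sqrt (t j)\<bar>)"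
      unfolding sum_distrib_left
    proof (intro sum.cong refl)
      fix j assume "j \<in> {..<m}"
      then have "0 \<le> rr j" "0 \<le> t j" using rr0 t(1) by auto
      then have "\<bar>sqrt (S k j) * sqrt (rr j)\<bar> * \<bar>sqrt (S k j) * sqrt (t j)\<bar>
          = (sqrt (S k j) * sqrt (S k j)) * (sqrt (rr j) * sqrt (t j))"
        using S0[of k j] by (simp add: abs_mult)
      also have "sqrt (S k j) * sqrt (S k j) = S k j" using S0 by simp
      finally show "S k j * (x * (sqrt (rr j) * sqrt (t j)))
          = x * (\<bar>sqrt (S k j) * sqrt (rr j)\<bar> * \<bar>sqrt (S k j) * sqrt (t j)\<bar>)" by simp
    qed
    \<comment> \<open>Second Cauchy-Schwarz, now with the weights \<open>S k j\<close>: the row sums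
      of \<open>S rr\<close> and \<open>S t\<close> are compared with \<open>a k - r\<close> and
      \<open>b k - r\<close>.\<close>
    moreover have "x * (\<Sum>j<m. \<bar>sqrt (S k j) * sqrt (rr j)\<bar> * \<bar>sqrt (S k j) * sqrt (t j)\<bar>)
        \<le> x * (sqrt ((1 - \<kappa>) * a k) * sqrt ((1 - \<kappa>) * b k))"
    proof (intro mult_left_mono x0 sum_abs_mult_le)
      have pk: "a k * \<kappa> \<le> r / 2" "b k * \<kappa> \<le> r / 2"
        using a[OF k] b[OF k] p r by (auto simp: \<kappa>_def field_simps)
      have ak: "0 \<le> (1 - \<kappa>) * a k" "0 \<le> (1 - \<kappa>) * b k"
        using \<kappa> a[OF k] b[OF k] r by auto
      have "(\<Sum>j<m. S k j * rr j) = Sg k - (\<Sum>j<m. S k j * (g j - rr j))"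
        by (simp add: Sg_def sum_subtractf right_diff_distrib)
      also have "\<dots> \<le> a k - r + \<eta>" using eta[OF k] unfolding a_def by linarith
      also have "\<dots> \<le> (1 - \<kappa>) * a k" using eta_le pk by (simp add: algebra_simps)
      finally have 1: "(\<Sum>j<m. S k j * rr j) \<le> (1 - \<kappa>) * a k" .
      have "(\<Sum>j<m. (sqrt (S k j) * sqrt (rr j))\<^sup>2) = (\<Sum>j<m. S k j * rr j)"
        using S0 rr0 by (intro sum.cong refl) (simp add: power_mult_distrib)
      then show "(\<Sum>j<m. (sqrt (S k j) * sqrt (rr j))\<^sup>2) \<le> (sqrt ((1 - \<kappa>) * a k))\<^sup>2"
        using 1 ak by simp
      have "(\<Sum>j<m. (sqrt (S k j) * sqrt (t j))\<^sup>2) = (\<Sum>j<m. S k j * t j)"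
        using S0 t(1) by (intro sum.cong refl) (simp add: power_mult_distrib)
      also have "\<dots> = b k - r" by (simp add: b_def St_def)
      also have "\<dots> \<le> (1 - \<kappa>) * b k" using pk r by (simp add: algebra_simps)
      finally show "(\<Sum>j<m. (sqrt (S k j) * sqrt (t j))\<^sup>2) \<le> (sqrt ((1 - \<kappa>) * b k))\<^sup>2"
        using ak by simp
    qed (use \<kappa> a[OF k] b[OF k] r in auto)
    moreover have "x * (sqrt ((1 - \<kappa>) * a k) * sqrt ((1 - \<kappa>) * b k)) = x * ((1 - \<kappa>) * c k)"
    proof -
      have "sqrt ((1 - \<kappa>) * a k) * sqrt ((1 - \<kappa>) * b k)
          = (sqrt (1 - \<kappa>) * sqrt (1 - \<kappa>)) * sqrt (a k * b k)"
        by (simp only: real_sqrt_mult ac_simps)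
      then show ?thesis using \<kappa> by (simp add: c_def)
    qed
    ultimately show ?thesis using eta[OF k] by linarith
  qed
  \<comment> \<open>At an index attaining the maximum the bound \<open>main\<close> closes on
    \<open>x\<close> itself.\<close>
  have "x \<le> \<eta> / r + x * (1 - \<kappa>)"
  proof -
    have "Max ((\<lambda>i. \<bar>e i\<bar> / c i) ` {..<m}) \<in> (\<lambda>i. \<bar>e i\<bar> / c i) ` {..<m}"
      using i by (intro Max_in) auto
    then obtain k where k: "k < m" "x = \<bar>e k\<bar> / c k" unfolding x_def by auto
    have ck: "0 < c k" using c_ge[OF k(1)] r by linarith
    have "0 \<le> \<eta>" using eta[OF k(1)] by linarith
    have "x \<le> (\<eta> + x * ((1 - \<kappa>) * c k)) / c k"
      using main[OF k(1)] ck unfolding k(2) by (intro divide_right_mono) auto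
    also have "\<dots> = \<eta> / c k + x * (1 - \<kappa>)"
      using ck by (simp add: add_divide_distrib)
    also have "\<eta> / c k \<le> \<eta> / r"
      using c_ge[OF k(1)] r \<open>0 \<le> \<eta>\<close> ck by (intro divide_left_mono) auto
    finally show ?thesis by simp
  qed
  then have "x * \<kappa> \<le> \<eta> / r" by (simp add: algebra_simps)
  then have x_le: "x \<le> 2 * p * \<eta> / r\<^sup>2"
    using r p by (simp add: \<kappa>_def power2_eq_square field_simps)
  have e_bound: "\<bar>e k\<bar> \<le> 2 * p\<^sup>2 * \<eta> / r\<^sup>2" if k: "k < m" for k
  proof -
    have "\<bar>e k\<bar> \<le> x * p"
      using e_le[OF k] mult_left_mono[OF c_le[OF k] x0] by linarith
    also have "\<dots> \<le> 2 * p * \<eta> / r\<^sup>2 * p" using x_le p by (intro mult_right_mono) auto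
    finally show ?thesis by (simp add: power2_eq_square mult_ac)
  qed
  show "\<bar>\<Sum>j<m. S i j * (g j - t j)\<bar> \<le> 2 * (r + K / r)\<^sup>2 * \<eta> / r\<^sup>2"
    using e_bound[OF i] by (simp add: e_def p_def)
  \<comment> \<open>Back from the averaged error \<open>e\<close> to single entries, by the row
    bound of \<open>R\<close> and the column bound of \<open>T\<close>.\<close>
  have "\<bar>rr i - t i\<bar> \<le> (\<Sum>l<m. 2 * p\<^sup>2 * \<eta> / r\<^sup>2 * (\<bar>R i l\<bar> * \<bar>T l i\<bar>))"
  proof (rule order_trans[OF diff[OF i]], rule sum_mono)
    fix l assume "l \<in> {..<m}"
    then have "\<bar>R i l\<bar> * \<bar>e l\<bar> * \<bar>T l i\<bar> \<le> \<bar>R i l\<bar> * (2 * p\<^sup>2 * \<eta> / r\<^sup>2) * \<bar>T l i\<bar>"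
      by (intro mult_right_mono mult_left_mono e_bound) auto
    then show "\<bar>R i l\<bar> * \<bar>e l\<bar> * \<bar>T l i\<bar> \<le> 2 * p\<^sup>2 * \<eta> / r\<^sup>2 * (\<bar>R i l\<bar> * \<bar>T l i\<bar>)"
      by (simp only: mult_ac)
  qed
  also have "\<dots> = 2 * p\<^sup>2 * \<eta> / r\<^sup>2 * (\<Sum>l<m. \<bar>R i l\<bar> * \<bar>T l i\<bar>)"
    by (simp only: sum_distrib_left)
  also have "\<dots> \<le> 2 * p\<^sup>2 * \<eta> / r\<^sup>2 * (1 / r * (1 / r))"
  proof (intro mult_left_mono sum_abs_mult_le)
    show "(\<Sum>l<m. (R i l)\<^sup>2) \<le> (1 / r)\<^sup>2"
      using finv_row_bound[OF hR r i] by (simp add: R_def power_divide)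
    show "(\<Sum>l<m. (T l i)\<^sup>2) \<le> (1 / r)\<^sup>2"
      using finv_col_bound[OF hT r i] by (simp add: T_def power_divide)
    show "0 \<le> 2 * p\<^sup>2 * \<eta> / r\<^sup>2" using e_bound[OF i] by (meson abs_ge_zero order_trans)
  qed (use r in auto)
  also have "\<dots> = 2 * p\<^sup>2 * \<eta> / r ^ 4" by (simp add: power2_eq_square power4_eq_xxxx)
  finally show "\<bar>rr i - t i\<bar> \<le> 2 * (r + K / r)\<^sup>2 * \<eta> / r ^ 4" by (simp add: p_def)
qed

subsection \<open>Random antisymmetric matrices\<close>

text \<open>\<open>P\<close> will consist of pairs strictly above the diagonal. The sign
  \<open>s = - 1\<close> then gives the antisymmetric noise built from independent variables,
  \<open>s = 1\<close> the symmetric matrix of variances.\<close>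

definition pair_mat :: "(nat \<times> nat) set \<Rightarrow> real \<Rightarrow> (nat \<times> nat \<Rightarrow> real) \<Rightarrow> nat \<Rightarrow> nat \<Rightarrow> real" where
  "pair_mat P s f i j = (if (i, j) \<in> P then f (i, j) else if (j, i) \<in> P then s * f (j, i) else 0)"

lemma pair_asym:
  assumes "P \<subseteq> {(i, j). i < j \<and> j < (m::nat)}" "(i, j) \<in> P"
  shows "(j, i) \<notin> P"
proof
  assume "(j, i) \<in> P"
  with assms have "i < j" "j < i" by blast+
  then show False by simp
qed

text \<open>\<open>P\<close> and its mirror image are disjoint, so every pair contributes exactly
  twice, once with the factor \<open>s\<close>.\<close>

lemma pair_mat_sum:
  assumes P: "P \<subseteq> {(i, j). i < j \<and> j < m}"
  shows "(\<Sum>i<m. \<Sum>j<m. pair_mat P s f i j * F i j)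
    = (\<Sum>p\<in>P. f p * (F (fst p) (snd p) + s * F (snd p) (fst p)))"
proof -
  have sub: "P \<subseteq> {..<m} \<times> {..<m}" using P by fastforce
  have *: "(\<Sum>i<m. \<Sum>j<m. if (i, j) \<in> P then F' (i, j) else 0) = (\<Sum>p\<in>P. F' p)"
    for F' :: "nat \<times> nat \<Rightarrow> real"
  proof -
    have "(\<Sum>i<m. \<Sum>j<m. if (i, j) \<in> P then F' (i, j) else 0)
        = (\<Sum>p\<in>{..<m} \<times> {..<m}. if p \<in> P then F' p else 0)"
      by (subst sum.cartesian_product, intro sum.cong refl) auto
    also have "\<dots> = (\<Sum>p\<in>({..<m} \<times> {..<m}) \<inter> P. F' p)"
      by (rule sum.inter_restrict[symmetric]) simp
    also have "({..<m} \<times> {..<m}) \<inter> P = P" using sub by blast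
    finally show ?thesis .
  qed
  have "(\<Sum>i<m. \<Sum>j<m. pair_mat P s f i j * F i j)
    = (\<Sum>i<m. \<Sum>j<m. (if (i, j) \<in> P then f (i, j) * F i j else 0)
        + (if (j, i) \<in> P then f (j, i) * (s * F i j) else 0))"
    by (intro sum.cong refl) (auto simp: pair_mat_def dest: pair_asym[OF P])
  also have "\<dots> = (\<Sum>i<m. \<Sum>j<m. if (i, j) \<in> P then f (i, j) * F i j else 0)
      + (\<Sum>i<m. \<Sum>j<m. if (j, i) \<in> P then f (j, i) * (s * F i j) else 0)"
    by (simp only: sum.distrib)
  also have "(\<Sum>i<m. \<Sum>j<m. if (j, i) \<in> P then f (j, i) * (s * F i j) else 0)
      = (\<Sum>i<m. \<Sum>j<m. if (i, j) \<in> P then f (i, j) * (s * F j i) else 0)"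
    by (rule sum.swap)
  also have "\<dots> = (\<Sum>p\<in>P. f p * (s * F (snd p) (fst p)))"
    using *[of "\<lambda>p. f p * (s * F (snd p) (fst p))"] by (simp only: fst_conv snd_conv)
  also have "(\<Sum>i<m. \<Sum>j<m. if (i, j) \<in> P then f (i, j) * F i j else 0)
      = (\<Sum>p\<in>P. f p * F (fst p) (snd p))"
    using *[of "\<lambda>p. f p * F (fst p) (snd p)"] by (simp only: fst_conv snd_conv)
  finally show ?thesis by (simp add: sum.distrib distrib_left)
qed

lemma pair_mat_skew:
  assumes P: "P \<subseteq> {(i, j). i < j \<and> j < m}" and h: "skew_diag m r h"
  shows "skew_diag m r (\<lambda>i j. h i j + pair_mat P (- 1) f i j)"
proof (rule skew_diagI)
  fix i assume "i < m"
  moreover have "(i, i) \<notin> P" using P by auto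
  ultimately show "r \<le> h i i + pair_mat P (- 1) f i i"
    using skew_diag_ge[OF h] by (simp add: pair_mat_def)
next
  fix i j assume ij: "i < m" "j < m" "i \<noteq> j"
  have "(i, j) \<in> P \<Longrightarrow> (j, i) \<notin> P" by (rule pair_asym[OF P])
  then have "pair_mat P (- 1) f i j = - pair_mat P (- 1) f j i"
    by (auto simp: pair_mat_def)
  then show "h i j + pair_mat P (- 1) f i j = - (h j i + pair_mat P (- 1) f j i)"
    using skew_diag_skew[OF h ij] by linarith
qed

lemma pair_mat_sym:
  assumes P: "P \<subseteq> {(i, j). i < j \<and> j < m}"
  shows "pair_mat P 1 f i j = pair_mat P 1 f j i"
proof -
  have "(i, j) \<in> P \<Longrightarrow> (j, i) \<notin> P" by (rule pair_asym[OF P])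
  then show ?thesis by (auto simp: pair_mat_def)
qed

text \<open>The bilinear form of the rank-two change that altering one independent variable makes to
  an antisymmetric matrix.\<close>

lemma sum_two_entries:
  fixes A B :: "nat \<Rightarrow> real"
  assumes "i < m" "j < m" "i \<noteq> j"
  shows "(\<Sum>k<m. \<Sum>l<m. A k * (if k = i \<and> l = j then d else if k = j \<and> l = i then - d else 0) * B l)
    = d * (A i * B j - A j * B i)"
proof -
  have "(\<Sum>k<m. \<Sum>l<m. A k * (if k = i \<and> l = j then d else if k = j \<and> l = i then - d else 0) * B l)
    = (\<Sum>k<m. \<Sum>l<m. (if l = j then (if k = i then A k * d * B l else 0) else 0)
        - (if l = i then (if k = j then A k * d * B l else 0) else 0))"
    using assms by (intro sum.cong refl) auto
  also have "\<dots> = A i * d * B j - A j * d * B i"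
    using assms by (simp add: sum_subtractf)
  finally show ?thesis by (simp add: algebra_simps)
qed

lemma abs_mult_mono:
  fixes a b A B :: real
  assumes "\<bar>a\<bar> \<le> A" "\<bar>b\<bar> \<le> B"
  shows "\<bar>a * b\<bar> \<le> A * B"
  unfolding abs_mult by (intro mult_mono assms) (use assms(1) in auto)

text \<open>In the application \<open>\<beta>\<close> is of order 1 / n and \<open>\<gamma>\<close>
  of order n^(-3/2). The bound \<open>mixed\<close> serves the term in which a variance multiplies a
  first absolute moment.\<close>

locale random_skew = real_noise \<mu> for \<mu> :: "nat \<times> nat \<Rightarrow> real measure" +
  fixes m :: nat and P :: "(nat \<times> nat) set" and h :: "nat \<Rightarrow> nat \<Rightarrow> real"
    and r \<beta> \<gamma> :: real and v :: "nat \<times> nat \<Rightarrow> real"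
  assumes P: "P \<subseteq> {(i, j). i < j \<and> j < m}"
    and h: "skew_diag m r h" and h_diag: "\<And>i. i < m \<Longrightarrow> h i i = r" and r: "0 < r"
    and int1: "\<And>p. p \<in> P \<Longrightarrow> integrable (\<mu> p) (\<lambda>u. u)"
    and int2: "\<And>p. p \<in> P \<Longrightarrow> integrable (\<mu> p) (\<lambda>u. u\<^sup>2)"
    and int3: "\<And>p. p \<in> P \<Longrightarrow> integrable (\<mu> p) (\<lambda>u. \<bar>u\<bar> ^ 3)"
    and mean: "\<And>p. p \<in> P \<Longrightarrow> (\<integral>u. u \<partial>\<mu> p) = 0"
    and variance: "\<And>p. p \<in> P \<Longrightarrow> (\<integral>u. u\<^sup>2 \<partial>\<mu> p) = v p"
    and var_le: "\<And>p. p \<in> P \<Longrightarrow> v p \<le> \<beta>"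
    and third: "\<And>p. p \<in> P \<Longrightarrow> (\<integral>u. \<bar>u\<bar> ^ 3 \<partial>\<mu> p) \<le> \<gamma>"
    and mixed: "\<And>p. p \<in> P \<Longrightarrow> v p * (\<integral>u. \<bar>u\<bar> \<partial>\<mu> p) \<le> \<gamma>"
    and \<beta>0: "0 \<le> \<beta>" and \<gamma>0: "0 \<le> \<gamma>"
begin

abbreviation "PM \<equiv> PiM P \<mu>"

definition H :: "(nat \<times> nat \<Rightarrow> real) \<Rightarrow> nat \<Rightarrow> nat \<Rightarrow> real" where
  "H x i j = h i j + pair_mat P (- 1) x i j"

definition G :: "(nat \<times> nat \<Rightarrow> real) \<Rightarrow> nat \<Rightarrow> nat \<Rightarrow> real" where
  "G x = finv m (H x)"

definition S :: "nat \<Rightarrow> nat \<Rightarrow> real" where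
  "S = pair_mat P 1 v"

lemma finite_P: "finite P"
  by (rule finite_subset[of _ "{..<m} \<times> {..<m}"]) (use P in fastforce)+

lemma card_P: "card P \<le> m * m"
proof -
  have "card P \<le> card ({..<m} \<times> {..<m})" using P by (intro card_mono) fastforce+
  then show ?thesis by simp
qed

lemma P_D: "p \<in> P \<Longrightarrow> fst p < m" "p \<in> P \<Longrightarrow> snd p < m" "p \<in> P \<Longrightarrow> fst p \<noteq> snd p"
  using P by fastforce+

lemma v0: "p \<in> P \<Longrightarrow> 0 \<le> v p"
  using variance[of p] by (metis integral_nonneg_AE AE_I2 zero_le_power2)

lemma S0: "0 \<le> S i j"
  using v0 by (auto simp: S_def pair_mat_def)

lemma S_le: "S i j \<le> \<beta>"
  using var_le \<beta>0 by (auto simp: S_def pair_mat_def)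

lemma S_sym: "S i j = S j i"
  unfolding S_def by (rule pair_mat_sym[OF P])

lemma S_row: "(\<Sum>j<m. S i j) \<le> real m * \<beta>"
  using sum_mono[of "{..<m}" "S i" "\<lambda>_. \<beta>"] S_le by simp

lemma H_skew: "skew_diag m r (H x)"
  unfolding H_def by (rule pair_mat_skew[OF P h])

lemma H_det: "fdet m (H x) \<noteq> 0"
  by (rule skew_diag_nz[OF H_skew r])

lemma G_abs: "a < m \<Longrightarrow> b < m \<Longrightarrow> \<bar>G x a b\<bar> \<le> 1 / r"
  unfolding G_def by (rule finv_abs_le[OF H_skew r])

lemma G_row: "a < m \<Longrightarrow> (\<Sum>b<m. (G x a b)\<^sup>2) \<le> (1 / r)\<^sup>2"
  using finv_row_bound[OF H_skew r, of a] by (simp add: G_def power_divide)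

lemma G_col: "a < m \<Longrightarrow> (\<Sum>b<m. (G x b a)\<^sup>2) \<le> (1 / r)\<^sup>2"
  using finv_col_bound[OF H_skew r, of a] by (simp add: G_def power_divide)

lemma G_nonneg: "a < m \<Longrightarrow> 0 \<le> G x a a"
  unfolding G_def by (rule finv_diag_nonneg[OF H_skew r])

lemma H_measurable:
  assumes "\<And>q. q \<in> P \<Longrightarrow> (\<lambda>x. \<phi> x q) \<in> borel_measurable N"
  shows "(\<lambda>x. H (\<phi> x) i j) \<in> borel_measurable N"
proof (cases "(i, j) \<in> P")
  case False
  then show ?thesis
    using assms by (cases "(j, i) \<in> P") (auto simp: H_def pair_mat_def)
qed (use assms in \<open>auto simp: H_def pair_mat_def\<close>)

lemma G_measurable:
  assumes "\<And>q. q \<in> P \<Longrightarrow> (\<lambda>x. \<phi> x q) \<in> borel_measurable N" "a < m" "b < m"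
  shows "(\<lambda>x. G (\<phi> x) a b) \<in> borel_measurable N"
  unfolding G_def using assms by (intro finv_measurable H_measurable H_det) auto

lemma G_meas: "a < m \<Longrightarrow> b < m \<Longrightarrow> (\<lambda>x. G x a b) \<in> borel_measurable PM"
  by (rule G_measurable[OF coordinate_measurable])

lemma G_meas0:
  assumes "a < m" "b < m"
  shows "(\<lambda>x. G (x(p := 0)) a b) \<in> borel_measurable PM"
proof (rule G_measurable[OF _ assms])
  fix q assume "q \<in> P"
  then show "(\<lambda>x. (x(p := 0)) q) \<in> borel_measurable PM"
    using coordinate_measurable[of q P] by (cases "q = p") auto
qed

lemma H_upd:
  assumes p: "p \<in> P" and d: "d = x p - y"
  shows "H x k l - H (x(p := y)) k l = (if k = fst p \<and> l = snd p then d
     else if k = snd p \<and> l = fst p then - d else 0)"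
proof -
  have "(k, l) \<in> P \<Longrightarrow> (l, k) \<notin> P" by (rule pair_asym[OF P])
  moreover obtain i j where ij: "p = (i, j)" by (cases p)
  moreover have "(j, i) \<notin> P" using p ij pair_asym[OF P] by auto
  moreover have "i \<noteq> j" using P_D(3)[OF p] ij by simp
  ultimately show ?thesis using p d by (auto simp: H_def pair_mat_def)
qed

text \<open>The resolvent identity for the matrices with and without the variable
  \<open>x p\<close>; the two versions differ in which resolvent stands on the left.\<close>

lemma G_upd:
  assumes p: "p \<in> P" and ab: "a < m" "b < m"
  defines "i \<equiv> fst p" and "j \<equiv> snd p"
  shows "G x a b = G (x(p := 0)) a b - x p * (G (x(p := 0)) a i * G x j b - G (x(p := 0)) a j * G x i b)"
    and "G x a b = G (x(p := 0)) a b - x p * (G x a i * G (x(p := 0)) j b - G x a j * G (x(p := 0)) i b)"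
proof -
  note pd = P_D[OF p, folded i_def j_def]
  have "G (x(p := 0)) a b - G x a b = (\<Sum>k<m. \<Sum>l<m. G (x(p := 0)) a k *
      (if k = i \<and> l = j then x p else if k = j \<and> l = i then - x p else 0) * G x l b)"
    unfolding G_def resolvent_identity[OF H_det H_det ab]
    by (intro sum.cong refl arg_cong2[where f="(*)"]) (simp add: H_upd[OF p refl] i_def j_def)
  then show "G x a b = G (x(p := 0)) a b - x p * (G (x(p := 0)) a i * G x j b - G (x(p := 0)) a j * G x i b)"
    unfolding sum_two_entries[OF pd] by linarith
  have neg: "H (x(p := 0)) k l - H x k l = (if k = i \<and> l = j then - x p else if k = j \<and> l = i then - (- x p) else 0)" for k l
  proof -
    have "H (x(p := 0)) k l - H x k l = - (H x k l - H (x(p := 0)) k l)" by simp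
    also have "H x k l - H (x(p := 0)) k l = (if k = i \<and> l = j then x p else if k = j \<and> l = i then - x p else 0)"
      unfolding i_def j_def by (rule H_upd[OF p]) simp
    also have "- \<dots> = (if k = i \<and> l = j then - x p else if k = j \<and> l = i then - (- x p) else 0)"
      by (simp split: if_split)
    finally show ?thesis .
  qed
  have "G x a b - G (x(p := 0)) a b = (\<Sum>k<m. \<Sum>l<m. G x a k *
      (if k = i \<and> l = j then - x p else if k = j \<and> l = i then - (- x p) else 0) * G (x(p := 0)) l b)"
    unfolding G_def resolvent_identity[OF H_det H_det ab] neg ..
  then show "G x a b = G (x(p := 0)) a b - x p * (G x a i * G (x(p := 0)) j b - G x a j * G (x(p := 0)) i b)"
    unfolding sum_two_entries[OF pd] by linarith
qed

lemma G_diff_le: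
  assumes p: "p \<in> P" and ab: "a < m" "b < m"
  shows "\<bar>G x a b - G (x(p := 0)) a b\<bar> \<le> \<bar>x p\<bar> * (2 / r\<^sup>2)"
proof -
  have "\<bar>G (x(p := 0)) a (fst p) * G x (snd p) b - G (x(p := 0)) a (snd p) * G x (fst p) b\<bar>
      \<le> 1 / r * (1 / r) + 1 / r * (1 / r)"
    by (intro order_trans[OF abs_triangle_ineq4] add_mono abs_mult_mono G_abs P_D p ab)
  also have "\<dots> = 2 / r\<^sup>2" by (simp add: power2_eq_square)
  finally have "\<bar>x p * (G (x(p := 0)) a (fst p) * G x (snd p) b - G (x(p := 0)) a (snd p) * G x (fst p) b)\<bar>
      \<le> \<bar>x p\<bar> * (2 / r\<^sup>2)"
    by (intro abs_mult_mono) auto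
  then show ?thesis using G_upd(1)[OF p ab, of x] by linarith
qed

end

section \<open>Expansion of the resolvent in a single entry\<close>

lemma abs_diff_four_terms:
  fixes a :: real
  assumes "\<bar>a - a'\<bar> \<le> c" "\<bar>b - b'\<bar> \<le> c" "\<bar>d - d'\<bar> \<le> c" "\<bar>e - e'\<bar> \<le> c"
  shows "\<bar>a + b - d - e - (a' + b' - d' - e')\<bar> \<le> 4 * c"
  using assms by linarith

context random_skew
begin

sublocale PM: prob_space PM
  by (rule Pi_noise_prob)

lemma coordinate_abs_integrable: "p \<in> P \<Longrightarrow> integrable (\<mu> p) (\<lambda>u. \<bar>u\<bar>)"
  using int1 by (intro integrable_abs)

context
  fixes D :: "nat \<Rightarrow> nat \<Rightarrow> real" and \<delta> :: real
  assumes D_col: "\<And>b. b < m \<Longrightarrow> (\<Sum>k<m. (D k b)\<^sup>2) \<le> (\<delta> / r)\<^sup>2" and \<delta>0: "0 \<le> \<delta>"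
begin

text \<open>The product \<open>G D\<close>. It will be used with \<open>D = diag d R\<close>, for
  which it appears when the trace of \<open>diag d (G - R)\<close> is expanded by the resolvent
  identity.\<close>

definition K :: "(nat \<times> nat \<Rightarrow> real) \<Rightarrow> nat \<Rightarrow> nat \<Rightarrow> real" where
  "K x a b = (\<Sum>k<m. G x a k * D k b)"

lemma K_abs:
  assumes "a < m" "b < m"
  shows "\<bar>K x a b\<bar> \<le> \<delta> / r\<^sup>2"
proof -
  have "\<bar>K x a b\<bar> \<le> (\<Sum>k<m. \<bar>G x a k\<bar> * \<bar>D k b\<bar>)"
    unfolding K_def by (rule order_trans[OF sum_abs]) (simp add: abs_mult)
  also have "\<dots> \<le> 1 / r * (\<delta> / r)"
    using r \<delta>0 by (intro sum_abs_mult_le G_row D_col assms) auto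
  finally show ?thesis by (simp add: power2_eq_square)
qed

lemma K_meas: "a < m \<Longrightarrow> b < m \<Longrightarrow> (\<lambda>x. K x a b) \<in> borel_measurable PM"
  unfolding K_def by (intro borel_measurable_sum borel_measurable_times G_meas) auto

lemma K_meas0: "a < m \<Longrightarrow> b < m \<Longrightarrow> (\<lambda>x. K (x(p := 0)) a b) \<in> borel_measurable PM"
  unfolding K_def by (intro borel_measurable_sum borel_measurable_times G_meas0) auto

lemma K_upd:
  assumes p: "p \<in> P" and ab: "a < m" "b < m"
  shows "K x a b = K (x(p := 0)) a b
    - x p * (G (x(p := 0)) a (fst p) * K x (snd p) b - G (x(p := 0)) a (snd p) * K x (fst p) b)"
proof -
  have "K x a b = (\<Sum>k<m. (G (x(p := 0)) a k
    - x p * (G (x(p := 0)) a (fst p) * G x (snd p) k - G (x(p := 0)) a (snd p) * G x (fst p) k)) * D k b)"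
    unfolding K_def
  proof (intro sum.cong refl)
    fix k assume "k \<in> {..<m}"
    then show "G x a k * D k b = (G (x(p := 0)) a k
      - x p * (G (x(p := 0)) a (fst p) * G x (snd p) k - G (x(p := 0)) a (snd p) * G x (fst p) k)) * D k b"
      using G_upd(1)[OF p ab(1), of k x] by simp
  qed
  also have "\<dots> = K (x(p := 0)) a b
    - x p * (G (x(p := 0)) a (fst p) * K x (snd p) b - G (x(p := 0)) a (snd p) * K x (fst p) b)"
    unfolding K_def by (simp only: left_diff_distrib right_diff_distrib sum_subtractf sum_distrib_left mult.assoc)
  finally show ?thesis .
qed

lemma K_diff_le:
  assumes p: "p \<in> P" and ab: "a < m" "b < m"
  shows "\<bar>K x a b - K (x(p := 0)) a b\<bar> \<le> \<bar>x p\<bar> * (2 * \<delta> / r ^ 3)"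
proof -
  have "\<bar>G (x(p := 0)) a (fst p) * K x (snd p) b - G (x(p := 0)) a (snd p) * K x (fst p) b\<bar>
      \<le> 1 / r * (\<delta> / r\<^sup>2) + 1 / r * (\<delta> / r\<^sup>2)"
    by (intro order_trans[OF abs_triangle_ineq4] add_mono abs_mult_mono G_abs K_abs P_D p ab)
  also have "\<dots> = 2 * \<delta> / r ^ 3" by (simp add: power2_eq_square power3_eq_cube)
  finally have "\<bar>x p * (G (x(p := 0)) a (fst p) * K x (snd p) b - G (x(p := 0)) a (snd p) * K x (fst p) b)\<bar>
      \<le> \<bar>x p\<bar> * (2 * \<delta> / r ^ 3)"
    by (intro abs_mult_mono) auto
  then show ?thesis using K_upd[OF p ab, of x] by linarith
qed

text \<open>The derivative of \<open>K x (snd p) (fst p) - K x (fst p) (snd p)\<close> in the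
  variable \<open>x p\<close>, as read off from \<open>K_upd\<close>.\<close>

definition Phi :: "nat \<times> nat \<Rightarrow> (nat \<times> nat \<Rightarrow> real) \<Rightarrow> real" where
  "Phi p x = G x (fst p) (fst p) * K x (snd p) (snd p) + G x (snd p) (snd p) * K x (fst p) (fst p)
    - G x (fst p) (snd p) * K x (fst p) (snd p) - G x (snd p) (fst p) * K x (snd p) (fst p)"

lemma Phi_abs: "p \<in> P \<Longrightarrow> \<bar>Phi p x\<bar> \<le> 4 * \<delta> / r ^ 3"
proof -
  assume p: "p \<in> P"
  have *: "\<bar>G x a b * K x c d\<bar> \<le> \<delta> / r ^ 3" if "a < m" "b < m" "c < m" "d < m" for a b c d
    using abs_mult_mono[OF G_abs[OF that(1,2)] K_abs[OF that(3,4)], of x x]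
    by (simp add: power2_eq_square power3_eq_cube)
  note pm = P_D(1,2)[OF p]
  have "\<bar>Phi p x\<bar> \<le> 4 * (\<delta> / r ^ 3)"
    unfolding Phi_def
    using *[OF pm(1) pm(1) pm(2) pm(2)] *[OF pm(2) pm(2) pm(1) pm(1)]
      *[OF pm(1) pm(2) pm(1) pm(2)] *[OF pm(2) pm(1) pm(2) pm(1)]
    by linarith
  then show "\<bar>Phi p x\<bar> \<le> 4 * \<delta> / r ^ 3" by simp
qed

lemma Phi_meas: "p \<in> P \<Longrightarrow> Phi p \<in> borel_measurable PM"
  unfolding Phi_def by (intro borel_measurable_add borel_measurable_diff borel_measurable_times G_meas K_meas P_D)

lemma Phi_meas0: "p \<in> P \<Longrightarrow> (\<lambda>x. Phi p (x(p := 0))) \<in> borel_measurable PM"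
  unfolding Phi_def by (intro borel_measurable_add borel_measurable_diff borel_measurable_times G_meas0 K_meas0 P_D)

lemma Phi_diff_le:
  assumes p: "p \<in> P"
  shows "\<bar>Phi p x - Phi p (x(p := 0))\<bar> \<le> \<bar>x p\<bar> * (16 * \<delta> / r ^ 4)"
proof -
  have *: "\<bar>G x a b * K x c d - G (x(p := 0)) a b * K (x(p := 0)) c d\<bar> \<le> \<bar>x p\<bar> * (4 * \<delta> / r ^ 4)"
    if "a < m" "b < m" "c < m" "d < m" for a b c d
  proof -
    have "G x a b * K x c d - G (x(p := 0)) a b * K (x(p := 0)) c d
        = (G x a b - G (x(p := 0)) a b) * K x c d + G (x(p := 0)) a b * (K x c d - K (x(p := 0)) c d)"
      by (simp add: algebra_simps)
    also have "\<bar>\<dots>\<bar> \<le> (\<bar>x p\<bar> * (2 / r\<^sup>2)) * (\<delta> / r\<^sup>2) + 1 / r * (\<bar>x p\<bar> * (2 * \<delta> / r ^ 3))"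
      by (intro order_trans[OF abs_triangle_ineq] add_mono abs_mult_mono G_diff_le K_diff_le G_abs K_abs p that)
    also have "\<dots> = \<bar>x p\<bar> * (4 * \<delta> / r ^ 4)"
      using r by (simp add: power2_eq_square power3_eq_cube power4_eq_xxxx mult_ac)
    finally show ?thesis .
  qed
  note pm = P_D(1,2)[OF p]
  have "\<bar>Phi p x - Phi p (x(p := 0))\<bar> \<le> 4 * (\<bar>x p\<bar> * (4 * \<delta> / r ^ 4))"
    unfolding Phi_def
    by (rule abs_diff_four_terms) (intro * pm)+
  also have "\<dots> = \<bar>x p\<bar> * (16 * \<delta> / r ^ 4)" by simp
  finally show ?thesis .
qed

text \<open>Iterate \<open>K_upd\<close> once more around the point where \<open>x p\<close> is
  \<open>0\<close>. The quadratic remainder \<open>E\<close> consists of four products of size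
  \<open>\<delta> / r ^ 4\<close>; two such remainders, multiplied by the prefactor
  \<open>x p\<close>, give the cubic error.\<close>

lemma second_order_expansion:
  assumes p: "p \<in> P"
  shows "\<bar>x p * (K x (snd p) (fst p) - K x (fst p) (snd p))
      - x p * (K (x(p := 0)) (snd p) (fst p) - K (x(p := 0)) (fst p) (snd p))
      - (x p)\<^sup>2 * Phi p (x(p := 0))\<bar> \<le> \<bar>x p\<bar> ^ 3 * (8 * \<delta> / r ^ 4)"
proof -
  define i j y g k k0 where "i = fst p" and "j = snd p" and "y = x p" and "g = G (x(p := 0))"
    and "k = K x" and "k0 = K (x(p := 0))"
  note ij = P_D(1,2)[OF p, folded i_def j_def]
  define E where "E = (\<lambda>a b. g a i * (g j i * k j b - g j j * k i b) - g a j * (g i i * k j b - g i j * k i b))"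
  have upd: "k a b = k0 a b - y * (g a i * k j b - g a j * k i b)" if "a < m" "b < m" for a b
    unfolding k_def k0_def g_def y_def i_def j_def by (rule K_upd[OF p that])
  have exp: "k a b = k0 a b - y * (g a i * k0 j b - g a j * k0 i b) + y\<^sup>2 * E a b" if "a < m" "b < m" for a b
  proof -
    have 1: "k0 j b = k j b + y * (g j i * k j b - g j j * k i b)" using upd[OF ij(2) that(2)] by simp
    have 2: "k0 i b = k i b + y * (g i i * k j b - g i j * k i b)" using upd[OF ij(1) that(2)] by simp
    show ?thesis unfolding upd[OF that] 1 2 E_def by (simp add: power2_eq_square algebra_simps)
  qed
  have E_le: "\<bar>E a b\<bar> \<le> 4 * \<delta> / r ^ 4" if "a < m" "b < m" for a b
  proof -
    have "\<bar>E a b\<bar> \<le> 1 / r * (1 / r * (\<delta> / r\<^sup>2) + 1 / r * (\<delta> / r\<^sup>2)) + 1 / r * (1 / r * (\<delta> / r\<^sup>2) + 1 / r * (\<delta> / r\<^sup>2))"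
      unfolding E_def g_def k_def
      by (intro order_trans[OF abs_triangle_ineq4] add_mono abs_mult_mono G_abs K_abs ij that)
    also have "\<dots> = 4 * \<delta> / r ^ 4" using r by (simp add: power2_eq_square power4_eq_xxxx)
    finally show ?thesis .
  qed
  have Phi0: "Phi p (x(p := 0)) = g i i * k0 j j + g j j * k0 i i - g i j * k0 i j - g j i * k0 j i"
    by (simp add: Phi_def g_def k0_def i_def j_def)
  have "y * (k j i - k i j) - y * (k0 j i - k0 i j) - y\<^sup>2 * Phi p (x(p := 0)) = y ^ 3 * (E j i - E i j)"
    unfolding exp[OF ij(2,1)] exp[OF ij] Phi0 by (simp add: power2_eq_square power3_eq_cube algebra_simps)
  also have "\<bar>\<dots>\<bar> \<le> \<bar>y\<bar> ^ 3 * (4 * \<delta> / r ^ 4 + 4 * \<delta> / r ^ 4)"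
    by (intro abs_mult_mono order_trans[OF abs_triangle_ineq4] add_mono E_le ij) (simp add: power_abs)
  finally show ?thesis by (simp add: y_def k_def k0_def i_def j_def)
qed

text \<open>A substitute for Gaussian integration by parts. After the expansion at
  \<open>x p = 0\<close> the constant term has mean zero, and the linear one gives
  \<open>v p\<close> times the mean of \<open>Phi p (x(p := 0))\<close>. Restoring
  \<open>x p\<close> inside \<open>Phi\<close> is paid for by \<open>mixed\<close>. The constant is
  8 + 16 = 24.\<close>

lemma entry_expectation:
  assumes p: "p \<in> P"
  shows "integrable PM (\<lambda>x. x p * (K x (snd p) (fst p) - K x (fst p) (snd p)))"
    and "\<bar>(\<integral>x. x p * (K x (snd p) (fst p) - K x (fst p) (snd p)) \<partial>PM) - v p * (\<integral>x. Phi p x \<partial>PM)\<bar>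
      \<le> 24 * \<gamma> * \<delta> / r ^ 4"
proof -
  note pm = P_D(1,2)[OF p]
  define f where "f = (\<lambda>x. K x (snd p) (fst p) - K x (fst p) (snd p))"
  define f0 where "f0 = (\<lambda>x. f (x(p := 0)))"
  define \<Phi>0 where "\<Phi>0 = (\<lambda>x. Phi p (x(p := 0)))"
  have f_abs: "\<bar>f x\<bar> \<le> 2 * (\<delta> / r\<^sup>2)" for x
    unfolding f_def using K_abs[OF pm, of x] K_abs[OF pm(2,1), of x] by linarith
  have f_meas: "f \<in> borel_measurable PM" "f0 \<in> borel_measurable PM"
    unfolding f_def f0_def by (intro borel_measurable_diff K_meas K_meas0 pm)+
  have f0_abs: "\<bar>f0 x\<bar> \<le> 2 * (\<delta> / r\<^sup>2)" for x unfolding f0_def by (rule f_abs)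
  have \<Phi>0_abs: "\<bar>\<Phi>0 x\<bar> \<le> 4 * \<delta> / r ^ 3" for x unfolding \<Phi>0_def by (rule Phi_abs[OF p])
  have \<Phi>0_meas: "\<Phi>0 \<in> borel_measurable PM" unfolding \<Phi>0_def by (rule Phi_meas0[OF p])
  note I = integrable_coordinate_times[OF finite_P p]
  note X = integral_coordinate_indep[OF finite_P p]
  have i1: "integrable PM (\<lambda>x. x p * f x)" by (rule I[OF int1[OF p] f_meas(1) f_abs])
  then show "integrable PM (\<lambda>x. x p * (K x (snd p) (fst p) - K x (fst p) (snd p)))" by (simp add: f_def)
  have i2: "integrable PM (\<lambda>x. x p * f0 x)" by (rule I[OF int1[OF p] f_meas(2) f0_abs])
  have i3: "integrable PM (\<lambda>x. (x p)\<^sup>2 * \<Phi>0 x)" by (rule I[OF int2[OF p] \<Phi>0_meas \<Phi>0_abs])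
  have i4: "integrable PM (\<lambda>x. \<bar>x p\<bar> ^ 3)" "(\<integral>x. \<bar>x p\<bar> ^ 3 \<partial>PM) \<le> \<gamma>"
    using coordinate_integrable[OF finite_P p int3[OF p]] third[OF p] by auto
  have i5: "integrable PM (\<lambda>x. \<bar>x p\<bar>)" "(\<integral>x. \<bar>x p\<bar> \<partial>PM) = (\<integral>u. \<bar>u\<bar> \<partial>\<mu> p)"
    using coordinate_integrable[OF finite_P p coordinate_abs_integrable[OF p]] by auto
  have z: "(\<integral>x. x p * f0 x \<partial>PM) = 0"
    using X[OF int1[OF p] f_meas(2) f0_abs] mean[OF p] by (simp add: f0_def)
  have s: "(\<integral>x. (x p)\<^sup>2 * \<Phi>0 x \<partial>PM) = v p * (\<integral>x. \<Phi>0 x \<partial>PM)"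
    using X[OF int2[OF p] \<Phi>0_meas \<Phi>0_abs] variance[OF p] by (simp add: \<Phi>0_def)
  have "\<bar>(\<integral>x. x p * f x \<partial>PM) - v p * (\<integral>x. \<Phi>0 x \<partial>PM)\<bar>
      = \<bar>\<integral>x. x p * f x - x p * f0 x - (x p)\<^sup>2 * \<Phi>0 x \<partial>PM\<bar>"
    using i1 i2 i3 z s by simp
  also have "\<dots> \<le> (\<integral>x. \<bar>x p * f x - x p * f0 x - (x p)\<^sup>2 * \<Phi>0 x\<bar> \<partial>PM)" by (rule integral_abs_bound)
  also have "\<dots> \<le> (\<integral>x. \<bar>x p\<bar> ^ 3 * (8 * \<delta> / r ^ 4) \<partial>PM)"
    using i1 i2 i3 i4 second_order_expansion[OF p]
    by (intro integral_mono) (auto simp: f_def f0_def \<Phi>0_def)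
  also have "\<dots> = (\<integral>x. \<bar>x p\<bar> ^ 3 \<partial>PM) * (8 * \<delta> / r ^ 4)" by simp
  also have "\<dots> \<le> \<gamma> * (8 * \<delta> / r ^ 4)" using i4 r \<delta>0 by (intro mult_right_mono) auto
  finally have a: "\<bar>(\<integral>x. x p * f x \<partial>PM) - v p * (\<integral>x. \<Phi>0 x \<partial>PM)\<bar> \<le> \<gamma> * (8 * \<delta> / r ^ 4)" .
  have j1: "integrable PM \<Phi>0" by (rule PM.bounded_integrable[OF \<Phi>0_meas \<Phi>0_abs])
  have j2: "integrable PM (Phi p)" by (rule PM.bounded_integrable[OF Phi_meas[OF p] Phi_abs[OF p]])
  have "\<bar>(\<integral>x. Phi p x \<partial>PM) - (\<integral>x. \<Phi>0 x \<partial>PM)\<bar> = \<bar>\<integral>x. Phi p x - \<Phi>0 x \<partial>PM\<bar>"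
    using j1 j2 by simp
  also have "\<dots> \<le> (\<integral>x. \<bar>Phi p x - \<Phi>0 x\<bar> \<partial>PM)" by (rule integral_abs_bound)
  also have "\<dots> \<le> (\<integral>x. \<bar>x p\<bar> * (16 * \<delta> / r ^ 4) \<partial>PM)"
    using j1 j2 i5(1) Phi_diff_le[OF p] by (intro integral_mono) (auto simp: \<Phi>0_def)
  also have "\<dots> = (\<integral>u. \<bar>u\<bar> \<partial>\<mu> p) * (16 * \<delta> / r ^ 4)" using i5 by simp
  finally have "\<bar>v p * ((\<integral>x. Phi p x \<partial>PM) - (\<integral>x. \<Phi>0 x \<partial>PM))\<bar>
      \<le> v p * ((\<integral>u. \<bar>u\<bar> \<partial>\<mu> p) * (16 * \<delta> / r ^ 4))"
    using v0[OF p] by (intro abs_mult_mono) auto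
  also have "\<dots> \<le> \<gamma> * (16 * \<delta> / r ^ 4)"
    unfolding mult.assoc[symmetric, of "v p"] using mixed[OF p] r \<delta>0 by (intro mult_right_mono) auto
  finally have b: "\<bar>v p * ((\<integral>x. Phi p x \<partial>PM) - (\<integral>x. \<Phi>0 x \<partial>PM))\<bar> \<le> \<gamma> * (16 * \<delta> / r ^ 4)" .
  have "(\<integral>x. x p * f x \<partial>PM) - v p * (\<integral>x. Phi p x \<partial>PM)
      = ((\<integral>x. x p * f x \<partial>PM) - v p * (\<integral>x. \<Phi>0 x \<partial>PM)) - v p * ((\<integral>x. Phi p x \<partial>PM) - (\<integral>x. \<Phi>0 x \<partial>PM))"
    by (simp add: algebra_simps)
  also have "\<bar>\<dots>\<bar> \<le> \<gamma> * (8 * \<delta> / r ^ 4) + \<gamma> * (16 * \<delta> / r ^ 4)"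
    by (intro order_trans[OF abs_triangle_ineq4] add_mono a b)
  also have "\<dots> = 24 * \<gamma> * \<delta> / r ^ 4" by simp
  finally show "\<bar>(\<integral>x. x p * (K x (snd p) (fst p) - K x (fst p) (snd p)) \<partial>PM) - v p * (\<integral>x. Phi p x \<partial>PM)\<bar>
      \<le> 24 * \<gamma> * \<delta> / r ^ 4" by (simp add: f_def)
qed

end

text \<open>Efron-Stein with \<open>V (x(p := 0))\<close> as the function that ignores
  \<open>x p\<close>. Each of the at most \<open>m * m\<close> variables contributes at most
  \<open>\<beta> * (2 * \<beta> / r\<^sup>2)\<^sup>2\<close>.\<close>

lemma variance_bound:
  assumes w: "\<And>l. l < m \<Longrightarrow> \<bar>w l\<bar> \<le> \<beta>"
  defines "V \<equiv> \<lambda>x. \<Sum>l<m. w l * G x l l"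
  shows "(\<integral>x. (V x - (\<integral>x. V x \<partial>PM))\<^sup>2 \<partial>PM) \<le> (2 * real m * \<beta> * sqrt \<beta> / r\<^sup>2)\<^sup>2"
proof -
  have V_abs: "\<bar>V x\<bar> \<le> real m * (\<beta> * (1 / r))" for x
  proof -
    have "\<bar>V x\<bar> \<le> (\<Sum>l<m. \<beta> * (1 / r))"
      unfolding V_def by (rule order_trans[OF sum_abs]) (intro sum_mono abs_mult_mono w G_abs, auto)
    then show ?thesis by simp
  qed
  have V_meas: "V \<in> borel_measurable PM"
    unfolding V_def by (intro borel_measurable_sum borel_measurable_times G_meas) auto
  have V_meas0: "(\<lambda>x. V (x(p := 0))) \<in> borel_measurable PM" for p
    unfolding V_def by (intro borel_measurable_sum borel_measurable_times G_meas0) auto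
  \<comment> \<open>Cauchy-Schwarz over \<open>l\<close> uses a column of one resolvent and a row of
    the other, so that no factor \<open>m\<close> arises.\<close>
  have half: "\<bar>\<Sum>l<m. w l * (G y l a * G x b l)\<bar> \<le> \<beta> * (1 / r * (1 / r))" if "a < m" "b < m" for a b x y
  proof -
    have "\<bar>\<Sum>l<m. w l * (G y l a * G x b l)\<bar> \<le> (\<Sum>l<m. \<beta> * (\<bar>G y l a\<bar> * \<bar>G x b l\<bar>))"
      by (rule order_trans[OF sum_abs], intro sum_mono, rule abs_mult_mono) (auto simp: w abs_mult)
    also have "\<dots> = \<beta> * (\<Sum>l<m. \<bar>G y l a\<bar> * \<bar>G x b l\<bar>)" by (simp add: sum_distrib_left)
    also have "\<dots> \<le> \<beta> * (1 / r * (1 / r))"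
      using r \<beta>0 by (intro mult_left_mono sum_abs_mult_le G_col G_row that) auto
    finally show ?thesis .
  qed
  have diff: "(V x - V (x(p := 0)))\<^sup>2 \<le> (x p)\<^sup>2 * (2 * \<beta> / r\<^sup>2)\<^sup>2" if p: "p \<in> P" for p x
  proof -
    note pm = P_D(1,2)[OF p]
    have "V x - V (x(p := 0)) = (\<Sum>l<m. w l * (G x l l - G (x(p := 0)) l l))"
      by (simp add: V_def right_diff_distrib sum_subtractf)
    also have "\<dots> = (\<Sum>l<m. - x p * (w l * (G (x(p := 0)) l (fst p) * G x (snd p) l)
        - w l * (G (x(p := 0)) l (snd p) * G x (fst p) l)))"
    proof (intro sum.cong refl)
      fix l assume "l \<in> {..<m}"
      then have "G x l l - G (x(p := 0)) l l
          = - x p * (G (x(p := 0)) l (fst p) * G x (snd p) l - G (x(p := 0)) l (snd p) * G x (fst p) l)"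
        using G_upd(1)[OF p, of l l x] by simp
      then have "w l * (G x l l - G (x(p := 0)) l l) = w l * (- x p * (G (x(p := 0)) l (fst p) * G x (snd p) l
          - G (x(p := 0)) l (snd p) * G x (fst p) l))"
        by (simp only:)
      then show "w l * (G x l l - G (x(p := 0)) l l) = - x p * (w l * (G (x(p := 0)) l (fst p) * G x (snd p) l)
        - w l * (G (x(p := 0)) l (snd p) * G x (fst p) l))"
        by (simp only: right_diff_distrib mult_ac)
    qed
    also have "\<dots> = - x p * ((\<Sum>l<m. w l * (G (x(p := 0)) l (fst p) * G x (snd p) l))
        - (\<Sum>l<m. w l * (G (x(p := 0)) l (snd p) * G x (fst p) l)))"
      by (simp only: sum_subtractf[symmetric] sum_distrib_left)
    also have "\<bar>\<dots>\<bar> \<le> \<bar>x p\<bar> * (\<beta> * (1 / r * (1 / r)) + \<beta> * (1 / r * (1 / r)))"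
      by (intro abs_mult_mono order_trans[OF abs_triangle_ineq4] add_mono half pm) simp
    finally have "\<bar>V x - V (x(p := 0))\<bar> \<le> \<bar>x p\<bar> * (2 * \<beta> / r\<^sup>2)" by (simp add: power2_eq_square)
    then have "\<bar>V x - V (x(p := 0))\<bar>\<^sup>2 \<le> (\<bar>x p\<bar> * (2 * \<beta> / r\<^sup>2))\<^sup>2" by (intro power_mono) auto
    then show ?thesis unfolding power_mult_distrib power2_abs .
  qed
  have sq: "\<bar>(u - u')\<^sup>2\<bar> \<le> (2 * B)\<^sup>2" if "\<bar>u\<bar> \<le> B" "\<bar>u'\<bar> \<le> B" for u u' B :: real
  proof -
    have "\<bar>u - u'\<bar> \<le> 2 * B" using that by linarith
    then have "\<bar>u - u'\<bar>\<^sup>2 \<le> (2 * B)\<^sup>2" by (intro power_mono) auto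
    then show ?thesis by simp
  qed
  have "(\<integral>x. (V x - (\<integral>x. V x \<partial>PM))\<^sup>2 \<partial>PM) \<le> (\<Sum>p\<in>P. \<integral>x. (V x - V (x(p := 0)))\<^sup>2 \<partial>PM)"
    by (rule efron_stein[OF finite_P V_meas V_abs V_meas0 V_abs]) simp
  also have "\<dots> \<le> (\<Sum>p\<in>P. \<beta> * (2 * \<beta> / r\<^sup>2)\<^sup>2)"
  proof (rule sum_mono)
    fix p assume p: "p \<in> P"
    have "(\<integral>x. (V x - V (x(p := 0)))\<^sup>2 \<partial>PM) \<le> (\<integral>x. (x p)\<^sup>2 * (2 * \<beta> / r\<^sup>2)\<^sup>2 \<partial>PM)"
    proof (rule integral_mono)
      show "integrable PM (\<lambda>x. (V x - V (x(p := 0)))\<^sup>2)"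
        by (rule PM.bounded_integrable[OF _ sq[OF V_abs V_abs]]) (use V_meas V_meas0 in measurable)
      show "integrable PM (\<lambda>x. (x p)\<^sup>2 * (2 * \<beta> / r\<^sup>2)\<^sup>2)"
        using coordinate_integrable(1)[OF finite_P p int2[OF p]] by simp
    qed (rule diff[OF p])
    also have "\<dots> = v p * (2 * \<beta> / r\<^sup>2)\<^sup>2"
      using coordinate_integrable[OF finite_P p int2[OF p]] variance[OF p] by simp
    also have "\<dots> \<le> \<beta> * (2 * \<beta> / r\<^sup>2)\<^sup>2" using var_le[OF p] by (intro mult_right_mono) auto
    finally show "(\<integral>x. (V x - V (x(p := 0)))\<^sup>2 \<partial>PM) \<le> \<beta> * (2 * \<beta> / r\<^sup>2)\<^sup>2" .
  qed
  also have "\<dots> = real (card P) * (\<beta> * (2 * \<beta> / r\<^sup>2)\<^sup>2)" by simp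
  also have "\<dots> \<le> real (m * m) * (\<beta> * (2 * \<beta> / r\<^sup>2)\<^sup>2)"
    using card_P \<beta>0 by (intro mult_right_mono) (auto simp del: of_nat_mult)
  also have "\<dots> = (2 * real m * \<beta> * sqrt \<beta> / r\<^sup>2)\<^sup>2"
    using \<beta>0 by (simp add: power_mult_distrib power_divide) (simp add: power2_eq_square)
  finally show ?thesis .
qed

end

section \<open>The averaged equation for the expected resolvent\<close>

context random_skew
begin

definition g :: "nat \<Rightarrow> real" where
  "g i = (\<integral>x. G x i i \<partial>PM)"

text \<open>The three terms come from the fluctuation of the weighted diagonal sums of
  \<open>G\<close>, from a sum over off-diagonal entries of \<open>G\<close>, and from the
  third-order remainders. With \<open>m\<close> of order n, \<open>\<beta>\<close> of order 1 / n
  and \<open>\<gamma>\<close> of order n^(-3/2), each is of order sqrt n.\<close>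

definition \<Theta> :: real where
  "\<Theta> = 2 * (real m)\<^sup>2 * \<beta> * sqrt \<beta> / r ^ 4 + real m * sqrt (real m) * \<beta> / r ^ 3 + 24 * (real m)\<^sup>2 * \<gamma> / r ^ 4"

lemma \<Theta>_nonneg: "0 \<le> \<Theta>"
  unfolding \<Theta>_def using r \<beta>0 \<gamma>0 by (intro add_nonneg_nonneg divide_nonneg_nonneg mult_nonneg_nonneg) auto

lemma G_integrable: "i < m \<Longrightarrow> j < m \<Longrightarrow> integrable PM (\<lambda>x. G x i j)"
  by (rule PM.bounded_integrable[OF G_meas G_abs])

lemma g_nonneg: "i < m \<Longrightarrow> 0 \<le> g i"
  unfolding g_def using G_nonneg by (intro integral_nonneg_AE) auto

lemma g_le: "i < m \<Longrightarrow> g i \<le> 1 / r"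
  using PM.abs_integral_le[of "\<lambda>x. G x i i" "1 / r"] G_abs[of i i] by (simp add: g_def abs_le_iff)

text \<open>Testing against weights \<open>d\<close> serves two ends: rows of \<open>S\<close> give
  the defect needed for stability, the constant \<open>1\<close> gives the trace. In mean, the noise
  term of the expansion is close to the sum of \<open>v p * Phi D p\<close>; its main part, the sum
  of \<open>V i x * k x i i\<close>, cancels the sum of \<open>e i * k x i i\<close> up to the
  fluctuation of \<open>V i\<close> around its mean \<open>e i\<close>.\<close>

lemma local_law_approx:
  fixes d :: "nat \<Rightarrow> real"
  assumes d: "\<And>k. k < m \<Longrightarrow> \<bar>d k\<bar> \<le> \<delta>" and \<delta>0: "0 \<le> \<delta>"
  defines "R \<equiv> finv m (add_diag h (\<lambda>i. \<Sum>j<m. S i j * g j))"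
  shows "\<bar>\<Sum>k<m. d k * (g k - R k k)\<bar> \<le> \<delta> * \<Theta>"
proof -
  define e where "e = (\<lambda>i. \<Sum>j<m. S i j * g j)"
  have e0: "0 \<le> e i" for i unfolding e_def using S0 g_nonneg by (intro sum_nonneg mult_nonneg_nonneg) auto
  define hR where "hR = add_diag h e"
  have hR: "skew_diag m r hR" unfolding hR_def by (rule skew_diag_add_diag[OF h e0])
  have R: "R = finv m hR" unfolding R_def hR_def e_def ..
  define D where "D = (\<lambda>k b. d k * R k b)"
  have D_col: "(\<Sum>k<m. (D k b)\<^sup>2) \<le> (\<delta> / r)\<^sup>2" if "b < m" for b
  proof -
    have "(\<Sum>k<m. (D k b)\<^sup>2) \<le> (\<Sum>k<m. \<delta>\<^sup>2 * (R k b)\<^sup>2)"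
    proof (intro sum_mono)
      fix k assume "k \<in> {..<m}"
      then have "\<bar>d k\<bar>\<^sup>2 \<le> \<delta>\<^sup>2" using d by (intro power_mono) auto
      then show "(D k b)\<^sup>2 \<le> \<delta>\<^sup>2 * (R k b)\<^sup>2"
        by (simp add: D_def power_mult_distrib mult_right_mono)
    qed
    also have "\<dots> = \<delta>\<^sup>2 * (\<Sum>k<m. (R k b)\<^sup>2)" by (simp add: sum_distrib_left)
    also have "\<dots> \<le> \<delta>\<^sup>2 * (1 / r\<^sup>2)"
      unfolding R by (intro mult_left_mono finv_col_bound[OF hR r that]) auto
    finally show ?thesis by (simp add: power_divide)
  qed
  define k where "k = K D"
  have K_def_D: "K D x a b = (\<Sum>k<m. G x a k * D k b)" for x a b
    by (rule K_def[OF _ \<delta>0]) (rule D_col)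
  have Phi_def_D: "Phi D p x = G x (fst p) (fst p) * K D x (snd p) (snd p) + G x (snd p) (snd p) * K D x (fst p) (fst p)
    - G x (fst p) (snd p) * K D x (fst p) (snd p) - G x (snd p) (fst p) * K D x (snd p) (fst p)" for p x
    by (rule Phi_def[OF _ \<delta>0]) (rule D_col)
  have k_abs: "\<bar>k x a b\<bar> \<le> \<delta> / r\<^sup>2" if "a < m" "b < m" for x a b
    unfolding k_def by (rule K_abs[OF _ \<delta>0 that]) (rule D_col)
  have k_meas: "(\<lambda>x. k x a b) \<in> borel_measurable PM" if "a < m" "b < m" for a b
    unfolding k_def by (rule K_meas[OF _ \<delta>0 that]) (rule D_col)
  have k_entry: "integrable PM (\<lambda>x. x p * (k x (snd p) (fst p) - k x (fst p) (snd p)))"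
      "\<bar>(\<integral>x. x p * (k x (snd p) (fst p) - k x (fst p) (snd p)) \<partial>PM) - v p * (\<integral>x. Phi D p x \<partial>PM)\<bar>
        \<le> 24 * \<gamma> * \<delta> / r ^ 4" if "p \<in> P" for p
    unfolding k_def using entry_expectation[OF _ \<delta>0 that, of D] D_col by blast+
  define V where "V = (\<lambda>i x. \<Sum>j<m. S i j * G x j j)"
  have V_meas: "V i \<in> borel_measurable PM" for i
    unfolding V_def by (intro borel_measurable_sum borel_measurable_times G_meas) auto
  have V_abs: "\<bar>V i x\<bar> \<le> real m * (\<beta> * (1 / r))" for i x
  proof -
    have "\<bar>S i j * G x j j\<bar> \<le> \<beta> * (1 / r)" if "j < m" for j
      by (rule abs_mult_mono[OF _ G_abs[OF that that]]) (simp add: S0 S_le)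
    then have "\<bar>V i x\<bar> \<le> (\<Sum>j<m. \<beta> * (1 / r))"
      unfolding V_def by (intro order_trans[OF sum_abs] sum_mono) auto
    then show ?thesis by simp
  qed
  have V_mean: "(\<integral>x. V i x \<partial>PM) = e i" for i
    unfolding V_def e_def g_def using G_integrable by simp
  define w where "w = (\<lambda>p x. x p * (k x (snd p) (fst p) - k x (fst p) (snd p)))"
  \<comment> \<open>Exact for every \<open>x\<close>: the common part \<open>h\<close> cancels in
    \<open>H x - hR\<close>, which leaves the noise minus the diagonal \<open>e\<close>.\<close>
  have path: "(\<Sum>c<m. d c * (G x c c - R c c)) = (\<Sum>a<m. e a * k x a a) - (\<Sum>p\<in>P. w p x)" for x
  proof -
    have res: "G x c c - R c c = (\<Sum>a<m. \<Sum>l<m. R c a * ((if a = l then e a else 0) - pair_mat P (- 1) x a l) * G x l c)"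
      if c: "c < m" for c
    proof -
      have "R c c - G x c c = (\<Sum>a<m. \<Sum>l<m. R c a * (H x a l - hR a l) * G x l c)"
        unfolding R G_def by (rule resolvent_identity[OF skew_diag_nz[OF hR r] H_det c c])
      then have "G x c c - R c c = - (\<Sum>a<m. \<Sum>l<m. R c a * (H x a l - hR a l) * G x l c)" by simp
      also have "\<dots> = (\<Sum>a<m. \<Sum>l<m. R c a * ((if a = l then e a else 0) - pair_mat P (- 1) x a l) * G x l c)"
        unfolding sum_negf[symmetric]
        by (intro sum.cong refl) (simp add: hR_def add_diag_def H_def algebra_simps)
      finally show ?thesis .
    qed
    have "(\<Sum>c<m. d c * (G x c c - R c c))
        = (\<Sum>c<m. \<Sum>a<m. \<Sum>l<m. ((if a = l then e a else 0) - pair_mat P (- 1) x a l) * (G x l c * D c a))"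
    proof (intro sum.cong refl)
      fix c assume "c \<in> {..<m}"
      then have c: "c < m" by simp
      show "d c * (G x c c - R c c)
        = (\<Sum>a<m. \<Sum>l<m. ((if a = l then e a else 0) - pair_mat P (- 1) x a l) * (G x l c * D c a))"
        unfolding res[OF c] sum_distrib_left by (intro sum.cong refl) (simp add: D_def)
    qed
    also have "\<dots> = (\<Sum>a<m. \<Sum>c<m. \<Sum>l<m. ((if a = l then e a else 0) - pair_mat P (- 1) x a l) * (G x l c * D c a))"
      by (rule sum.swap)
    also have "\<dots> = (\<Sum>a<m. \<Sum>l<m. ((if a = l then e a else 0) - pair_mat P (- 1) x a l) * k x l a)"
    proof (rule sum.cong[OF refl])
      fix a
      have "(\<Sum>c<m. \<Sum>l<m. ((if a = l then e a else 0) - pair_mat P (- 1) x a l) * (G x l c * D c a))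
        = (\<Sum>l<m. \<Sum>c<m. ((if a = l then e a else 0) - pair_mat P (- 1) x a l) * (G x l c * D c a))"
        by (rule sum.swap)
      then show "(\<Sum>c<m. \<Sum>l<m. ((if a = l then e a else 0) - pair_mat P (- 1) x a l) * (G x l c * D c a))
        = (\<Sum>l<m. ((if a = l then e a else 0) - pair_mat P (- 1) x a l) * k x l a)"
        by (simp only: k_def K_def_D sum_distrib_left)
    qed
    also have "\<dots> = (\<Sum>a<m. \<Sum>l<m. (if l = a then e a * k x a a else 0)) - (\<Sum>a<m. \<Sum>l<m. pair_mat P (- 1) x a l * k x l a)"
      unfolding sum_subtractf[symmetric] by (intro sum.cong refl) (auto simp: algebra_simps)
    also have "(\<Sum>a<m. \<Sum>l<m. (if l = a then e a * k x a a else 0)) = (\<Sum>a<m. e a * k x a a)"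
      by simp
    also have "(\<Sum>a<m. \<Sum>l<m. pair_mat P (- 1) x a l * k x l a) = (\<Sum>p\<in>P. w p x)"
      unfolding pair_mat_sum[OF P, of "- 1" x "\<lambda>a l. k x l a"] w_def by simp
    finally show ?thesis .
  qed
  \<comment> \<open>The part of the sum of \<open>v p * Phi D p\<close> with off-diagonal resolvent
    entries. It has no counterpart in the self-consistent equation and must be shown to be
    small.\<close>
  define B where "B = (\<lambda>x. \<Sum>i<m. \<Sum>j<m. S i j * (G x i j * k x i j))"
  have Phi_sum: "(\<Sum>p\<in>P. v p * Phi D p x) = (\<Sum>i<m. V i x * k x i i) - B x" for x
  proof -
    have "(\<Sum>p\<in>P. v p * Phi D p x) = (\<Sum>i<m. \<Sum>j<m. S i j * (G x j j * k x i i - G x i j * k x i j))"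
      unfolding S_def pair_mat_sum[OF P]
      by (intro sum.cong refl) (simp add: Phi_def_D k_def algebra_simps)
    also have "\<dots> = (\<Sum>i<m. V i x * k x i i) - B x"
      unfolding B_def V_def sum_distrib_right sum_subtractf[symmetric]
      by (intro sum.cong refl) (simp add: algebra_simps)
    finally show ?thesis .
  qed
  have Phi_int: "integrable PM (Phi D p)" if "p \<in> P" for p
  proof (rule PM.bounded_integrable)
    show "Phi D p \<in> borel_measurable PM" by (rule Phi_meas[OF _ \<delta>0 that]) (rule D_col)
    show "\<bar>Phi D p x\<bar> \<le> 4 * \<delta> / r ^ 3" for x by (rule Phi_abs[OF _ \<delta>0 that]) (rule D_col)
  qed
  have B_abs: "\<bar>B x\<bar> \<le> real m * (\<beta> * (\<delta> / r\<^sup>2) * (1 / r * sqrt (real m)))" for x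
  proof -
    \<comment> \<open>Cauchy-Schwarz against the constant \<open>1\<close> gives
      \<open>sqrt m\<close> instead of \<open>m\<close> for a row of \<open>G\<close>.\<close>
    have row: "\<bar>\<Sum>j<m. S i j * (G x i j * k x i j)\<bar> \<le> \<beta> * (\<delta> / r\<^sup>2) * (1 / r * sqrt (real m))" if i: "i < m" for i
    proof -
      have "\<bar>\<Sum>j<m. S i j * (G x i j * k x i j)\<bar> \<le> (\<Sum>j<m. \<beta> * (\<bar>G x i j\<bar> * (\<delta> / r\<^sup>2)))"
        by (rule order_trans[OF sum_abs], intro sum_mono, intro abs_mult_mono) (auto simp: S0 S_le intro: k_abs i)
      also have "\<dots> = \<beta> * (\<delta> / r\<^sup>2) * (\<Sum>j<m. \<bar>G x i j\<bar> * \<bar>1\<bar>)"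
        by (simp add: sum_distrib_left mult_ac)
      also have "\<dots> \<le> \<beta> * (\<delta> / r\<^sup>2) * (1 / r * sqrt (real m))"
        using \<beta>0 \<delta>0 r by (intro mult_left_mono sum_abs_mult_le G_row i) auto
      finally show ?thesis .
    qed
    have "\<bar>B x\<bar> \<le> (\<Sum>i<m. \<beta> * (\<delta> / r\<^sup>2) * (1 / r * sqrt (real m)))"
      unfolding B_def by (rule order_trans[OF sum_abs], intro sum_mono row) simp
    then show ?thesis by simp
  qed
  have B_meas: "B \<in> borel_measurable PM"
    unfolding B_def by (intro borel_measurable_sum borel_measurable_times borel_measurable_const G_meas k_meas) auto
  have B_int: "integrable PM B" by (rule PM.bounded_integrable[OF B_meas B_abs])
  have Vk_int: "integrable PM (\<lambda>x. (e i - V i x) * k x i i)" if "i < m" for i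
  proof (rule PM.bounded_integrable)
    show "(\<lambda>x. (e i - V i x) * k x i i) \<in> borel_measurable PM"
      using V_meas k_meas[OF that that] by measurable
    show "\<bar>(e i - V i x) * k x i i\<bar> \<le> (\<bar>e i\<bar> + real m * (\<beta> * (1 / r))) * (\<delta> / r\<^sup>2)" for x
      by (intro abs_mult_mono order_trans[OF abs_triangle_ineq4] add_mono V_abs k_abs that) simp
  qed
  \<comment> \<open>The first absolute moment of \<open>V i - e i\<close> is bounded by the standard
    deviation, to which \<open>variance_bound\<close> applies with the weights
    \<open>S i\<close>.\<close>
  have A_le: "\<bar>\<integral>x. (e i - V i x) * k x i i \<partial>PM\<bar> \<le> 2 * real m * \<beta> * sqrt \<beta> / r\<^sup>2 * (\<delta> / r\<^sup>2)" if i: "i < m" for i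
  proof -
    have Zm: "(\<lambda>x. \<bar>V i x - e i\<bar>) \<in> borel_measurable PM" using V_meas by measurable
    have Zb: "\<bar>\<bar>V i x - e i\<bar>\<bar> \<le> real m * (\<beta> * (1 / r)) + \<bar>e i\<bar>" for x
      using V_abs[of i x] by linarith
    have "(\<integral>x. \<bar>V i x - e i\<bar> \<partial>PM)\<^sup>2 \<le> (\<integral>x. \<bar>V i x - e i\<bar>\<^sup>2 \<partial>PM)"
      by (rule PM.square_integral_le[OF Zm Zb])
    also have "\<dots> \<le> (2 * real m * \<beta> * sqrt \<beta> / r\<^sup>2)\<^sup>2"
      using variance_bound[of "S i"] S0 S_le V_mean[of i] by (simp add: V_def)
    finally have Z: "(\<integral>x. \<bar>V i x - e i\<bar> \<partial>PM) \<le> 2 * real m * \<beta> * sqrt \<beta> / r\<^sup>2"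
      by (rule power2_le_imp_le) (use \<beta>0 r in auto)
    have "\<bar>\<integral>x. (e i - V i x) * k x i i \<partial>PM\<bar> \<le> (\<integral>x. \<bar>(e i - V i x) * k x i i\<bar> \<partial>PM)"
      by (rule integral_abs_bound)
    also have "\<dots> \<le> (\<integral>x. \<bar>V i x - e i\<bar> * (\<delta> / r\<^sup>2) \<partial>PM)"
    proof (rule integral_mono)
      show "integrable PM (\<lambda>x. \<bar>(e i - V i x) * k x i i\<bar>)" by (intro integrable_abs Vk_int i)
      show "integrable PM (\<lambda>x. \<bar>V i x - e i\<bar> * (\<delta> / r\<^sup>2))"
        using PM.bounded_integrable[OF Zm Zb] by simp
      show "\<bar>(e i - V i x) * k x i i\<bar> \<le> \<bar>V i x - e i\<bar> * (\<delta> / r\<^sup>2)" for x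
        by (intro abs_mult_mono k_abs i) (simp add: abs_minus_commute)
    qed
    also have "\<dots> = (\<integral>x. \<bar>V i x - e i\<bar> \<partial>PM) * (\<delta> / r\<^sup>2)" by simp
    also have "\<dots> \<le> 2 * real m * \<beta> * sqrt \<beta> / r\<^sup>2 * (\<delta> / r\<^sup>2)"
      using Z \<delta>0 by (intro mult_right_mono) auto
    finally show ?thesis .
  qed
  have card_bound: "(\<Sum>p\<in>P. 24 * \<gamma> * \<delta> / r ^ 4) \<le> real (m * m) * (24 * \<gamma> * \<delta> / r ^ 4)"
  proof -
    have c0: "0 \<le> 24 * \<gamma> * \<delta> / r ^ 4"
      by (intro divide_nonneg_nonneg mult_nonneg_nonneg \<gamma>0 \<delta>0 zero_le_power less_imp_le[OF r]) simp
    have "real (card P) \<le> real (m * m)" using card_P by (simp only: of_nat_le_iff)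
    from mult_right_mono[OF this c0] show ?thesis by (simp only: sum_constant)
  qed
  have "(\<Sum>c<m. d c * (g c - R c c)) = (\<integral>x. (\<Sum>c<m. d c * (G x c c - R c c)) \<partial>PM)"
    using G_integrable by (simp add: g_def PM.prob_space)
  also have "\<dots> = (\<integral>x. (\<Sum>a<m. e a * k x a a) - (\<Sum>p\<in>P. w p x) \<partial>PM)"
    unfolding path ..
  also have "\<dots> = (\<integral>x. (\<Sum>i<m. (e i - V i x) * k x i i) + B x + ((\<Sum>p\<in>P. v p * Phi D p x) - (\<Sum>p\<in>P. w p x)) \<partial>PM)"
    unfolding Phi_sum by (simp add: left_diff_distrib sum_subtractf)
  also have "\<dots> = (\<Sum>i<m. \<integral>x. (e i - V i x) * k x i i \<partial>PM) + (\<integral>x. B x \<partial>PM)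
      + ((\<Sum>p\<in>P. v p * (\<integral>x. Phi D p x \<partial>PM)) - (\<Sum>p\<in>P. \<integral>x. w p x \<partial>PM))"
  proof -
    have w_int: "integrable PM (w p)" if "p \<in> P" for p using k_entry(1)[OF that] by (simp add: w_def)
    have i1: "integrable PM (\<lambda>x. \<Sum>i<m. (e i - V i x) * k x i i)"
      by (intro Bochner_Integration.integrable_sum Vk_int) simp
    have i3: "integrable PM (\<lambda>x. \<Sum>p\<in>P. v p * Phi D p x)"
      by (intro Bochner_Integration.integrable_sum Bochner_Integration.integrable_mult_right Phi_int)
    have i4: "integrable PM (\<lambda>x. \<Sum>p\<in>P. w p x)"
      by (intro Bochner_Integration.integrable_sum w_int)
    have s1: "(\<integral>x. (\<Sum>i<m. (e i - V i x) * k x i i) \<partial>PM) = (\<Sum>i<m. \<integral>x. (e i - V i x) * k x i i \<partial>PM)"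
      by (rule Bochner_Integration.integral_sum) (simp add: Vk_int)
    have s3: "(\<integral>x. (\<Sum>p\<in>P. v p * Phi D p x) \<partial>PM) = (\<Sum>p\<in>P. v p * (\<integral>x. Phi D p x \<partial>PM))"
      by (subst Bochner_Integration.integral_sum) (simp_all add: Phi_int)
    have s4: "(\<integral>x. (\<Sum>p\<in>P. w p x) \<partial>PM) = (\<Sum>p\<in>P. \<integral>x. w p x \<partial>PM)"
      by (rule Bochner_Integration.integral_sum) (rule w_int)
    show ?thesis
      unfolding Bochner_Integration.integral_add[OF Bochner_Integration.integrable_add[OF i1 B_int]
          Bochner_Integration.integrable_diff[OF i3 i4]]
        Bochner_Integration.integral_add[OF i1 B_int] Bochner_Integration.integral_diff[OF i3 i4] s1 s3 s4 ..
  qed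
  also have "\<dots> = (\<Sum>i<m. \<integral>x. (e i - V i x) * k x i i \<partial>PM) + (\<integral>x. B x \<partial>PM)
      - (\<Sum>p\<in>P. (\<integral>x. w p x \<partial>PM) - v p * (\<integral>x. Phi D p x \<partial>PM))"
    by (simp add: sum_subtractf)
  finally have total: "(\<Sum>c<m. d c * (g c - R c c)) = (\<Sum>i<m. \<integral>x. (e i - V i x) * k x i i \<partial>PM) + (\<integral>x. B x \<partial>PM)
      - (\<Sum>p\<in>P. (\<integral>x. w p x \<partial>PM) - v p * (\<integral>x. Phi D p x \<partial>PM))" .
  have "\<bar>\<Sum>c<m. d c * (g c - R c c)\<bar> \<le> (\<Sum>i<m. 2 * real m * \<beta> * sqrt \<beta> / r\<^sup>2 * (\<delta> / r\<^sup>2))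
      + real m * (\<beta> * (\<delta> / r\<^sup>2) * (1 / r * sqrt (real m))) + (\<Sum>p\<in>P. 24 * \<gamma> * \<delta> / r ^ 4)"
    unfolding total
  proof (intro order_trans[OF abs_triangle_ineq4] order_trans[OF abs_triangle_ineq] add_mono)
    show "\<bar>\<Sum>i<m. \<integral>x. (e i - V i x) * k x i i \<partial>PM\<bar> \<le> (\<Sum>i<m. 2 * real m * \<beta> * sqrt \<beta> / r\<^sup>2 * (\<delta> / r\<^sup>2))"
      by (intro order_trans[OF sum_abs] sum_mono A_le) simp
    show "\<bar>\<integral>x. B x \<partial>PM\<bar> \<le> real m * (\<beta> * (\<delta> / r\<^sup>2) * (1 / r * sqrt (real m)))"
      by (rule PM.abs_integral_le[OF B_abs])
    show "\<bar>\<Sum>p\<in>P. (\<integral>x. w p x \<partial>PM) - v p * (\<integral>x. Phi D p x \<partial>PM)\<bar> \<le> (\<Sum>p\<in>P. 24 * \<gamma> * \<delta> / r ^ 4)"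
      unfolding w_def by (intro order_trans[OF sum_abs] sum_mono k_entry(2))
  qed
  also have "\<dots> \<le> (\<Sum>i<m. 2 * real m * \<beta> * sqrt \<beta> / r\<^sup>2 * (\<delta> / r\<^sup>2))
      + real m * (\<beta> * (\<delta> / r\<^sup>2) * (1 / r * sqrt (real m))) + real (m * m) * (24 * \<gamma> * \<delta> / r ^ 4)"
    by (rule add_left_mono[OF card_bound])
  also have "(\<Sum>i<m. 2 * real m * \<beta> * sqrt \<beta> / r\<^sup>2 * (\<delta> / r\<^sup>2)) = \<delta> * (2 * (real m)\<^sup>2 * \<beta> * sqrt \<beta> / r ^ 4)"
    by (simp add: power2_eq_square power4_eq_xxxx mult_ac)
  also have "real m * (\<beta> * (\<delta> / r\<^sup>2) * (1 / r * sqrt (real m))) = \<delta> * (real m * sqrt (real m) * \<beta> / r ^ 3)"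
    by (simp add: power2_eq_square power3_eq_cube mult_ac)
  also have "real (m * m) * (24 * \<gamma> * \<delta> / r ^ 4) = \<delta> * (24 * (real m)\<^sup>2 * \<gamma> / r ^ 4)"
    by (simp add: power2_eq_square mult_ac)
  finally show ?thesis by (simp only: \<Theta>_def distrib_left)
qed

text \<open>\<open>R\<close> is the resolvent whose diagonal is predicted from \<open>g\<close>.
  \<open>local_law_approx\<close> bounds \<open>g - R\<close> both summed and averaged by
  \<open>S\<close>; the averaged defect, of size \<open>\<beta> * \<Theta>\<close>, feeds the
  stability estimate for \<open>R - t\<close>. Summing that over \<open>m\<close> indices costs a
  factor \<open>m * \<beta> \<le> \<kappa>\<close>, so the total stays of order
  \<open>\<Theta>\<close>.\<close>

lemma trace_estimate:
  fixes t :: "nat \<Rightarrow> real"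
  assumes t: "\<And>i. i < m \<Longrightarrow> 0 \<le> t i"
      "\<And>i. i < m \<Longrightarrow> t i = finv m (add_diag h (\<lambda>i. \<Sum>j<m. S i j * t j)) i i"
    and \<kappa>: "real m * \<beta> \<le> \<kappa>" and small: "\<beta> * \<Theta> \<le> r / 2"
  shows "\<bar>(\<Sum>k<m. g k) - (\<Sum>k<m. t k)\<bar> \<le> \<Theta> * (1 + 2 * \<kappa> * (r + \<kappa> / r)\<^sup>2 / r ^ 4)"
proof -
  define R where "R = finv m (add_diag h (\<lambda>i. \<Sum>j<m. S i j * g j))"
  have eta: "\<bar>\<Sum>j<m. S i j * (g j - R j j)\<bar> \<le> \<beta> * \<Theta>" for i
    unfolding R_def by (rule local_law_approx) (use S0 S_le \<beta>0 in auto)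
  have rt: "\<bar>R i i - t i\<bar> \<le> 2 * (r + \<kappa> / r)\<^sup>2 * (\<beta> * \<Theta>) / r ^ 4" if i: "i < m" for i
  proof (rule fixed_point_stability(2)[OF h h_diag r S0 _ g_nonneg g_le t _ eta small i])
    show "(\<Sum>j<m. S i j) \<le> \<kappa>" for i using S_row[of i] \<kappa> by linarith
  qed (auto simp: R_def)
  have "(\<Sum>k<m. g k) - (\<Sum>k<m. t k) = (\<Sum>k<m. 1 * (g k - R k k)) + (\<Sum>k<m. R k k - t k)"
    by (simp add: sum_subtractf)
  also have "\<bar>\<dots>\<bar> \<le> 1 * \<Theta> + (\<Sum>k<m. 2 * (r + \<kappa> / r)\<^sup>2 * (\<beta> * \<Theta>) / r ^ 4)"
  proof (intro order_trans[OF abs_triangle_ineq] add_mono)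
    show "\<bar>\<Sum>k<m. 1 * (g k - R k k)\<bar> \<le> 1 * \<Theta>"
      unfolding R_def by (rule local_law_approx) auto
    show "\<bar>\<Sum>k<m. R k k - t k\<bar> \<le> (\<Sum>k<m. 2 * (r + \<kappa> / r)\<^sup>2 * (\<beta> * \<Theta>) / r ^ 4)"
      by (intro order_trans[OF sum_abs] sum_mono rt) simp
  qed
  also have "\<dots> = \<Theta> + (real m * \<beta>) * (\<Theta> * (2 * (r + \<kappa> / r)\<^sup>2 / r ^ 4))"
    by (simp add: mult_ac)
  also have "\<dots> \<le> \<Theta> + \<kappa> * (\<Theta> * (2 * (r + \<kappa> / r)\<^sup>2 / r ^ 4))"
    using \<kappa> \<Theta>_nonneg r by (intro add_left_mono mult_right_mono) auto
  also have "\<dots> = \<Theta> * (1 + 2 * \<kappa> * (r + \<kappa> / r)\<^sup>2 / r ^ 4)"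
    by (simp add: algebra_simps)
  finally show ?thesis .
qed

end

subsection \<open>Dependence on the diagonal\<close>

text \<open>The diagonal of \<open>B\<close> is overwritten, not shifted; bounds in terms of
  \<open>B\<close> therefore leave out its diagonal entries.\<close>

definition const_diag :: "real \<Rightarrow> (nat \<Rightarrow> nat \<Rightarrow> real) \<Rightarrow> nat \<Rightarrow> nat \<Rightarrow> real" where
  "const_diag r B i j = (if i = j then r else B i j)"

lemma const_diag_diag [simp]: "const_diag r B i i = r"
  by (simp add: const_diag_def)

lemma skew_diag_const_diag:
  assumes "\<And>i j. i < m \<Longrightarrow> j < m \<Longrightarrow> i \<noteq> j \<Longrightarrow> B i j = - B j i"
  shows "skew_diag m r (const_diag r B)"
proof (rule skew_diagI)
  fix i j assume ij: "i < m" "j < m" "i \<noteq> j"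
  from assms[OF ij] show "const_diag r B i j = - const_diag r B j i"
    using ij(3) by (simp add: const_diag_def)
qed simp

lemma fdet_scale: "fdet m (\<lambda>i j. c * h i j) = c ^ m * fdet m h"
proof -
  have "fmat m (\<lambda>i j. c * h i j) = c \<cdot>\<^sub>m fmat m h" by (intro eq_matI) auto
  then show ?thesis by (simp add: fdet_def)
qed

text \<open>Dividing all entries by \<open>r\<close> takes \<open>r ^ m\<close> out of the
  determinant and leaves matrices that tend to the identity.\<close>

lemma ln_fdet_tendsto:
  fixes h :: "real \<Rightarrow> nat \<Rightarrow> nat \<Rightarrow> real"
  assumes "\<And>i j. i < m \<Longrightarrow> j < m \<Longrightarrow> ((\<lambda>r. h r i j / r) \<longlongrightarrow> (if i = j then 1 else 0)) at_top"
    and skew: "\<And>r. 0 < r \<Longrightarrow> skew_diag m r (h r)"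
  shows "((\<lambda>r. ln (fdet m (h r)) - real m * ln r) \<longlongrightarrow> 0) at_top"
proof -
  have "((\<lambda>r. fdet m (\<lambda>i j. h r i j / r)) \<longlongrightarrow> fdet m (\<lambda>i j. if i = j then 1 else 0)) at_top"
    by (rule fdet_tendsto) (rule assms)
  moreover have "fdet m (\<lambda>i j. if i = j then 1 else 0 :: real) = 1"
    by (subst fdet_diag) auto
  ultimately have "((\<lambda>r. ln (fdet m (\<lambda>i j. h r i j / r))) \<longlongrightarrow> ln 1) at_top"
    by (intro tendsto_ln) auto
  moreover have "eventually (\<lambda>r. ln (fdet m (\<lambda>i j. h r i j / r)) = ln (fdet m (h r)) - real m * ln r) at_top"
    using eventually_gt_at_top[of 0]
  proof eventually_elim
    case (elim r)
    have "fdet m (\<lambda>i j. h r i j / r) = (1 / r) ^ m * fdet m (h r)"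
      using fdet_scale[of m "1 / r" "h r"] by simp
    then show ?case
      using skew_diag_det_pos[OF skew[OF elim] elim] elim
      by (simp add: ln_mult ln_realpow ln_div power_divide)
  qed
  ultimately show ?thesis by (simp add: tendsto_cong)
qed

text \<open>\<open>u\<close> decreases to \<open>0\<close>, hence is nonnegative; the difference
  \<open>u s - c / (2 * s\<^sup>2)\<close> increases to \<open>0\<close>, hence is
  nonpositive.\<close>

lemma decay_from_derivative:
  fixes u :: "real \<Rightarrow> real"
  assumes r: "0 < r" and u: "\<And>s. r \<le> s \<Longrightarrow> (u has_real_derivative u' s) (at s)"
    and up: "\<And>s. r \<le> s \<Longrightarrow> u' s \<le> 0" and low: "\<And>s. r \<le> s \<Longrightarrow> - c / s ^ 3 \<le> u' s"
    and lim: "(u \<longlongrightarrow> 0) at_top"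
  shows "0 \<le> u r" "u r \<le> c / (2 * r\<^sup>2)"
proof -
  have "u s \<le> u r" if "r \<le> s" for s
    using that u up by (intro DERIV_nonpos_imp_nonincreasing[OF that]) blast
  then have "eventually (\<lambda>s. u s \<le> u r) at_top"
    by (intro eventually_mono[OF eventually_ge_at_top[of r]])
  then show "0 \<le> u r" by (intro tendsto_upperbound[OF lim]) auto
  define w where "w = (\<lambda>s. u s - c / 2 * inverse (s\<^sup>2))"
  have w': "(w has_real_derivative u' s + c / s ^ 3) (at s)" if "r \<le> s" for s
    unfolding w_def using that r
    by (auto intro!: derivative_eq_intros u[OF that] simp: field_simps power2_eq_square power3_eq_cube)
  have "w r \<le> w s" if "r \<le> s" for s
  proof (rule DERIV_nonneg_imp_nondecreasing[OF that])
    fix x assume "r \<le> x" "x \<le> s"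
    then show "\<exists>y. (w has_real_derivative y) (at x) \<and> 0 \<le> y"
      using w'[of x] low[of x] by (intro exI[of _ "u' x + c / x ^ 3"]) auto
  qed
  then have "eventually (\<lambda>s. w r \<le> w s) at_top"
    by (intro eventually_mono[OF eventually_ge_at_top[of r]])
  moreover have "(w \<longlongrightarrow> 0 - c / 2 * 0) at_top"
    unfolding w_def
    by (intro tendsto_intros lim tendsto_inverse_0_at_top filterlim_pow_at_top filterlim_ident) auto
  ultimately have "w r \<le> 0" using tendsto_lowerbound[of w 0 at_top "w r"] by simp
  then show "u r \<le> c / (2 * r\<^sup>2)" by (simp add: w_def field_simps)
qed

lemma has_real_derivative_of_quadratic_bound:
  fixes f :: "real \<Rightarrow> real"
  assumes "0 < \<epsilon>" "\<And>s. \<bar>s - r\<bar> < \<epsilon> \<Longrightarrow> \<bar>f s - f r - (s - r) * d\<bar> \<le> C * (s - r)\<^sup>2"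
  shows "(f has_real_derivative d) (at r)"
proof -
  have "((\<lambda>s. (f s - f r) / (s - r) - d) \<longlongrightarrow> 0) (at r)"
  proof (rule Lim_null_comparison)
    show "eventually (\<lambda>s. norm ((f s - f r) / (s - r) - d) \<le> C * \<bar>s - r\<bar>) (at r)"
      unfolding eventually_at
    proof (intro exI[of _ \<epsilon>] conjI ballI impI assms(1))
      fix s assume s: "s \<noteq> r \<and> dist s r < \<epsilon>"
      have "(f s - f r) / (s - r) - d = (f s - f r - (s - r) * d) / (s - r)"
        using s by (simp add: diff_divide_distrib)
      then have "\<bar>(f s - f r) / (s - r) - d\<bar> = \<bar>f s - f r - (s - r) * d\<bar> / \<bar>s - r\<bar>"
        by (simp only: abs_divide)
      also have "\<dots> \<le> C * (s - r)\<^sup>2 / \<bar>s - r\<bar>"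
        using s assms(2)[of s] by (intro divide_right_mono) (auto simp: dist_real_def)
      also have "\<dots> = C * \<bar>s - r\<bar>" using s by (simp add: power2_eq_square abs_if field_simps)
      finally show "norm ((f s - f r) / (s - r) - d) \<le> C * \<bar>s - r\<bar>" by simp
    qed
    have "((\<lambda>s. C * \<bar>s - r\<bar>) \<longlongrightarrow> C * \<bar>r - r\<bar>) (at r)" by (intro tendsto_intros)
    then show "((\<lambda>s. C * \<bar>s - r\<bar>) \<longlongrightarrow> 0) (at r)" by simp
  qed
  then show ?thesis unfolding has_field_derivative_iff by (rule LIM_zero_cancel)
qed

context
  fixes m :: nat and B :: "nat \<Rightarrow> nat \<Rightarrow> real"
  assumes offdiag: "\<And>i j. i < m \<Longrightarrow> j < m \<Longrightarrow> i \<noteq> j \<Longrightarrow> B i j = - B j i"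
begin

lemma const_diag_skew: "skew_diag m r (const_diag r B)"
  by (rule skew_diag_const_diag) (rule offdiag)

lemma ln_fdet_const_diag_deriv:
  assumes r: "0 < r"
  shows "((\<lambda>r. ln (fdet m (const_diag r B))) has_real_derivative (\<Sum>k<m. finv m (const_diag r B) k k)) (at r)"
proof -
  have "((\<lambda>r. ln (fdet m (const_diag r B))) has_real_derivative
    (\<Sum>k<m. \<Sum>l<m. finv m (const_diag r B) k l * (if l = k then 1 else 0))) (at r)"
  proof (rule ln_fdet_has_derivative[where r = r])
    fix i j show "((\<lambda>r. const_diag r B i j) has_real_derivative (if i = j then 1 else 0)) (at r)"
      by (cases "i = j") (auto simp: const_diag_def)
  qed (rule const_diag_skew r)+
  then show ?thesis by (simp add: if_distrib[of "\<lambda>x. _ * x"] cong: if_cong)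
qed

text \<open>The derivative of the logarithmic determinant is Lipschitz with a constant that depends
  on \<open>m\<close> and \<open>r0\<close> but not on \<open>B\<close>. This makes the Taylor bound
  below uniform in the noise.\<close>

lemma trace_const_diag_lipschitz:
  assumes r: "0 < r0" "r0 \<le> r" "r0 \<le> s"
  shows "\<bar>(\<Sum>k<m. finv m (const_diag s B) k k) - (\<Sum>k<m. finv m (const_diag r B) k k)\<bar> \<le> \<bar>s - r\<bar> * (real m / r0\<^sup>2)"
proof -
  have sk: "skew_diag m r0 (const_diag q B)" if "r0 \<le> q" for q
    by (rule skew_diag_mono[OF const_diag_skew that])
  have "\<bar>finv m (const_diag s B) k k - finv m (const_diag r B) k k\<bar> \<le> \<bar>s - r\<bar> * (1 / r0 * (1 / r0))" if k: "k < m" for k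
  proof -
    have "finv m (const_diag s B) k k - finv m (const_diag r B) k k
      = (\<Sum>a<m. \<Sum>l<m. finv m (const_diag s B) k a * (const_diag r B a l - const_diag s B a l) * finv m (const_diag r B) l k)"
      by (rule resolvent_identity[OF skew_diag_nz[OF sk r(1)] skew_diag_nz[OF sk r(1)] k k]) (use r in auto)
    also have "\<dots> = (\<Sum>a<m. \<Sum>l<m. if l = a then (r - s) * (finv m (const_diag s B) k a * finv m (const_diag r B) a k) else 0)"
      by (intro sum.cong refl) (auto simp: const_diag_def)
    also have "\<dots> = (r - s) * (\<Sum>a<m. finv m (const_diag s B) k a * finv m (const_diag r B) a k)"
      by (simp add: sum_distrib_left)
    also have "\<bar>\<dots>\<bar> \<le> \<bar>s - r\<bar> * (1 / r0 * (1 / r0))"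
    proof (rule abs_mult_mono)
      have "\<bar>\<Sum>a<m. finv m (const_diag s B) k a * finv m (const_diag r B) a k\<bar>
          \<le> (\<Sum>a<m. \<bar>finv m (const_diag s B) k a\<bar> * \<bar>finv m (const_diag r B) a k\<bar>)"
        by (rule order_trans[OF sum_abs]) (simp add: abs_mult)
      also have "\<dots> \<le> 1 / r0 * (1 / r0)"
        using finv_row_bound[OF sk[OF r(3)] r(1) k] finv_col_bound[OF sk[OF r(2)] r(1) k] r
        by (intro sum_abs_mult_le) (auto simp: power_divide)
      finally show "\<bar>\<Sum>a<m. finv m (const_diag s B) k a * finv m (const_diag r B) a k\<bar> \<le> 1 / r0 * (1 / r0)" .
    qed (simp add: abs_minus_commute)
    finally show ?thesis .
  qed
  then have "\<bar>\<Sum>k<m. finv m (const_diag s B) k k - finv m (const_diag r B) k k\<bar> \<le> (\<Sum>k<m. \<bar>s - r\<bar> * (1 / r0 * (1 / r0)))"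
    by (intro order_trans[OF sum_abs] sum_mono) simp
  then show ?thesis by (simp add: sum_subtractf power2_eq_square mult_ac)
qed

lemma ln_fdet_const_diag_taylor:
  assumes r: "0 < r0" "r0 \<le> r" "r0 \<le> s"
  shows "\<bar>ln (fdet m (const_diag s B)) - ln (fdet m (const_diag r B)) - (s - r) * (\<Sum>k<m. finv m (const_diag r B) k k)\<bar>
    \<le> real m / r0\<^sup>2 * (s - r)\<^sup>2"
proof (cases "s = r")
  case False
  let ?f = "\<lambda>r. ln (fdet m (const_diag r B))" and ?f' = "\<lambda>r. \<Sum>k<m. finv m (const_diag r B) k k"
  have "\<exists>z. min r s < z \<and> z < max r s \<and> ?f (max r s) - ?f (min r s) = (max r s - min r s) * ?f' z"
    using False r by (intro MVT2 ln_fdet_const_diag_deriv) auto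
  then obtain z where z: "min r s < z" "z < max r s" "?f (max r s) - ?f (min r s) = (max r s - min r s) * ?f' z"
    by blast
  have eq: "?f s - ?f r = (s - r) * ?f' z"
  proof (cases "r \<le> s")
    case False
    then have "?f r - ?f s = (r - s) * ?f' z" using z(3) by simp
    then have "?f s - ?f r = - ((r - s) * ?f' z)" by linarith
    then show ?thesis by (simp add: left_diff_distrib)
  qed (use z(3) in simp)
  have "?f s - ?f r - (s - r) * ?f' r = (s - r) * (?f' z - ?f' r)"
    unfolding eq by (simp add: right_diff_distrib)
  also have "\<bar>\<dots>\<bar> \<le> \<bar>s - r\<bar> * (\<bar>z - r\<bar> * (real m / r0\<^sup>2))"
    by (rule abs_mult_mono[OF order_refl], rule trace_const_diag_lipschitz[OF r(1)]) (use z r in auto)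
  also have "\<dots> \<le> \<bar>s - r\<bar> * (\<bar>s - r\<bar> * (real m / r0\<^sup>2))"
    using z by (intro mult_left_mono mult_right_mono) auto
  also have "\<dots> = (\<bar>s - r\<bar> * \<bar>s - r\<bar>) * (real m / r0\<^sup>2)" by simp
  also have "\<bar>s - r\<bar> * \<bar>s - r\<bar> = (s - r)\<^sup>2" by (simp add: power2_eq_square)
  finally show ?thesis by (simp only: mult.commute)
qed simp

text \<open>The upper bound is \<open>finv_diag_le\<close>, the lower one is the second-order bound
  \<open>finv_diag_approx\<close>; hence the trace deviates from m / r only at order r^-3.\<close>

lemma trace_const_diag_bounds:
  assumes r: "0 < r"
  shows "(\<Sum>k<m. finv m (const_diag r B) k k) - real m / r \<le> 0"
    and "- (\<Sum>i<m. \<Sum>j<m. if j = i then 0 else (B i j)\<^sup>2) / r ^ 3 \<le> (\<Sum>k<m. finv m (const_diag r B) k k) - real m / r"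
proof -
  have sk: "skew_diag m r (const_diag r B)" by (rule const_diag_skew)
  have e: "(\<Sum>k<m. finv m (const_diag r B) k k) - real m / r = (\<Sum>k<m. finv m (const_diag r B) k k - 1 / r)"
    by (simp add: sum_subtractf)
  show "(\<Sum>k<m. finv m (const_diag r B) k k) - real m / r \<le> 0"
    unfolding e using finv_diag_le[OF sk r] by (intro sum_nonpos) simp
  have "(\<Sum>i<m. - (\<Sum>j<m. if j = i then 0 else (B i j)\<^sup>2) / r ^ 3) \<le> (\<Sum>k<m. finv m (const_diag r B) k k - 1 / r)"
  proof (rule sum_mono)
    fix k assume "k \<in> {..<m}"
    then have k: "k < m" by simp
    have "(\<Sum>j<m. if j = k then 0 else (const_diag r B k j)\<^sup>2) = (\<Sum>j<m. if j = k then 0 else (B k j)\<^sup>2)"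
      by (intro sum.cong refl) (simp add: const_diag_def)
    then have "1 / r - finv m (const_diag r B) k k \<le> (\<Sum>j<m. if j = k then 0 else (B k j)\<^sup>2) / r ^ 3"
      using finv_diag_approx(2)[OF sk r k] by simp
    moreover have "- (\<Sum>j<m. if j = k then 0 else (B k j)\<^sup>2) / r ^ 3 = - ((\<Sum>j<m. if j = k then 0 else (B k j)\<^sup>2) / r ^ 3)"
      by simp
    ultimately show "- (\<Sum>j<m. if j = k then 0 else (B k j)\<^sup>2) / r ^ 3 \<le> finv m (const_diag r B) k k - 1 / r"
      by linarith
  qed
  then show "- (\<Sum>i<m. \<Sum>j<m. if j = i then 0 else (B i j)\<^sup>2) / r ^ 3 \<le> (\<Sum>k<m. finv m (const_diag r B) k k) - real m / r"
    unfolding e by (simp only: sum_divide_distrib[symmetric] sum_negf)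
qed

lemma ln_fdet_const_diag_bounds:
  assumes r: "0 < r"
  shows "0 \<le> ln (fdet m (const_diag r B)) - real m * ln r"
    and "ln (fdet m (const_diag r B)) - real m * ln r \<le> (\<Sum>i<m. \<Sum>j<m. if j = i then 0 else (B i j)\<^sup>2) / (2 * r\<^sup>2)"
proof -
  define u' where "u' = (\<lambda>s. (\<Sum>k<m. finv m (const_diag s B) k k) - real m / s)"
  have d: "((\<lambda>s. ln (fdet m (const_diag s B)) - real m * ln s) has_real_derivative u' s) (at s)" if "r \<le> s" for s
    unfolding u'_def using that r
    by (intro DERIV_diff ln_fdet_const_diag_deriv) (auto intro!: derivative_eq_intros simp: divide_inverse)
  have lim: "((\<lambda>s. ln (fdet m (const_diag s B)) - real m * ln s) \<longlongrightarrow> 0) at_top"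
  proof (rule ln_fdet_tendsto)
    fix i j
    have "((\<lambda>r. B i j / r) \<longlongrightarrow> 0) at_top"
      by (rule real_tendsto_divide_at_top[OF tendsto_const filterlim_ident])
    moreover have "((\<lambda>r::real. r / r) \<longlongrightarrow> 1) at_top"
      by (rule tendsto_eventually) (rule eventually_mono[OF eventually_gt_at_top[of 0]], simp)
    ultimately show "((\<lambda>r. const_diag r B i j / r) \<longlongrightarrow> (if i = j then 1 else 0)) at_top"
      by (cases "i = j") (auto simp: const_diag_def)
  qed (rule const_diag_skew)
  note b = decay_from_derivative[OF r d _ _ lim, where c = "\<Sum>i<m. \<Sum>j<m. if j = i then 0 else (B i j)\<^sup>2"]
  show "0 \<le> ln (fdet m (const_diag r B)) - real m * ln r"
    by (rule b(1)) (use trace_const_diag_bounds r in \<open>auto simp: u'_def\<close>)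
  show "ln (fdet m (const_diag r B)) - real m * ln r \<le> (\<Sum>i<m. \<Sum>j<m. if j = i then 0 else (B i j)\<^sup>2) / (2 * r\<^sup>2)"
    by (rule b(2)) (use trace_const_diag_bounds r in \<open>auto simp: u'_def\<close>)
qed

end

section \<open>Solutions of the self-consistent equation as functions of the diagonal\<close>

lemma finv_tendsto:
  fixes h :: "'x \<Rightarrow> nat \<Rightarrow> nat \<Rightarrow> real"
  assumes lim: "\<And>i j. i < m \<Longrightarrow> j < m \<Longrightarrow> ((\<lambda>x. h x i j) \<longlongrightarrow> h0 i j) F"
    and nz: "eventually (\<lambda>x. fdet m (h x) \<noteq> 0) F" and nz0: "fdet m h0 \<noteq> 0" and ij: "i < m" "j < m"
  shows "((\<lambda>x. finv m (h x) i j) \<longlongrightarrow> finv m h0 i j) F"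
proof -
  have "((\<lambda>x. fdet m (\<lambda>a b. if b = i then (if a = j then 1 else 0) else h x a b) / fdet m (h x))
    \<longlongrightarrow> finv m h0 i j) F"
    unfolding finv_cramer[OF nz0 ij]
  proof (intro tendsto_divide fdet_tendsto lim nz0)
    fix a b assume ab: "a < m" "b < m"
    show "((\<lambda>x. if b = i then if a = j then 1 else 0 else h x a b) \<longlongrightarrow> (if b = i then if a = j then 1 else 0 else h0 a b)) F"
      using lim[OF ab] by (cases "b = i") auto
  qed auto
  moreover have "eventually (\<lambda>x. finv m (h x) i j
      = fdet m (\<lambda>a b. if b = i then (if a = j then 1 else 0) else h x a b) / fdet m (h x)) F"
    using nz by eventually_elim (rule finv_cramer[OF _ ij])
  ultimately show ?thesis by (simp add: tendsto_cong)
qed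

text \<open>Differentiability is asked of \<open>S t\<close>, not of \<open>t\<close>: the
  transforms \<open>psi\<close> encode exactly \<open>S t\<close>, so their smoothness passes to it
  directly.\<close>

locale dyson_family =
  fixes m :: nat and B S :: "nat \<Rightarrow> nat \<Rightarrow> real" and \<kappa> a :: real and t :: "real \<Rightarrow> nat \<Rightarrow> real"
  assumes offdiag: "\<And>i j. i < m \<Longrightarrow> j < m \<Longrightarrow> i \<noteq> j \<Longrightarrow> B i j = - B j i"
    and row_B: "\<And>i. i < m \<Longrightarrow> (\<Sum>j<m. (B i j)\<^sup>2) \<le> a"
    and S0: "\<And>i j. 0 \<le> S i j" and S_sym: "\<And>i j. S i j = S j i"
    and S_row: "\<And>i. i < m \<Longrightarrow> (\<Sum>j<m. S i j) \<le> \<kappa>"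
    and t0: "\<And>r i. 0 < r \<Longrightarrow> i < m \<Longrightarrow> 0 \<le> t r i"
    and t_eq: "\<And>r i. 0 < r \<Longrightarrow> i < m \<Longrightarrow>
      t r i = finv m (add_diag (const_diag r B) (\<lambda>i. \<Sum>j<m. S i j * t r j)) i i"
    and t_diff: "\<And>r i. 0 < r \<Longrightarrow> i < m \<Longrightarrow> (\<lambda>r. \<Sum>j<m. S i j * t r j) differentiable (at r)"
begin

definition q :: "real \<Rightarrow> nat \<Rightarrow> real" where
  "q r i = (\<Sum>j<m. S i j * t r j)"

definition hh :: "real \<Rightarrow> nat \<Rightarrow> nat \<Rightarrow> real" where
  "hh r = add_diag (const_diag r B) (q r)"

definition \<Lambda> :: "real \<Rightarrow> real" where
  "\<Lambda> r = ln (fdet m (hh r)) - (\<Sum>i<m. t r i * q r i) / 2"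

lemma q0: "0 < r \<Longrightarrow> 0 \<le> q r i"
  unfolding q_def using S0 t0 by (intro sum_nonneg mult_nonneg_nonneg) auto

lemma hh_skew:
  assumes "0 < r"
  shows "skew_diag m r (hh r)"
proof -
  have "skew_diag m r (const_diag r B)" by (rule skew_diag_const_diag) (rule offdiag)
  then show ?thesis unfolding hh_def using q0[OF assms] by (rule skew_diag_add_diag)
qed

lemma hh_diag: "hh r i i = r + q r i"
  by (simp add: hh_def add_diag_def)

lemma hh_offdiag: "i \<noteq> j \<Longrightarrow> hh r i j = B i j"
  by (simp add: hh_def add_diag_def const_diag_def)

lemma t_finv: "0 < r \<Longrightarrow> i < m \<Longrightarrow> t r i = finv m (hh r) i i"
  using t_eq[of r i] by (simp add: hh_def q_def[abs_def])

lemma t_le: "0 < r \<Longrightarrow> i < m \<Longrightarrow> t r i \<le> 1 / r"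
  using finv_diag_le[OF hh_skew] by (simp add: t_finv)

lemma \<kappa>0: "i < m \<Longrightarrow> 0 \<le> \<kappa>"
  using S_row[of i] S0 by (meson order_trans sum_nonneg)

lemma q_le:
  assumes r: "0 < r" and i: "i < m"
  shows "q r i \<le> \<kappa> / r"
proof -
  have "q r i \<le> (\<Sum>j<m. S i j * (1 / r))"
    unfolding q_def using t_le[OF r] S0 by (intro sum_mono mult_left_mono) auto
  also have "\<dots> = (\<Sum>j<m. S i j) * (1 / r)" by (simp only: sum_distrib_right)
  also have "\<dots> \<le> \<kappa> * (1 / r)" using S_row[OF i] r by (intro mult_right_mono) auto
  finally show ?thesis by simp
qed

definition q' :: "real \<Rightarrow> nat \<Rightarrow> real" where
  "q' r i = deriv (\<lambda>r. q r i) r"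

lemma q_deriv:
  assumes "0 < r" "i < m"
  shows "((\<lambda>r. q r i) has_real_derivative q' r i) (at r)"
  using t_diff[OF assms] unfolding q'_def q_def[abs_def]
  by (simp add: DERIV_deriv_iff_real_differentiable)

text \<open>Continuity of \<open>t\<close> is recovered from that of \<open>q\<close>, since the
  entries of an inverse depend continuously on the matrix.\<close>

lemma t_tendsto:
  assumes r: "0 < r" and i: "i < m"
  shows "((\<lambda>r. t r i) \<longlongrightarrow> t r i) (at r)"
proof -
  have ev: "eventually (\<lambda>s. 0 < s) (at r)"
    using r by (intro order_tendstoD(1)[OF tendsto_ident_at]) auto
  have "((\<lambda>s. finv m (hh s) i i) \<longlongrightarrow> finv m (hh r) i i) (at r)"
  proof (rule finv_tendsto)
    fix a b assume "a < m" "b < m"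
    then show "((\<lambda>s. hh s a b) \<longlongrightarrow> hh r a b) (at r)"
      using DERIV_isCont[OF q_deriv[OF r, of a]]
      by (cases "a = b") (auto simp: hh_diag hh_offdiag isCont_def intro!: tendsto_intros)
  next
    show "eventually (\<lambda>s. fdet m (hh s) \<noteq> 0) (at r)"
      using ev by eventually_elim (rule skew_diag_nz[OF hh_skew])
  qed (use i skew_diag_nz[OF hh_skew r] r in auto)
  moreover have "eventually (\<lambda>s. finv m (hh s) i i = t s i) (at r)"
    using ev by eventually_elim (simp add: t_finv i)
  ultimately show ?thesis using t_finv[OF r i] by (simp add: tendsto_cong)
qed

text \<open>As \<open>S\<close> is symmetric, \<open>t\<^sup>T S t\<close> has derivative \<open>2 t\<^sup>T (S t)'\<close>, for which only
  the continuity of \<open>t\<close> itself is needed.\<close>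

lemma quadratic_form_deriv:
  assumes r: "0 < r"
  shows "((\<lambda>r. \<Sum>i<m. t r i * q r i) has_real_derivative (\<Sum>i<m. 2 * (t r i * q' r i))) (at r)"
proof -
  have sym: "(\<Sum>i<m. t s i * q r i) = (\<Sum>i<m. t r i * q s i)" for s
  proof -
    have "(\<Sum>i<m. t s i * q r i) = (\<Sum>i<m. \<Sum>j<m. t s i * (S i j * t r j))"
      by (simp add: q_def sum_distrib_left)
    also have "\<dots> = (\<Sum>j<m. \<Sum>i<m. t s i * (S i j * t r j))" by (rule sum.swap)
    also have "\<dots> = (\<Sum>j<m. t r j * q s j)"
      unfolding q_def sum_distrib_left by (intro sum.cong refl) (simp add: S_sym mult_ac)
    finally show ?thesis .
  qed
  \<comment> \<open>By the symmetry \<open>sym\<close> the mixed terms cancel, and the difference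
    quotient involves increments of \<open>q\<close> alone.\<close>
  have eq: "((\<Sum>i<m. t s i * q s i) - (\<Sum>i<m. t r i * q r i)) / (s - r)
      = (\<Sum>i<m. (t s i + t r i) * ((q s i - q r i) / (s - r)))" for s
  proof -
    have "(\<Sum>i<m. (t s i + t r i) * (q s i - q r i))
      = (\<Sum>i<m. t s i * q s i) + (\<Sum>i<m. t r i * q s i) - (\<Sum>i<m. t s i * q r i) - (\<Sum>i<m. t r i * q r i)"
      by (simp add: algebra_simps sum.distrib sum_subtractf)
    then have "(\<Sum>i<m. t s i * q s i) - (\<Sum>i<m. t r i * q r i) = (\<Sum>i<m. (t s i + t r i) * (q s i - q r i))"
      using sym[of s] by linarith
    then show ?thesis by (simp add: sum_divide_distrib)
  qed
  have "((\<lambda>s. \<Sum>i<m. (t s i + t r i) * ((q s i - q r i) / (s - r)))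
      \<longlongrightarrow> (\<Sum>i<m. (t r i + t r i) * q' r i)) (at r)"
    using q_deriv[OF r] unfolding has_field_derivative_iff
    by (intro tendsto_sum tendsto_mult tendsto_add t_tendsto[OF r] tendsto_const) auto
  then show ?thesis
    unfolding has_field_derivative_iff eq by (simp add: mult.assoc)
qed

text \<open>The determinant contributes the sum of \<open>t r k * (1 + q' r k)\<close>, and half the
  derivative of the quadratic form removes the terms with \<open>q'\<close>.\<close>

lemma \<Lambda>_deriv:
  assumes r: "0 < r"
  shows "(\<Lambda> has_real_derivative (\<Sum>i<m. t r i)) (at r)"
proof -
  have "((\<lambda>r. ln (fdet m (hh r))) has_real_derivative
    (\<Sum>k<m. \<Sum>l<m. finv m (hh r) k l * (if l = k then 1 + q' r k else 0))) (at r)"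
  proof (rule ln_fdet_has_derivative[where r = r])
    fix i j assume "i < m" "j < m"
    then show "((\<lambda>r. hh r i j) has_real_derivative (if i = j then 1 + q' r j else 0)) (at r)"
      using q_deriv[OF r, of j]
      by (cases "i = j") (auto simp: hh_diag hh_offdiag intro!: derivative_eq_intros)
  qed (rule hh_skew r)+
  also have "(\<Sum>k<m. \<Sum>l<m. finv m (hh r) k l * (if l = k then 1 + q' r k else 0)) = (\<Sum>k<m. t r k * (1 + q' r k))"
    by (intro sum.cong refl) (simp add: t_finv[OF r] if_distrib[of "\<lambda>x. _ * x"] cong: if_cong)
  finally have "((\<lambda>r. ln (fdet m (hh r)) - (\<Sum>i<m. t r i * q r i) / 2) has_real_derivative
      (\<Sum>k<m. t r k * (1 + q' r k)) - (\<Sum>i<m. 2 * (t r i * q' r i)) / 2) (at r)"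
    by (intro DERIV_diff DERIV_cdivide quadratic_form_deriv r)
  moreover have "(\<Sum>k<m. t r k * (1 + q' r k)) - (\<Sum>i<m. 2 * (t r i * q' r i)) / 2 = (\<Sum>i<m. t r i)"
    by (simp add: distrib_left sum.distrib sum_distrib_left[symmetric])
  ultimately show ?thesis unfolding \<Lambda>_def[abs_def] by simp
qed

text \<open>Two corrections to 1 / r: the off-diagonal entries cost \<open>a / r ^ 3\<close>, and
  the shift of the diagonal by \<open>q r i \<le> \<kappa> / r\<close> costs
  \<open>\<kappa> / r ^ 3\<close>.\<close>

lemma t_lower:
  assumes r: "0 < r" and i: "i < m"
  shows "1 / r - t r i \<le> (a + \<kappa>) / r ^ 3"
proof -
  have "(\<Sum>j<m. if j = i then 0 else (hh r i j)\<^sup>2) \<le> (\<Sum>j<m. (B i j)\<^sup>2)"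
    by (intro sum_mono) (auto simp: hh_offdiag)
  also have "\<dots> \<le> a" by (rule row_B[OF i])
  finally have "(\<Sum>j<m. if j = i then 0 else (hh r i j)\<^sup>2) / r ^ 3 \<le> a / r ^ 3"
    using r by (intro divide_right_mono) auto
  then have 1: "1 / (r + q r i) - t r i \<le> a / r ^ 3"
    using finv_diag_approx(2)[OF hh_skew[OF r] r i] unfolding t_finv[OF r i] hh_diag by linarith
  have "1 / r - 1 / (r + q r i) = q r i / (r * (r + q r i))"
    using r q0[OF r, of i] by (simp add: field_simps)
  also have "\<dots> \<le> (\<kappa> / r) / (r * r)"
    using r q0[OF r, of i] q_le[OF r i] by (intro frac_le mult_left_mono) auto
  also have "\<dots> = \<kappa> / r ^ 3" by (simp add: power3_eq_cube)
  finally show ?thesis using 1 by (simp add: add_divide_distrib)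
qed

lemma \<Lambda>_bounds:
  assumes r: "0 < r"
  shows "0 \<le> \<Lambda> r - real m * ln r" "\<Lambda> r - real m * ln r \<le> real m * (a + \<kappa>) / (2 * r\<^sup>2)"
proof -
  define u' where "u' = (\<lambda>s. (\<Sum>i<m. t s i) - real m / s)"
  have d: "((\<lambda>s. \<Lambda> s - real m * ln s) has_real_derivative u' s) (at s)" if "r \<le> s" for s
    unfolding u'_def using that r
    by (intro DERIV_diff \<Lambda>_deriv) (auto intro!: derivative_eq_intros simp: divide_inverse)
  have u'_eq: "u' s = (\<Sum>i<m. t s i - 1 / s)" for s by (simp add: u'_def sum_subtractf)
  have up: "u' s \<le> 0" if "r \<le> s" for s
    unfolding u'_eq using t_le[of s] that r by (intro sum_nonpos) auto
  have low: "- (real m * (a + \<kappa>)) / s ^ 3 \<le> u' s" if "r \<le> s" for s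
  proof -
    have "(\<Sum>i<m. - ((a + \<kappa>) / s ^ 3)) \<le> u' s"
    proof (unfold u'_eq, rule sum_mono)
      fix i assume "i \<in> {..<m}"
      then have "1 / s - t s i \<le> (a + \<kappa>) / s ^ 3" using that r by (intro t_lower) auto
      then show "- ((a + \<kappa>) / s ^ 3) \<le> t s i - 1 / s" by linarith
    qed
    then show ?thesis by simp
  qed
  have inv0: "((\<lambda>s. c / s ^ 2) \<longlongrightarrow> 0) at_top" for c :: real
    by (intro real_tendsto_divide_at_top[OF tendsto_const] filterlim_pow_at_top filterlim_ident) simp
  have "((\<lambda>s. ln (fdet m (hh s)) - real m * ln s) \<longlongrightarrow> 0) at_top"
  proof (rule ln_fdet_tendsto)
    fix i j assume ij: "i < m" "j < m"
    show "((\<lambda>s. hh s i j / s) \<longlongrightarrow> (if i = j then 1 else 0)) at_top"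
    proof (cases "i = j")
      case True
      have "((\<lambda>s. q s i / s) \<longlongrightarrow> 0) at_top"
      proof (rule Lim_null_comparison[OF _ inv0[of \<kappa>]])
        show "eventually (\<lambda>s. norm (q s i / s) \<le> \<kappa> / s\<^sup>2) at_top"
        proof (rule eventually_mono[OF eventually_gt_at_top[of 0]])
          fix s :: real assume s: "0 < s"
          have "q s i / s \<le> \<kappa> / s / s" using q_le[OF s ij(1)] s by (intro divide_right_mono) auto
          then show "norm (q s i / s) \<le> \<kappa> / s\<^sup>2" using q0[OF s, of i] s by (simp add: power2_eq_square)
        qed
      qed
      then have "((\<lambda>s. 1 + q s i / s) \<longlongrightarrow> 1 + 0) at_top" by (intro tendsto_intros)
      moreover have "eventually (\<lambda>s. 1 + q s i / s = hh s i j / s) at_top"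
        by (rule eventually_mono[OF eventually_gt_at_top[of 0]]) (simp add: True hh_diag add_divide_distrib)
      ultimately show ?thesis using True by (simp add: tendsto_cong)
    next
      case False
      have "((\<lambda>s. B i j / s) \<longlongrightarrow> 0) at_top"
        by (rule real_tendsto_divide_at_top[OF tendsto_const filterlim_ident])
      then show ?thesis using False by (simp add: hh_offdiag)
    qed
  qed (rule hh_skew)
  moreover have "((\<lambda>s. (\<Sum>i<m. t s i * q s i) / 2) \<longlongrightarrow> 0) at_top"
  proof (rule Lim_null_comparison[OF _ inv0[of "real m * \<kappa>"]])
    show "eventually (\<lambda>s. norm ((\<Sum>i<m. t s i * q s i) / 2) \<le> real m * \<kappa> / s\<^sup>2) at_top"
    proof (rule eventually_mono[OF eventually_gt_at_top[of 0]])
      fix s :: real assume s: "0 < s"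
      have "0 \<le> (\<Sum>i<m. t s i * q s i)"
        using t0[OF s] q0[OF s] by (intro sum_nonneg mult_nonneg_nonneg) auto
      then have "norm ((\<Sum>i<m. t s i * q s i) / 2) \<le> (\<Sum>i<m. t s i * q s i)" by simp
      also have "(\<Sum>i<m. t s i * q s i) \<le> (\<Sum>i<m. 1 / s * (\<kappa> / s))"
        using t0[OF s] q0[OF s] t_le[OF s] q_le[OF s] s by (intro sum_mono mult_mono) auto
      finally show "norm ((\<Sum>i<m. t s i * q s i) / 2) \<le> real m * \<kappa> / s\<^sup>2"
        by (simp add: power2_eq_square)
    qed
  qed
  ultimately have "((\<lambda>s. (ln (fdet m (hh s)) - real m * ln s) - (\<Sum>i<m. t s i * q s i) / 2) \<longlongrightarrow> 0 - 0) at_top"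
    by (rule tendsto_diff)
  then have lim: "((\<lambda>s. \<Lambda> s - real m * ln s) \<longlongrightarrow> 0) at_top"
    by (simp add: \<Lambda>_def algebra_simps)
  note b = decay_from_derivative[OF r d _ _ lim, where c = "real m * (a + \<kappa>)"]
  show "0 \<le> \<Lambda> r - real m * ln r" by (rule b(1)) (use up low in auto)
  show "\<Lambda> r - real m * ln r \<le> real m * (a + \<kappa>) / (2 * r\<^sup>2)" by (rule b(2)) (use up low in auto)
qed

end


text \<open>A quadratic Taylor remainder that is uniform in \<open>x\<close> survives integration,
  so differentiation under the integral needs no limit theorem.\<close>

lemma (in prob_space) expectation_has_derivative:
  fixes \<phi> \<psi> :: "real \<Rightarrow> 'a \<Rightarrow> real"
  assumes r: "0 < r" and int: "\<And>s. 0 < s \<Longrightarrow> integrable M (\<phi> s)" and int': "integrable M (\<psi> r)"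
    and taylor: "\<And>s x. r / 2 \<le> s \<Longrightarrow> \<bar>\<phi> s x - \<phi> r x - (s - r) * \<psi> r x\<bar> \<le> C * (s - r)\<^sup>2"
  shows "((\<lambda>s. \<integral>x. \<phi> s x \<partial>M) has_real_derivative (\<integral>x. \<psi> r x \<partial>M)) (at r)"
proof (rule has_real_derivative_of_quadratic_bound[of "r / 2"])
  fix s assume "\<bar>s - r\<bar> < r / 2"
  then have s: "r / 2 \<le> s" "0 < s" using r by linarith+
  have "(\<integral>x. \<phi> s x \<partial>M) - (\<integral>x. \<phi> r x \<partial>M) - (s - r) * (\<integral>x. \<psi> r x \<partial>M)
      = (\<integral>x. \<phi> s x - \<phi> r x - (s - r) * \<psi> r x \<partial>M)"
    using int[OF s(2)] int[OF r] int' by simp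
  also have "\<bar>\<dots>\<bar> \<le> C * (s - r)\<^sup>2" by (rule abs_integral_le[OF taylor[OF s(1)]])
  finally show "\<bar>(\<integral>x. \<phi> s x \<partial>M) - (\<integral>x. \<phi> r x \<partial>M) - (s - r) * (\<integral>x. \<psi> r x \<partial>M)\<bar> \<le> C * (s - r)\<^sup>2" .
qed (use r in simp)

section \<open>The expected logarithmic determinant\<close>

locale random_family = real_noise \<mu> for \<mu> :: "nat \<times> nat \<Rightarrow> real measure" +
  fixes m :: nat and P :: "(nat \<times> nat) set" and B :: "nat \<Rightarrow> nat \<Rightarrow> real"
    and \<beta> \<gamma> \<kappa> a :: real and v :: "nat \<times> nat \<Rightarrow> real"
  assumes P: "P \<subseteq> {(i, j). i < j \<and> j < m}"
    and offdiag: "\<And>i j. i < m \<Longrightarrow> j < m \<Longrightarrow> i \<noteq> j \<Longrightarrow> B i j = - B j i"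
    and row_B: "\<And>i. i < m \<Longrightarrow> (\<Sum>j<m. (B i j)\<^sup>2) \<le> a"
    and int1: "\<And>p. p \<in> P \<Longrightarrow> integrable (\<mu> p) (\<lambda>u. u)"
    and int2: "\<And>p. p \<in> P \<Longrightarrow> integrable (\<mu> p) (\<lambda>u. u\<^sup>2)"
    and int3: "\<And>p. p \<in> P \<Longrightarrow> integrable (\<mu> p) (\<lambda>u. \<bar>u\<bar> ^ 3)"
    and mean: "\<And>p. p \<in> P \<Longrightarrow> (\<integral>u. u \<partial>\<mu> p) = 0"
    and variance: "\<And>p. p \<in> P \<Longrightarrow> (\<integral>u. u\<^sup>2 \<partial>\<mu> p) = v p"
    and var_le: "\<And>p. p \<in> P \<Longrightarrow> v p \<le> \<beta>"
    and third: "\<And>p. p \<in> P \<Longrightarrow> (\<integral>u. \<bar>u\<bar> ^ 3 \<partial>\<mu> p) \<le> \<gamma>"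
    and mixed: "\<And>p. p \<in> P \<Longrightarrow> v p * (\<integral>u. \<bar>u\<bar> \<partial>\<mu> p) \<le> \<gamma>"
    and \<beta>0: "0 \<le> \<beta>" and \<gamma>0: "0 \<le> \<gamma>" and \<kappa>: "real m * \<beta> \<le> \<kappa>"
begin

lemma random_skew: "0 < r \<Longrightarrow> random_skew \<mu> m P (const_diag r B) r \<beta> \<gamma> v"
  by unfold_locales
    (use P skew_diag_const_diag[OF offdiag] int1 int2 int3 mean variance var_le third mixed \<beta>0 \<gamma>0 in auto)

abbreviation "PM \<equiv> PiM P \<mu>"

sublocale PM: prob_space PM
  by (rule Pi_noise_prob)

definition Bx :: "(nat \<times> nat \<Rightarrow> real) \<Rightarrow> nat \<Rightarrow> nat \<Rightarrow> real" where
  "Bx x i j = B i j + pair_mat P (- 1) x i j"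

definition L :: "real \<Rightarrow> real" where
  "L r = (\<integral>x. ln (fdet m (const_diag r (Bx x))) \<partial>PM)"

lemma Bx_offdiag: "i < m \<Longrightarrow> j < m \<Longrightarrow> i \<noteq> j \<Longrightarrow> Bx x i j = - Bx x j i"
proof -
  assume ij: "i < m" "j < m" "i \<noteq> j"
  have "pair_mat P (- 1) x i j = - pair_mat P (- 1) x j i"
    using pair_asym[OF P, of i j] by (auto simp: pair_mat_def)
  then show "Bx x i j = - Bx x j i" using offdiag[OF ij] by (simp add: Bx_def)
qed

lemma H_eq: "0 < r \<Longrightarrow> random_skew.H P (const_diag r B) x = const_diag r (Bx x)"
proof -
  assume r: "0 < r"
  have "(i, i) \<notin> P" for i using P by auto
  then show "random_skew.H P (const_diag r B) x = const_diag r (Bx x)"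
    by (intro ext) (auto simp: random_skew.H_def[OF random_skew[OF r]] const_diag_def Bx_def pair_mat_def)
qed

lemma G_eq: "0 < r \<Longrightarrow> random_skew.G m P (const_diag r B) x = finv m (const_diag r (Bx x))"
  using random_skew.G_def[OF random_skew[of r]] H_eq by simp

lemma finite_P: "finite P"
  using random_skew.finite_P[OF random_skew[of 1]] by simp

abbreviation F :: "(nat \<times> nat \<Rightarrow> real) \<Rightarrow> real" where
  "F x \<equiv> \<Sum>i<m. \<Sum>j<m. if j = i then 0 else (Bx x i j)\<^sup>2"

text \<open>An integrable majorant of \<open>F\<close>: squares of sums are split by
  \<open>(u + w)^2 <= 2 u^2 + 2 w^2\<close>, and each variable occurs in two entries, hence the
  factor 4.\<close>

definition F' :: "(nat \<times> nat \<Rightarrow> real) \<Rightarrow> real" where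
  "F' x = (\<Sum>i<m. \<Sum>j<m. 2 * (B i j)\<^sup>2) + 4 * (\<Sum>p\<in>P. (x p)\<^sup>2)"

lemma F_le: "F x \<le> F' x"
proof -
  have "F x \<le> (\<Sum>i<m. \<Sum>j<m. 2 * (B i j)\<^sup>2 + pair_mat P 1 (\<lambda>p. 2 * (x p)\<^sup>2) i j)"
  proof (intro sum_mono)
    fix i j
    have "(u + w)\<^sup>2 \<le> 2 * u\<^sup>2 + 2 * w\<^sup>2" for u w :: real
      using zero_le_power2[of "u - w"] by (simp add: power2_sum power2_diff)
    from this[of "B i j" "pair_mat P (- 1) x i j"]
    show "(if j = i then 0 else (Bx x i j)\<^sup>2) \<le> 2 * (B i j)\<^sup>2 + pair_mat P 1 (\<lambda>p. 2 * (x p)\<^sup>2) i j"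
      by (auto simp: Bx_def pair_mat_def)
  qed
  also have "\<dots> = (\<Sum>i<m. \<Sum>j<m. 2 * (B i j)\<^sup>2) + (\<Sum>i<m. \<Sum>j<m. pair_mat P 1 (\<lambda>p. 2 * (x p)\<^sup>2) i j * 1)"
    by (simp add: sum.distrib)
  also have "(\<Sum>i<m. \<Sum>j<m. pair_mat P 1 (\<lambda>p. 2 * (x p)\<^sup>2) i j * 1) = 4 * (\<Sum>p\<in>P. (x p)\<^sup>2)"
    unfolding pair_mat_sum[OF P] sum_distrib_left by (intro sum.cong refl) simp
  finally show ?thesis by (simp add: F'_def)
qed

lemma F'_integrable: "integrable PM F'"
  unfolding F'_def[abs_def]
  using coordinate_integrable(1)[OF finite_P _ int2] by (intro Bochner_Integration.integrable_add
    integrable_const Bochner_Integration.integrable_mult_right Bochner_Integration.integrable_sum) auto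

text \<open>The sum of \<open>v\<close> over \<open>P\<close> is half of the full sum of the
  variance matrix, each row of which sums to at most \<open>\<kappa>\<close>.\<close>

lemma F'_integral: "(\<integral>x. F' x \<partial>PM) \<le> 2 * real m * (a + \<kappa>)"
proof -
  have c: "integrable PM (\<lambda>x. (x p)\<^sup>2)" "(\<integral>x. (x p)\<^sup>2 \<partial>PM) = v p" if "p \<in> P" for p
    using coordinate_integrable[OF finite_P that int2[OF that]] variance[OF that] by auto
  have "(\<integral>x. F' x \<partial>PM) = (\<Sum>i<m. \<Sum>j<m. 2 * (B i j)\<^sup>2) + 4 * (\<Sum>p\<in>P. v p)"
  proof -
    have i: "integrable PM (\<lambda>x. \<Sum>p\<in>P. (x p)\<^sup>2)" by (intro Bochner_Integration.integrable_sum c)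
    have "(\<integral>x. (\<Sum>p\<in>P. (x p)\<^sup>2) \<partial>PM) = (\<Sum>p\<in>P. v p)"
      by (subst Bochner_Integration.integral_sum) (auto simp: c)
    then show ?thesis unfolding F'_def using i by (simp add: PM.prob_space)
  qed
  also have "(\<Sum>i<m. \<Sum>j<m. 2 * (B i j)\<^sup>2) \<le> (\<Sum>i<m. 2 * a)"
    unfolding sum_distrib_left[symmetric] using row_B by (intro mult_left_mono sum_mono) auto
  also have "4 * (\<Sum>p\<in>P. v p) = 2 * (\<Sum>i<m. \<Sum>j<m. pair_mat P 1 v i j * 1)"
    unfolding pair_mat_sum[OF P] sum_distrib_left by (intro sum.cong refl) simp
  also have "(\<Sum>i<m. \<Sum>j<m. pair_mat P 1 v i j * 1) \<le> (\<Sum>i<m. \<kappa>)"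
  proof (rule sum_mono)
    fix i
    show "(\<Sum>j<m. pair_mat P 1 v i j * 1) \<le> \<kappa>"
      using random_skew.S_row[OF random_skew[of 1], of i] \<kappa>
      by (simp add: random_skew.S_def[OF random_skew[of 1]])
  qed
  finally show ?thesis by (simp add: algebra_simps)
qed

lemma ln_fdet_Bx_bounds:
  assumes "0 < r"
  shows "0 \<le> ln (fdet m (const_diag r (Bx x))) - real m * ln r"
    and "ln (fdet m (const_diag r (Bx x))) - real m * ln r \<le> F' x / (2 * r\<^sup>2)"
proof -
  show "0 \<le> ln (fdet m (const_diag r (Bx x))) - real m * ln r"
    by (rule ln_fdet_const_diag_bounds(1)[OF Bx_offdiag assms])
  have "ln (fdet m (const_diag r (Bx x))) - real m * ln r \<le> F x / (2 * r\<^sup>2)"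
    by (rule ln_fdet_const_diag_bounds(2)[OF Bx_offdiag assms])
  also have "\<dots> \<le> F' x / (2 * r\<^sup>2)" using F_le[of x] assms by (intro divide_right_mono) auto
  finally show "ln (fdet m (const_diag r (Bx x))) - real m * ln r \<le> F' x / (2 * r\<^sup>2)" .
qed

lemma ln_fdet_Bx_meas: "(\<lambda>x. ln (fdet m (const_diag r (Bx x)))) \<in> borel_measurable PM"
proof -
  have "(\<lambda>x. const_diag r (Bx x) i j) \<in> borel_measurable PM" for i j
  proof -
    have "(\<lambda>x. pair_mat P (- 1) x i j) \<in> borel_measurable PM"
      using coordinate_measurable[of "(i, j)" P] coordinate_measurable[of "(j, i)" P]
      by (cases "(i, j) \<in> P"; cases "(j, i) \<in> P") (auto simp: pair_mat_def)
    then show ?thesis by (cases "i = j") (auto simp: const_diag_def Bx_def)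
  qed
  then show ?thesis by (intro borel_measurable_ln fdet_measurable)
qed

lemma ln_fdet_Bx_integrable:
  assumes r: "0 < r"
  shows "integrable PM (\<lambda>x. ln (fdet m (const_diag r (Bx x))))"
proof (rule Bochner_Integration.integrable_bound)
  show "integrable PM (\<lambda>x. F' x / (2 * r\<^sup>2) + \<bar>real m * ln r\<bar>)"
    using F'_integrable by simp
  have "\<bar>ln (fdet m (const_diag r (Bx x)))\<bar> \<le> \<bar>F' x / (2 * r\<^sup>2) + \<bar>real m * ln r\<bar>\<bar>" for x
    using ln_fdet_Bx_bounds[OF r, of x] by linarith
  then show "AE x in PM. norm (ln (fdet m (const_diag r (Bx x)))) \<le> norm (F' x / (2 * r\<^sup>2) + \<bar>real m * ln r\<bar>)"
    by simp
qed (rule ln_fdet_Bx_meas)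

text \<open>The pointwise bounds are integrated. The majorant has mean at most
  \<open>2 * m * (a + \<kappa>)\<close>, which accounts for the factor 2 lost against
  \<open>\<Lambda>_bounds\<close>.\<close>

lemma L_bounds:
  assumes r: "0 < r"
  shows "0 \<le> L r - real m * ln r" "L r - real m * ln r \<le> real m * (a + \<kappa>) / r\<^sup>2"
proof -
  have eq: "L r - real m * ln r = (\<integral>x. ln (fdet m (const_diag r (Bx x))) - real m * ln r \<partial>PM)"
    using ln_fdet_Bx_integrable[OF r] by (simp add: L_def PM.prob_space)
  show "0 \<le> L r - real m * ln r"
    unfolding eq using ln_fdet_Bx_bounds(1)[OF r] by (intro integral_nonneg_AE) auto
  have "L r - real m * ln r \<le> (\<integral>x. F' x / (2 * r\<^sup>2) \<partial>PM)"
    unfolding eq using ln_fdet_Bx_integrable[OF r] F'_integrable ln_fdet_Bx_bounds(2)[OF r]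
    by (intro integral_mono) auto
  also have "\<dots> = (\<integral>x. F' x \<partial>PM) / (2 * r\<^sup>2)" by simp
  also have "\<dots> \<le> (2 * real m * (a + \<kappa>)) / (2 * r\<^sup>2)"
    using F'_integral by (intro divide_right_mono) auto
  finally show "L r - real m * ln r \<le> real m * (a + \<kappa>) / r\<^sup>2" by simp
qed

lemma L_deriv:
  assumes r: "0 < r"
  shows "(L has_real_derivative (\<Sum>k<m. random_skew.g \<mu> m P (const_diag r B) k)) (at r)"
proof -
  interpret R: random_skew \<mu> m P "const_diag r B" r \<beta> \<gamma> v by (rule random_skew[OF r])
  have "((\<lambda>s. \<integral>x. ln (fdet m (const_diag s (Bx x))) \<partial>PM) has_real_derivative
      (\<integral>x. (\<Sum>k<m. finv m (const_diag r (Bx x)) k k) \<partial>PM)) (at r)"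
  \<comment> \<open>The Taylor bound is taken with \<open>r0 = r / 2\<close>, so that it covers all
    \<open>s\<close> near \<open>r\<close>.\<close>
  proof (rule PM.expectation_has_derivative[OF r, where C = "real m / (r / 2)\<^sup>2" and
        \<psi> = "\<lambda>r x. \<Sum>k<m. finv m (const_diag r (Bx x)) k k"])
    show "integrable PM (\<lambda>x. \<Sum>k<m. finv m (const_diag r (Bx x)) k k)"
      unfolding G_eq[OF r, symmetric] by (intro Bochner_Integration.integrable_sum R.G_integrable) auto
    fix s x assume s: "r / 2 \<le> s"
    show "\<bar>ln (fdet m (const_diag s (Bx x))) - ln (fdet m (const_diag r (Bx x)))
        - (s - r) * (\<Sum>k<m. finv m (const_diag r (Bx x)) k k)\<bar> \<le> real m / (r / 2)\<^sup>2 * (s - r)\<^sup>2"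
      by (rule ln_fdet_const_diag_taylor[OF Bx_offdiag]) (use r s in auto)
  qed (rule ln_fdet_Bx_integrable)
  moreover have "(\<integral>x. (\<Sum>k<m. finv m (const_diag r (Bx x)) k k) \<partial>PM) = (\<Sum>k<m. R.g k)"
    unfolding G_eq[OF r, symmetric] R.g_def
    by (rule Bochner_Integration.integral_sum) (auto intro: R.G_integrable)
  ultimately show ?thesis by (simp add: L_def[abs_def])
qed

definition \<Theta> :: "real \<Rightarrow> real" where
  "\<Theta> r = 2 * (real m)\<^sup>2 * \<beta> * sqrt \<beta> / r ^ 4 + real m * sqrt (real m) * \<beta> / r ^ 3 + 24 * (real m)\<^sup>2 * \<gamma> / r ^ 4"

lemma \<Theta>_mono:
  assumes "0 < r" "r \<le> s"
  shows "\<Theta> s \<le> \<Theta> r"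
  unfolding \<Theta>_def using assms \<beta>0 \<gamma>0
  by (intro add_mono divide_left_mono power_mono mult_nonneg_nonneg mult_pos_pos zero_less_power) auto

text \<open>The mean value theorem needs one bound for the trace error on the whole interval;
  \<open>\<Theta>\<close> and the stability factor decrease in the diagonal, so their values at
  \<open>r0\<close> serve. At \<open>r1\<close> both functions exceed \<open>m ln r1\<close> by a
  nonnegative amount, hence their difference is at most the larger of the two bounds.\<close>

theorem L_approx:
  assumes D: "dyson_family m B (pair_mat P 1 v) \<kappa> a t"
    and r: "0 < r0" "r0 \<le> r1" and small: "\<beta> * \<Theta> r0 \<le> r0 / 2"
  shows "\<bar>L r0 - dyson_family.\<Lambda> m B (pair_mat P 1 v) t r0\<bar>
    \<le> real m * (a + \<kappa>) / r1\<^sup>2 + (r1 - r0) * (\<Theta> r0 * (1 + 2 * \<kappa> * (1 / r0 + \<kappa> / r0 ^ 3)\<^sup>2))"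
proof -
  interpret D: dyson_family m B "pair_mat P 1 v" \<kappa> a t by (rule D)
  define e where "e = \<Theta> r0 * (1 + 2 * \<kappa> * (1 / r0 + \<kappa> / r0 ^ 3)\<^sup>2)"
  have \<kappa>0: "0 \<le> \<kappa>" using \<kappa> \<beta>0 by (meson mult_nonneg_nonneg of_nat_0_le_iff order_trans)
  have "\<bar>L r1 - D.\<Lambda> r1\<bar> \<le> real m * (a + \<kappa>) / r1\<^sup>2"
  proof -
    have r1: "0 < r1" using r by simp
    define y where "y = real m * (a + \<kappa>) / r1\<^sup>2"
    have "real m * (a + \<kappa>) / (2 * r1\<^sup>2) = y / 2" by (simp add: y_def)
    then have "D.\<Lambda> r1 - real m * ln r1 \<le> y / 2" using D.\<Lambda>_bounds(2)[OF r1] by (simp only:)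
    moreover have "L r1 - real m * ln r1 \<le> y" using L_bounds(2)[OF r1] by (simp only: y_def)
    ultimately show ?thesis
      using L_bounds(1)[OF r1] D.\<Lambda>_bounds(1)[OF r1] unfolding y_def[symmetric] by linarith
  qed
  moreover have "\<bar>(L r1 - D.\<Lambda> r1) - (L r0 - D.\<Lambda> r0)\<bar> \<le> (r1 - r0) * e"
  proof (cases "r0 = r1")
    case False
    then have lt: "r0 < r1" using r by simp
    have d: "((\<lambda>s. L s - D.\<Lambda> s) has_real_derivative
        (\<Sum>k<m. random_skew.g \<mu> m P (const_diag s B) k) - (\<Sum>i<m. t s i)) (at s)" if "r0 \<le> s" for s
      using that r by (intro DERIV_diff L_deriv D.\<Lambda>_deriv) auto
    obtain z where z: "r0 < z" "z < r1" "(L r1 - D.\<Lambda> r1) - (L r0 - D.\<Lambda> r0)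
        = (r1 - r0) * ((\<Sum>k<m. random_skew.g \<mu> m P (const_diag z B) k) - (\<Sum>i<m. t z i))"
      using MVT2[OF lt d] by blast
    have z0: "0 < z" using z r by simp
    interpret R: random_skew \<mu> m P "const_diag z B" z \<beta> \<gamma> v by (rule random_skew[OF z0])
    have \<Theta>z: "R.\<Theta> = \<Theta> z" by (simp add: R.\<Theta>_def \<Theta>_def)
    have \<Theta>le: "\<Theta> z \<le> \<Theta> r0" using \<Theta>_mono[OF r(1), of z] z by simp
    have "\<bar>(\<Sum>k<m. R.g k) - (\<Sum>i<m. t z i)\<bar> \<le> R.\<Theta> * (1 + 2 * \<kappa> * (z + \<kappa> / z)\<^sup>2 / z ^ 4)"
    proof (rule R.trace_estimate[OF _ _ \<kappa>])
      show "0 \<le> t z i" if "i < m" for i using D.t0[OF z0 that] .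
      show "t z i = finv m (add_diag (const_diag z B) (\<lambda>i. \<Sum>j<m. R.S i j * t z j)) i i" if "i < m" for i
        using D.t_eq[OF z0 that] by (simp add: R.S_def)
      have "\<beta> * R.\<Theta> \<le> \<beta> * \<Theta> r0" unfolding \<Theta>z using \<Theta>le \<beta>0 by (intro mult_left_mono)
      then show "\<beta> * R.\<Theta> \<le> z / 2" using small z by linarith
    qed
    \<comment> \<open>Rewritten so that monotonicity in \<open>z\<close> becomes visible;
      \<open>z + \<kappa> / z\<close> by itself need not be monotone.\<close>
    also have "\<dots> = \<Theta> z * (1 + 2 * \<kappa> * (1 / z + \<kappa> / z ^ 3)\<^sup>2)"
    proof -
      have "(z + \<kappa> / z)\<^sup>2 / z ^ 4 = ((z + \<kappa> / z) / z\<^sup>2)\<^sup>2" by (simp add: power_divide)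
      also have "(z + \<kappa> / z) / z\<^sup>2 = 1 / z + \<kappa> / z ^ 3"
        using z0 by (simp add: add_divide_distrib power2_eq_square power3_eq_cube)
      finally show ?thesis unfolding \<Theta>z by (metis times_divide_eq_right)
    qed
    also have "\<dots> \<le> e"
    proof -
      have "1 / z + \<kappa> / z ^ 3 \<le> 1 / r0 + \<kappa> / r0 ^ 3"
        using z r z0 \<kappa>0 by (intro add_mono divide_left_mono power_mono mult_pos_pos zero_less_power) auto
      then have "(1 / z + \<kappa> / z ^ 3)\<^sup>2 \<le> (1 / r0 + \<kappa> / r0 ^ 3)\<^sup>2"
        using z0 \<kappa>0 by (intro power_mono) auto
      then show ?thesis
        unfolding e_def using \<Theta>le R.\<Theta>_nonneg \<Theta>z \<kappa>0 by (intro mult_mono add_mono mult_left_mono) auto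
    qed
    finally show ?thesis unfolding z(3) using r by (intro abs_mult_mono[of "r1 - r0" "r1 - r0"]) auto
  qed simp
  ultimately show ?thesis unfolding e_def[symmetric] by linarith
qed

end

subsection \<open>The deterministic equivalent on the negative axis\<close>

text \<open>At \<open>z = - w\<close> the kernel is \<open>1 / (l + w)\<close>, positive and at most
  \<open>1 / w\<close> for almost every \<open>l\<close>. Its integral is real and positive, and the
  Taylor remainder in \<open>w\<close> is controlled uniformly in \<open>l\<close>.\<close>

lemma stieltjes_negative_axis:
  assumes f: "f \<in> stieltjes_class" and w: "0 < w"
  shows "f (- complex_of_real w) = complex_of_real (Re (f (- complex_of_real w)))"
    and "0 < Re (f (- complex_of_real w))"
    and "(\<lambda>w. Re (f (- complex_of_real w))) differentiable (at w)"
proof -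
  obtain \<nu> where \<nu>: "real_distribution \<nu>" "emeasure \<nu> {0..} = 1"
      "\<And>z. z \<notin> \<real>\<^sub>\<ge>\<^sub>0 \<Longrightarrow> f z = (LINT l|\<nu>. 1 / (complex_of_real l - z))"
    using f unfolding stieltjes_class_def by blast
  interpret real_distribution \<nu> by (rule \<nu>(1))
  have ae: "AE l in \<nu>. 0 \<le> l"
  proof -
    have "prob {0..} = 1" using \<nu>(2) by (simp add: measure_def)
    then have "AE l in \<nu>. l \<in> {0..}" by (subst (asm) prob_eq_1) auto
    then show ?thesis by simp
  qed
  \<comment> \<open>Replacing \<open>l\<close> by \<open>max l 0\<close> makes the bounds hold everywhere, not just almost everywhere.\<close>
  define \<phi> where "\<phi> = (\<lambda>s l. 1 / (max l 0 + s) :: real)"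
  have \<phi>_meas: "\<phi> s \<in> borel_measurable \<nu>" for s unfolding \<phi>_def by measurable
  have \<phi>_bound: "\<bar>\<phi> s l\<bar> \<le> 1 / s" if "0 < s" for s l
    using that by (auto simp: \<phi>_def intro!: divide_left_mono)
  have \<phi>_int: "integrable \<nu> (\<phi> s)" if "0 < s" for s
    by (rule bounded_integrable[OF \<phi>_meas \<phi>_bound[OF that]])
  have val: "f (- complex_of_real s) = complex_of_real (\<integral>l. \<phi> s l \<partial>\<nu>)" if s: "0 < s" for s
  proof -
    have "- complex_of_real s \<notin> \<real>\<^sub>\<ge>\<^sub>0"
      using s by (auto simp: nonneg_Reals_def complex_eq_iff)
    then have "f (- complex_of_real s) = (LINT l|\<nu>. 1 / (complex_of_real l - - complex_of_real s))"
      by (rule \<nu>(3))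
    also have "\<dots> = (LINT l|\<nu>. complex_of_real (\<phi> s l))"
    proof (rule integral_cong_AE)
      show "AE l in \<nu>. 1 / (complex_of_real l - - complex_of_real s) = complex_of_real (\<phi> s l)"
        using ae by eventually_elim (simp add: \<phi>_def)
    qed (use \<phi>_meas in measurable)
    finally show ?thesis by simp
  qed
  have Re: "Re (f (- complex_of_real s)) = (\<integral>l. \<phi> s l \<partial>\<nu>)" if "0 < s" for s
    using val[OF that] by simp
  show "f (- complex_of_real w) = complex_of_real (Re (f (- complex_of_real w)))"
    using val[OF w] Re[OF w] by simp
  have pos: "0 < \<phi> w l" for l using w by (auto simp: \<phi>_def max_def)
  have "(\<integral>l. \<phi> w l \<partial>\<nu>) \<noteq> 0"
  proof
    assume "(\<integral>l. \<phi> w l \<partial>\<nu>) = 0"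
    then have "AE l in \<nu>. \<phi> w l = 0"
      using integral_nonneg_eq_0_iff_AE[OF \<phi>_int[OF w]] pos by (auto intro: less_imp_le)
    then have "AE l in \<nu>. False" by eventually_elim (use pos in \<open>metis less_irrefl\<close>)
    then show False by simp
  qed
  moreover have "0 \<le> (\<integral>l. \<phi> w l \<partial>\<nu>)" using pos by (intro integral_nonneg_AE) (auto intro: less_imp_le)
  ultimately show "0 < Re (f (- complex_of_real w))" using Re[OF w] by simp
  define \<psi> where "\<psi> = (\<lambda>s l. - 1 / (max l 0 + s)\<^sup>2 :: real)"
  have "((\<lambda>s. \<integral>l. \<phi> s l \<partial>\<nu>) has_real_derivative (\<integral>l. \<psi> w l \<partial>\<nu>)) (at w)"
  \<comment> \<open>The Taylor remainder of \<open>1 / (x + s)\<close> is exactly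
    \<open>(s - w)\<^sup>2 / ((x + s) * (x + w)\<^sup>2)\<close>; \<open>0 \<le> x\<close> and
    \<open>w / 2 \<le> s\<close> turn this into the constant.\<close>
  proof (rule expectation_has_derivative[OF w \<phi>_int, where C = "1 / ((w / 2) * w\<^sup>2)"])
    show "integrable \<nu> (\<psi> w)"
    proof (rule bounded_integrable)
      show "\<psi> w \<in> borel_measurable \<nu>" unfolding \<psi>_def by measurable
      show "\<bar>\<psi> w l\<bar> \<le> 1 / w\<^sup>2" for l
        using w by (auto simp: \<psi>_def abs_divide intro!: divide_left_mono power_mono)
    qed
    fix s l :: real assume s: "w / 2 \<le> s"
    define x where "x = max l 0"
    have "0 \<le> x" unfolding x_def by (rule max.cobounded2)
    then have x: "0 \<le> x" "0 < s" using s w by auto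
    have "\<phi> s l - \<phi> w l - (s - w) * \<psi> w l = (s - w)\<^sup>2 / ((x + s) * (x + w)\<^sup>2)"
      using x w by (simp add: \<phi>_def \<psi>_def x_def[symmetric] divide_simps) (simp add: power2_eq_square algebra_simps)
    then have "\<bar>\<phi> s l - \<phi> w l - (s - w) * \<psi> w l\<bar> = (s - w)\<^sup>2 / ((x + s) * (x + w)\<^sup>2)"
      using x w by simp
    also have "\<dots> \<le> (s - w)\<^sup>2 / ((w / 2) * w\<^sup>2)"
      using x w s by (intro divide_left_mono mult_mono power_mono mult_pos_pos zero_less_power) auto
    also have "\<dots> = 1 / (w / 2 * w\<^sup>2) * (s - w)\<^sup>2" by (simp add: mult.commute)
    finally show "\<bar>\<phi> s l - \<phi> w l - (s - w) * \<psi> w l\<bar> \<le> 1 / (w / 2 * w\<^sup>2) * (s - w)\<^sup>2" .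
  qed
  then have "((\<lambda>s. Re (f (- complex_of_real s))) has_real_derivative (\<integral>l. \<psi> w l \<partial>\<nu>)) (at w)"
    by (rule has_field_derivative_transform_within_open[of _ _ _ "{0<..}"]) (use w Re in auto)
  then show "(\<lambda>w. Re (f (- complex_of_real w))) differentiable (at w)"
    by (auto simp: real_differentiable_def)
qed

section \<open>Block matrices and Schur complements\<close>

lemma sum_block: "(\<Sum>k<N + n. f k) = (\<Sum>k<N. f k) + (\<Sum>l<n. f (N + l))" for f :: "nat \<Rightarrow> 'b::comm_monoid_add"
  by (induction n) (simp_all add: add.assoc)

lemma mat_inv_diag:
  fixes f :: "nat \<Rightarrow> 'a::field"
  assumes "\<And>i. i < n \<Longrightarrow> f i \<noteq> 0"
  shows "mat_inv (mat_diag n f) = mat_diag n (\<lambda>i. 1 / f i)"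
proof (rule mat_inv_unique)
  show "mat_diag n f * mat_diag n (\<lambda>i. 1 / f i) = 1\<^sub>m n"
    unfolding mat_diag_diag using assms by (intro eq_matI) (auto simp: mat_diag_def)
qed auto

lemma det_mat_diag: "Determinant.det (mat_diag n f) = (\<Prod>i<n. f i)" for f :: "nat \<Rightarrow> 'a::field"
proof -
  have "upper_triangular (mat_diag n f)" by (auto simp: mat_diag_def upper_triangular_def)
  from det_upper_triangular[OF this mat_diag_dim] show ?thesis
    by (simp add: diag_mat_def mat_diag_def prod.distinct_set_conv_list[symmetric] atLeast0LessThan)
qed

locale block_model =
  fixes N n :: nat and A :: "real mat"
  assumes A: "A \<in> carrier_mat N n"
begin

definition B :: "nat \<Rightarrow> nat \<Rightarrow> real" where
  "B i j = (if i < N \<and> N \<le> j \<and> j < N + n then A $$ (i, j - N)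
     else if j < N \<and> N \<le> i \<and> i < N + n then - A $$ (j, i - N) else 0)"

lemma B_simps:
  "i < N \<Longrightarrow> j < N \<Longrightarrow> B i j = 0" "i < N \<Longrightarrow> l < n \<Longrightarrow> B i (N + l) = A $$ (i, l)"
  "i < N \<Longrightarrow> l < n \<Longrightarrow> B (N + l) i = - A $$ (i, l)" "l < n \<Longrightarrow> k < n \<Longrightarrow> B (N + l) (N + k) = 0"
  by (auto simp: B_def)

lemma B_skew: "B i j = - B j i"
  by (auto simp: B_def)

context
  fixes c :: real and h :: "nat \<Rightarrow> nat \<Rightarrow> real"
  assumes h: "skew_diag (N + n) c h" and c: "0 < c"
    and hB: "\<And>i j. i \<noteq> j \<Longrightarrow> h i j = B i j"
begin

abbreviation "gi \<equiv> finv (N + n) h"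

lemma h_pos: "i < N + n \<Longrightarrow> 0 < h i i"
  using skew_diag_ge[OF h, of i] c by simp

lemma row_upper:
  assumes i: "i < N"
  shows "(\<Sum>k<N + n. h i k * u k) = h i i * u i + (\<Sum>l<n. A $$ (i, l) * u (N + l))"
proof -
  have "(\<Sum>k<N. h i k * u k) = (\<Sum>k<N. if k = i then h i i * u i else 0)"
    using i by (intro sum.cong refl) (auto simp: hB B_simps)
  then show ?thesis using i by (simp add: sum_block hB B_simps)
qed

lemma row_lower:
  assumes l: "l < n"
  shows "(\<Sum>k<N + n. h (N + l) k * u k) = h (N + l) (N + l) * u (N + l) - (\<Sum>k<N. A $$ (k, l) * u k)"
proof -
  have "(\<Sum>k<n. h (N + l) (N + k) * u (N + k)) = (\<Sum>k<n. if k = l then h (N + l) (N + l) * u (N + l) else 0)"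
    using l by (intro sum.cong refl) (auto simp: hB B_simps)
  then show ?thesis using l by (simp add: sum_block hB B_simps sum_negf)
qed

lemma col_upper:
  assumes i: "i < N"
  shows "(\<Sum>k<N + n. u k * h k i) = u i * h i i - (\<Sum>l<n. u (N + l) * A $$ (i, l))"
proof -
  have "(\<Sum>k<N. u k * h k i) = (\<Sum>k<N. if k = i then u i * h i i else 0)"
    using i by (intro sum.cong refl) (auto simp: hB B_simps)
  then show ?thesis using i by (simp add: sum_block hB B_simps sum_negf)
qed

lemma inverse_upper:
  "i < N \<Longrightarrow> j < N + n \<Longrightarrow> h i i * gi i j + (\<Sum>l<n. A $$ (i, l) * gi (N + l) j) = (if i = j then 1 else 0)"
  using finv_right[OF skew_diag_nz[OF h c], of i j] row_upper[of i "\<lambda>k. gi k j"] by simp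

lemma inverse_lower:
  "l < n \<Longrightarrow> j < N + n \<Longrightarrow> h (N + l) (N + l) * gi (N + l) j - (\<Sum>k<N. A $$ (k, l) * gi k j) = (if N + l = j then 1 else 0)"
  using finv_right[OF skew_diag_nz[OF h c], of "N + l" j] row_lower[of l "\<lambda>k. gi k j"] by simp

text \<open>Both sides equal the sum of \<open>gi k (N + l) * A $$ (k, l)\<close>: read
  \<open>gi * h = 1\<close> on the diagonal of the upper block and \<open>h * gi = 1\<close> on that
  of the lower block. This later relates the two partial traces of \<open>t\<close>.\<close>

lemma trace_balance: "(\<Sum>k<N. h k k * gi k k - 1) = (\<Sum>l<n. h (N + l) (N + l) * gi (N + l) (N + l) - 1)"
proof -
  have "(\<Sum>k<N. h k k * gi k k - 1) = (\<Sum>k<N. \<Sum>l<n. gi k (N + l) * A $$ (k, l))"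
  proof (rule sum.cong[OF refl])
    fix k assume "k \<in> {..<N}"
    then have k: "k < N" by simp
    show "h k k * gi k k - 1 = (\<Sum>l<n. gi k (N + l) * A $$ (k, l))"
      using finv_left[OF skew_diag_nz[OF h c], of k k] col_upper[OF k, of "\<lambda>j. gi k j"] k
      by (simp add: mult.commute)
  qed
  also have "\<dots> = (\<Sum>l<n. \<Sum>k<N. gi k (N + l) * A $$ (k, l))" by (rule sum.swap)
  also have "\<dots> = (\<Sum>l<n. h (N + l) (N + l) * gi (N + l) (N + l) - 1)"
  proof (rule sum.cong[OF refl])
    fix l assume "l \<in> {..<n}"
    then have l: "l < n" by simp
    show "(\<Sum>k<N. gi k (N + l) * A $$ (k, l)) = h (N + l) (N + l) * gi (N + l) (N + l) - 1"
      using inverse_lower[OF l, of "N + l"] l by (simp add: mult.commute)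
  qed
  finally show ?thesis .
qed

text \<open>The upper left block of the inverse inverts the Schur complement of the lower right
  block: the lower rows, whose own block is diagonal, are eliminated.\<close>

lemma schur_upper_inverse:
  assumes i: "i < N" and j: "j < N"
  shows "(\<Sum>k<N. ((if i = k then h i i else 0) + (\<Sum>l<n. A $$ (i, l) * (1 / h (N + l) (N + l)) * A $$ (k, l))) * gi k j)
    = (if i = j then 1 else 0)"
proof -
  have low: "(\<Sum>k<N. A $$ (k, l) * gi k j) = h (N + l) (N + l) * gi (N + l) j" if "l < n" for l
    using inverse_lower[OF that, of j] j by simp
  have "(\<Sum>k<N. ((if i = k then h i i else 0) + (\<Sum>l<n. A $$ (i, l) * (1 / h (N + l) (N + l)) * A $$ (k, l))) * gi k j)
    = (\<Sum>k<N. (if k = i then h i i * gi i j else 0)) + (\<Sum>k<N. \<Sum>l<n. A $$ (i, l) * (1 / h (N + l) (N + l)) * (A $$ (k, l) * gi k j))"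
    unfolding sum.distrib[symmetric]
    by (intro sum.cong refl, subst distrib_right, subst sum_distrib_right) (auto simp: mult_ac)
  also have "(\<Sum>k<N. (if k = i then h i i * gi i j else 0)) = h i i * gi i j" using i by simp
  also have "(\<Sum>k<N. \<Sum>l<n. A $$ (i, l) * (1 / h (N + l) (N + l)) * (A $$ (k, l) * gi k j))
    = (\<Sum>l<n. A $$ (i, l) * (1 / h (N + l) (N + l)) * (\<Sum>k<N. A $$ (k, l) * gi k j))"
    by (subst sum.swap) (simp only: sum_distrib_left)
  also have "\<dots> = (\<Sum>l<n. A $$ (i, l) * gi (N + l) j)"
  proof (rule sum.cong[OF refl])
    fix l assume "l \<in> {..<n}"
    then have l: "l < n" by simp
    show "A $$ (i, l) * (1 / h (N + l) (N + l)) * (\<Sum>k<N. A $$ (k, l) * gi k j) = A $$ (i, l) * gi (N + l) j"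
      using h_pos[of "N + l"] l unfolding low[OF l] by simp
  qed
  also have "h i i * gi i j + \<dots> = (if i = j then 1 else 0)" using inverse_upper[OF i, of j] j by simp
  finally show ?thesis .
qed

text \<open>The blocks exchange their roles. The minus sign of the lower left block and the one from
  solving for the upper rows combine to a plus.\<close>

lemma schur_lower_inverse:
  assumes i: "i < n" and j: "j < n"
  shows "(\<Sum>l<n. ((if i = l then h (N + i) (N + i) else 0) + (\<Sum>k<N. A $$ (k, i) * (1 / h k k) * A $$ (k, l))) * gi (N + l) (N + j))
    = (if i = j then 1 else 0)"
proof -
  have up: "(\<Sum>l<n. A $$ (k, l) * gi (N + l) (N + j)) = - (h k k * gi k (N + j))" if "k < N" for k
    using inverse_upper[OF that, of "N + j"] j that by simp
  have "(\<Sum>l<n. ((if i = l then h (N + i) (N + i) else 0) + (\<Sum>k<N. A $$ (k, i) * (1 / h k k) * A $$ (k, l))) * gi (N + l) (N + j))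
    = (\<Sum>l<n. (if l = i then h (N + i) (N + i) * gi (N + i) (N + j) else 0))
      + (\<Sum>l<n. \<Sum>k<N. A $$ (k, i) * (1 / h k k) * (A $$ (k, l) * gi (N + l) (N + j)))"
    unfolding sum.distrib[symmetric]
    by (intro sum.cong refl, subst distrib_right, subst sum_distrib_right) (auto simp: mult_ac)
  also have "(\<Sum>l<n. (if l = i then h (N + i) (N + i) * gi (N + i) (N + j) else 0)) = h (N + i) (N + i) * gi (N + i) (N + j)"
    using i by simp
  also have "(\<Sum>l<n. \<Sum>k<N. A $$ (k, i) * (1 / h k k) * (A $$ (k, l) * gi (N + l) (N + j)))
    = (\<Sum>k<N. A $$ (k, i) * (1 / h k k) * (\<Sum>l<n. A $$ (k, l) * gi (N + l) (N + j)))"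
    by (subst sum.swap) (simp only: sum_distrib_left)
  also have "\<dots> = (\<Sum>k<N. - (A $$ (k, i) * gi k (N + j)))"
  proof (rule sum.cong[OF refl])
    fix k assume "k \<in> {..<N}"
    then have k: "k < N" by simp
    show "A $$ (k, i) * (1 / h k k) * (\<Sum>l<n. A $$ (k, l) * gi (N + l) (N + j)) = - (A $$ (k, i) * gi k (N + j))"
      using h_pos[of k] k unfolding up[OF k] by simp
  qed
  also have "h (N + i) (N + i) * gi (N + i) (N + j) + \<dots> = (if i = j then 1 else 0)"
    using inverse_lower[OF i, of "N + j"] j by (simp add: sum_negf)
  finally show ?thesis .
qed

text \<open>Eliminating the lower left block: multiply from the right by a unitriangular matrix.\<close>

lemma schur_det:
  "fdet (N + n) h = fdet N (\<lambda>i k. (if i = k then h i i else 0) + (\<Sum>l<n. A $$ (i, l) * (1 / h (N + l) (N + l)) * A $$ (k, l)))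
    * (\<Prod>l<n. h (N + l) (N + l))"
proof -
  \<comment> \<open>\<open>X\<close> solves \<open>C + b X = 0\<close>; the product is then block
    upper triangular, with the Schur complement \<open>E = a + A X\<close> in its corner.\<close>
  define X where "X = Matrix.mat n N (\<lambda>(l, k). 1 / h (N + l) (N + l) * A $$ (k, l))"
  define a b where "a = mat_diag N (\<lambda>i. h i i)" and "b = mat_diag n (\<lambda>l. h (N + l) (N + l))"
  define C where "C = Matrix.mat n N (\<lambda>(l, k). - A $$ (k, l))"
  define E where "E = Matrix.mat N N (\<lambda>(i, k). (if i = k then h i i else 0) + (\<Sum>l<n. A $$ (i, l) * (1 / h (N + l) (N + l)) * A $$ (k, l)))"
  have car: "X \<in> carrier_mat n N" "a \<in> carrier_mat N N" "b \<in> carrier_mat n n" "C \<in> carrier_mat n N" "E \<in> carrier_mat N N"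
    by (simp_all add: X_def a_def b_def C_def E_def)
  have 1: "four_block_mat a A C b = fmat (N + n) h"
  proof (rule eq_matI)
    fix i j assume "i < dim_row (fmat (N + n) h)" "j < dim_col (fmat (N + n) h)"
    then have ij: "i < N + n" "j < N + n" by auto
    show "four_block_mat a A C b $$ (i, j) = fmat (N + n) h $$ (i, j)"
      using ij A car hB[of i j]
      by (cases "i = j"; cases "i < N"; cases "j < N") (auto simp: a_def b_def C_def mat_diag_def B_def)
  qed (use A car in auto)
  have "four_block_mat a A C b * four_block_mat (1\<^sub>m N) (0\<^sub>m N n) X (1\<^sub>m n)
    = four_block_mat (a * 1\<^sub>m N + A * X) (a * 0\<^sub>m N n + A * 1\<^sub>m n) (C * 1\<^sub>m N + b * X) (C * 0\<^sub>m N n + b * 1\<^sub>m n)"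
    by (rule mult_four_block_mat) (use car A in auto)
  also have "a * 1\<^sub>m N + A * X = E"
  proof (rule eq_matI)
    fix i j assume "i < dim_row E" "j < dim_col E"
    then have ij: "i < N" "j < N" using car by auto
    have "(A * X) $$ (i, j) = (\<Sum>l<n. A $$ (i, l) * X $$ (l, j))"
      by (rule mult_mat_entry[OF A car(1) ij])
    also have "\<dots> = (\<Sum>l<n. A $$ (i, l) * (1 / h (N + l) (N + l)) * A $$ (j, l))"
      using ij by (intro sum.cong refl) (simp add: X_def)
    finally show "(a * 1\<^sub>m N + A * X) $$ (i, j) = E $$ (i, j)"
      using ij car A by (simp add: E_def a_def mat_diag_def del: index_mult_mat(1))
  qed (use car A in auto)
  also have "a * 0\<^sub>m N n + A * 1\<^sub>m n = A" using car A by simp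
  also have "C * 1\<^sub>m N + b * X = 0\<^sub>m n N"
  proof (rule eq_matI)
    fix i j assume "i < dim_row (0\<^sub>m n N :: real mat)" "j < dim_col (0\<^sub>m n N :: real mat)"
    then have ij: "i < n" "j < N" by auto
    have "(b * X) $$ (i, j) = h (N + i) (N + i) * X $$ (i, j)"
      unfolding b_def mat_diag_mult_left[OF car(1)] using ij by simp
    then show "(C * 1\<^sub>m N + b * X) $$ (i, j) = 0\<^sub>m n N $$ (i, j)"
      using ij car h_pos[of "N + i"] by (simp add: C_def X_def del: index_mult_mat(1))
  qed (use car in auto)
  also have "C * 0\<^sub>m N n + b * 1\<^sub>m n = b" using car by simp
  finally have prod: "fmat (N + n) h * four_block_mat (1\<^sub>m N) (0\<^sub>m N n) X (1\<^sub>m n) = four_block_mat E A (0\<^sub>m n N) b"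
    unfolding 1 .
  have "Determinant.det (fmat (N + n) h * four_block_mat (1\<^sub>m N) (0\<^sub>m N n) X (1\<^sub>m n))
      = fdet (N + n) h * Determinant.det (four_block_mat (1\<^sub>m N) (0\<^sub>m N n) X (1\<^sub>m n))"
    unfolding fdet_def by (rule det_mult[OF fmat_carrier]) (use car in auto)
  moreover have "Determinant.det (four_block_mat (1\<^sub>m N) (0\<^sub>m N n) X (1\<^sub>m n)) = 1"
    by (subst det_four_block_mat_upper_right_zero[of _ N _ n]) (use car in auto)
  moreover have "Determinant.det (four_block_mat E A (0\<^sub>m n N) b) = Determinant.det E * Determinant.det b"
    by (rule det_four_block_mat_lower_left_zero) (use car A in auto)
  ultimately have "fdet (N + n) h = Determinant.det E * Determinant.det b"
    unfolding prod by simp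
  then show ?thesis by (simp add: det_mat_diag b_def fdet_def fmat_def E_def)
qed

end

end

section \<open>The deterministic equations on the negative axis\<close>

lemma mult_div_sqrt:
  assumes "0 < w"
  shows "w * (1 / sqrt w * z) = sqrt w * z"
proof -
  have "w * (1 / sqrt w * z) = w / sqrt w * z" by simp
  then show ?thesis using assms by (simp only: real_div_sqrt less_imp_le)
qed

locale deterministic_equivalent = block_model N n A for N n :: nat and A :: "real mat" +
  fixes sig :: "nat \<Rightarrow> nat \<Rightarrow> real" and psi psit :: "nat \<Rightarrow> complex \<Rightarrow> complex"
    and sig_max a_max :: real
  assumes N: "1 \<le> N" and n: "1 \<le> n" and system: "solves_system N n A sig psi psit"
    and sig_le: "\<And>i j. i < N \<Longrightarrow> j < n \<Longrightarrow> \<bar>sig i j\<bar> \<le> sig_max"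
    and cols: "\<And>k. k < n \<Longrightarrow> vec_eucl_norm (col A k) \<le> a_max"
    and rows: "\<And>l. l < N \<Longrightarrow> vec_eucl_norm (Matrix.row A l) \<le> a_max"
begin

definition m :: nat where "m = N + n"

text \<open>The independent variables sit in the upper right block; \<open>p\<close> stands for row
  \<open>fst p\<close> and column \<open>snd p - N\<close> of the noise.\<close>

definition P :: "(nat \<times> nat) set" where
  "P = (\<lambda>(i, j). (i, N + j)) ` ({..<N} \<times> {..<n})"

definition v :: "nat \<times> nat \<Rightarrow> real" where
  "v p = (sig (fst p) (snd p - N))\<^sup>2 / real n"

abbreviation "S \<equiv> pair_mat P 1 v"

lemma P_iff: "(i, j) \<in> P \<longleftrightarrow> i < N \<and> N \<le> j \<and> j < N + n"
proof
  assume "i < N \<and> N \<le> j \<and> j < N + n"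
  then show "(i, j) \<in> P" unfolding P_def by (intro image_eqI[of _ _ "(i, j - N)"]) auto
qed (auto simp: P_def)

lemma P_sub: "P \<subseteq> {(i, j). i < j \<and> j < m}"
  by (auto simp: P_iff m_def)

lemma S_simps:
  "i < N \<Longrightarrow> k < N \<Longrightarrow> S i k = 0" "i < N \<Longrightarrow> l < n \<Longrightarrow> S i (N + l) = (sig i l)\<^sup>2 / real n"
  "i < N \<Longrightarrow> l < n \<Longrightarrow> S (N + l) i = (sig i l)\<^sup>2 / real n" "l < n \<Longrightarrow> k < n \<Longrightarrow> S (N + l) (N + k) = 0"
  by (auto simp: pair_mat_def P_iff v_def)

lemma S_row_upper: "i < N \<Longrightarrow> (\<Sum>j<m. S i j * u j) = 1 / real n * (\<Sum>l<n. (sig i l)\<^sup>2 * u (N + l))"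
  unfolding m_def sum_block by (simp add: S_simps sum_distrib_left sum_divide_distrib)

lemma S_row_lower: "l < n \<Longrightarrow> (\<Sum>j<m. S (N + l) j * u j) = 1 / real n * (\<Sum>k<N. (sig k l)\<^sup>2 * u k)"
  unfolding m_def sum_block by (simp add: S_simps sum_distrib_left sum_divide_distrib)

definition x :: "real \<Rightarrow> nat \<Rightarrow> real" where "x w i = Re (psi i (- complex_of_real w))"
definition y :: "real \<Rightarrow> nat \<Rightarrow> real" where "y w l = Re (psit l (- complex_of_real w))"

lemma psi_class: "i < N \<Longrightarrow> psi i \<in> stieltjes_class" "l < n \<Longrightarrow> psit l \<in> stieltjes_class"
  using system by (auto simp: solves_system_def)

lemma x_pos: "0 < w \<Longrightarrow> i < N \<Longrightarrow> 0 < x w i" "0 < w \<Longrightarrow> l < n \<Longrightarrow> 0 < y w l"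
  using stieltjes_negative_axis(2) psi_class by (auto simp: x_def y_def)

lemma psi_x:
  "0 < w \<Longrightarrow> i < N \<Longrightarrow> psi i (- complex_of_real w) = complex_of_real (x w i)"
  "0 < w \<Longrightarrow> l < n \<Longrightarrow> psit l (- complex_of_real w) = complex_of_real (y w l)"
  using stieltjes_negative_axis(1) psi_class unfolding x_def y_def by blast+

text \<open>The matrix \<open>r + diag (S t) + B\<close> with \<open>r = sqrt w\<close>, but with
  its diagonal written through \<open>psi\<close> and \<open>psit\<close>. In this form
  \<open>T_mat\<close> and \<open>Tt_mat\<close> are recognised as its inverse blocks, and only
  afterwards do the equations of the system identify the diagonal.\<close>

definition hs :: "real \<Rightarrow> nat \<Rightarrow> nat \<Rightarrow> real" where
  "hs w i j = (if i = j then 1 / (sqrt w * (if i < N then x w i else y w (i - N))) else B i j)"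

lemma hs_diag: "i < N \<Longrightarrow> hs w i i = 1 / (sqrt w * x w i)" "hs w (N + l) (N + l) = 1 / (sqrt w * y w l)"
  by (auto simp: hs_def)

lemma hs_off: "i \<noteq> j \<Longrightarrow> hs w i j = B i j"
  by (simp add: hs_def)

lemma hs_pos: "0 < w \<Longrightarrow> i < m \<Longrightarrow> 0 < hs w i i"
  using x_pos by (auto simp: hs_def m_def)

text \<open>The minimum of the finitely many positive diagonal entries serves as \<open>c\<close>;
  that the diagonal is at least \<open>sqrt w\<close> becomes known only through the equations of
  the system.\<close>

lemma hs_skew:
  assumes w: "0 < w"
  obtains c where "0 < c" "skew_diag (N + n) c (hs w)"
proof
  define c where "c = Min ((\<lambda>i. hs w i i) ` {..<m})"
  have fin: "finite ((\<lambda>i. hs w i i) ` {..<m})" "(\<lambda>i. hs w i i) ` {..<m} \<noteq> {}"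
    using N by (auto simp: m_def)
  show "0 < c" unfolding c_def using hs_pos[OF w] fin by (subst Min_gr_iff) auto
  show "skew_diag (N + n) c (hs w)"
  proof (rule skew_diagI)
    fix i assume "i < N + n"
    then show "c \<le> hs w i i" unfolding c_def using fin by (intro Min_le) (auto simp: m_def)
  next
    fix i j :: nat assume "i \<noteq> j"
    then show "hs w i j = - hs w j i" using B_skew[of i j] hs_off[of i j w] hs_off[of j i w] by simp
  qed
qed

lemma mat_inv_Psi:
  assumes w: "0 < w"
  shows "mat_inv (mat_diag N (\<lambda>i. psi i (- complex_of_real w))) = mat_diag N (\<lambda>i. 1 / psi i (- complex_of_real w))"
    and "mat_inv (mat_diag n (\<lambda>i. psit i (- complex_of_real w))) = mat_diag n (\<lambda>i. 1 / psit i (- complex_of_real w))"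
proof -
  have "psi i (- complex_of_real w) \<noteq> 0" if "i < N" for i
    using psi_x(1)[OF w that] x_pos(1)[OF w that] by simp
  then show "mat_inv (mat_diag N (\<lambda>i. psi i (- complex_of_real w))) = mat_diag N (\<lambda>i. 1 / psi i (- complex_of_real w))"
    by (rule mat_inv_diag)
  have "psit i (- complex_of_real w) \<noteq> 0" if "i < n" for i
    using psi_x(2)[OF w that] x_pos(2)[OF w that] by simp
  then show "mat_inv (mat_diag n (\<lambda>i. psit i (- complex_of_real w))) = mat_diag n (\<lambda>i. 1 / psit i (- complex_of_real w))"
    by (rule mat_inv_diag)
qed

lemma cmat_A: "cmat A \<in> carrier_mat N n"
  using A by (simp add: cmat_def)

lemma cmat_index: "i < N \<Longrightarrow> l < n \<Longrightarrow> cmat A $$ (i, l) = complex_of_real (A $$ (i, l))"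
  using A by (simp add: cmat_def)

lemma APsiA_entry:
  assumes w: "0 < w" and ij: "i < N" "k < N"
  shows "(cmat A * mat_diag n (\<lambda>j. psit j (- complex_of_real w)) * transpose_mat (cmat A)) $$ (i, k)
    = complex_of_real (1 / sqrt w * (\<Sum>l<n. A $$ (i, l) * (1 / hs w (N + l) (N + l)) * A $$ (k, l)))"
proof -
  have "(cmat A * mat_diag n (\<lambda>j. psit j (- complex_of_real w)) * transpose_mat (cmat A)) $$ (i, k)
    = (\<Sum>l<n. (cmat A * mat_diag n (\<lambda>j. psit j (- complex_of_real w))) $$ (i, l) * transpose_mat (cmat A) $$ (l, k))"
    by (rule mult_mat_entry[of _ N n _ N]) (use cmat_A ij in auto)
  also have "\<dots> = (\<Sum>l<n. complex_of_real (A $$ (i, l) * y w l * A $$ (k, l)))"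
  proof (rule sum.cong[OF refl])
    fix l assume "l \<in> {..<n}"
    then show "(cmat A * mat_diag n (\<lambda>j. psit j (- complex_of_real w))) $$ (i, l) * transpose_mat (cmat A) $$ (l, k)
      = complex_of_real (A $$ (i, l) * y w l * A $$ (k, l))"
      using ij cmat_A psi_x(2)[OF w] cmat_index by (simp add: mat_diag_mult_right[OF cmat_A])
  qed
  also have "\<dots> = complex_of_real (\<Sum>l<n. A $$ (i, l) * y w l * A $$ (k, l))" by simp
  also have "(\<Sum>l<n. A $$ (i, l) * y w l * A $$ (k, l))
    = 1 / sqrt w * (\<Sum>l<n. A $$ (i, l) * (1 / hs w (N + l) (N + l)) * A $$ (k, l))"
    using w by (simp add: hs_diag sum_distrib_left mult.assoc)
  finally show ?thesis .
qed

lemma AtPsiA_entry: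
  assumes w: "0 < w" and ij: "i < n" "l < n"
  shows "(transpose_mat (cmat A) * mat_diag N (\<lambda>j. psi j (- complex_of_real w)) * cmat A) $$ (i, l)
    = complex_of_real (1 / sqrt w * (\<Sum>k<N. A $$ (k, i) * (1 / hs w k k) * A $$ (k, l)))"
proof -
  have car: "transpose_mat (cmat A) \<in> carrier_mat n N" using cmat_A by simp
  have "(transpose_mat (cmat A) * mat_diag N (\<lambda>j. psi j (- complex_of_real w)) * cmat A) $$ (i, l)
    = (\<Sum>k<N. (transpose_mat (cmat A) * mat_diag N (\<lambda>j. psi j (- complex_of_real w))) $$ (i, k) * cmat A $$ (k, l))"
    by (rule mult_mat_entry[of _ n N _ n]) (use cmat_A ij in auto)
  also have "\<dots> = (\<Sum>k<N. complex_of_real (A $$ (k, i) * x w k * A $$ (k, l)))"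
  proof (rule sum.cong[OF refl])
    fix k assume "k \<in> {..<N}"
    then show "(transpose_mat (cmat A) * mat_diag N (\<lambda>j. psi j (- complex_of_real w))) $$ (i, k) * cmat A $$ (k, l)
      = complex_of_real (A $$ (k, i) * x w k * A $$ (k, l))"
      using ij cmat_A psi_x(1)[OF w] cmat_index by (simp add: mat_diag_mult_right[OF car])
  qed
  also have "\<dots> = complex_of_real (\<Sum>k<N. A $$ (k, i) * x w k * A $$ (k, l))" by simp
  also have "(\<Sum>k<N. A $$ (k, i) * x w k * A $$ (k, l))
    = 1 / sqrt w * (\<Sum>k<N. A $$ (k, i) * (1 / hs w k k) * A $$ (k, l))"
    using w by (simp add: hs_diag sum_distrib_left mult.assoc)
  finally show ?thesis .
qed

text \<open>The matrix inverted in \<open>T_mat\<close> is \<open>sqrt w\<close> times the Schur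
  complement of \<open>hs w\<close>, so its inverse is the upper block of the inverse of
  \<open>hs w\<close>, divided by \<open>sqrt w\<close>.\<close>

lemma T_mat_eq:
  assumes w: "0 < w"
  shows "T_mat N n A psi psit (- complex_of_real w)
    = Matrix.mat N N (\<lambda>(i, j). complex_of_real (finv m (hs w) i j / sqrt w))" (is "_ = ?C")
proof -
  obtain c where c: "0 < c" "skew_diag (N + n) c (hs w)" using hs_skew[OF w] .
  let ?z = "- complex_of_real w"
  let ?M = "mat_inv (mat_diag N (\<lambda>i. psi i ?z)) - ?z \<cdot>\<^sub>m (cmat A * mat_diag n (\<lambda>j. psit j ?z) * transpose_mat (cmat A))"
  have M: "?M \<in> carrier_mat N N" unfolding mat_inv_Psi[OF w] using cmat_A by auto
  have entry: "?M $$ (i, k) = complex_of_real (sqrt w * ((if i = k then hs w i i else 0)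
      + (\<Sum>l<n. A $$ (i, l) * (1 / hs w (N + l) (N + l)) * A $$ (k, l))))" if ik: "i < N" "k < N" for i k
  proof -
    have "?M $$ (i, k) = (if i = k then 1 / psi i ?z else 0)
        - ?z * (cmat A * mat_diag n (\<lambda>j. psit j ?z) * transpose_mat (cmat A)) $$ (i, k)"
      unfolding mat_inv_Psi[OF w] using ik cmat_A by (auto simp: mat_diag_def simp del: index_mult_mat(1))
    also have "\<dots> = complex_of_real ((if i = k then 1 / x w i else 0)
        + w * (1 / sqrt w * (\<Sum>l<n. A $$ (i, l) * (1 / hs w (N + l) (N + l)) * A $$ (k, l))))"
      unfolding APsiA_entry[OF w ik] using psi_x(1)[OF w ik(1)] by auto
    also have "w * (1 / sqrt w * (\<Sum>l<n. A $$ (i, l) * (1 / hs w (N + l) (N + l)) * A $$ (k, l)))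
      = sqrt w * (\<Sum>l<n. A $$ (i, l) * (1 / hs w (N + l) (N + l)) * A $$ (k, l))"
      by (rule mult_div_sqrt[OF w])
    also have "(if i = k then 1 / x w i else 0) = sqrt w * (if i = k then hs w i i else 0)"
      using w ik by (auto simp: hs_diag)
    finally show ?thesis by (simp only: distrib_left)
  qed
  have "?M * ?C = 1\<^sub>m N"
  proof (rule eq_matI)
    fix i j assume "i < dim_row (1\<^sub>m N :: complex mat)" "j < dim_col (1\<^sub>m N :: complex mat)"
    then have ij: "i < N" "j < N" by auto
    have "(?M * ?C) $$ (i, j) = (\<Sum>k<N. ?M $$ (i, k) * ?C $$ (k, j))"
      by (rule mult_mat_entry[OF M _ ij]) simp
    also have "\<dots> = (\<Sum>k<N. complex_of_real (((if i = k then hs w i i else 0)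
      + (\<Sum>l<n. A $$ (i, l) * (1 / hs w (N + l) (N + l)) * A $$ (k, l))) * finv (N + n) (hs w) k j))"
    proof (rule sum.cong[OF refl])
      fix k assume "k \<in> {..<N}"
      then have k: "k < N" by simp
      have "?M $$ (i, k) * ?C $$ (k, j) = complex_of_real (sqrt w * ((if i = k then hs w i i else 0)
      + (\<Sum>l<n. A $$ (i, l) * (1 / hs w (N + l) (N + l)) * A $$ (k, l))) * (finv m (hs w) k j / sqrt w))"
        unfolding entry[OF ij(1) k] using k ij by (simp only: index_mat(1) prod.case of_real_mult)
      also have "sqrt w * ((if i = k then hs w i i else 0)
      + (\<Sum>l<n. A $$ (i, l) * (1 / hs w (N + l) (N + l)) * A $$ (k, l))) * (finv m (hs w) k j / sqrt w)
        = ((if i = k then hs w i i else 0)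
      + (\<Sum>l<n. A $$ (i, l) * (1 / hs w (N + l) (N + l)) * A $$ (k, l))) * finv (N + n) (hs w) k j"
        using w by (simp only: m_def) (simp add: field_simps)
      finally show "?M $$ (i, k) * ?C $$ (k, j) = complex_of_real (((if i = k then hs w i i else 0)
      + (\<Sum>l<n. A $$ (i, l) * (1 / hs w (N + l) (N + l)) * A $$ (k, l))) * finv (N + n) (hs w) k j)" .
    qed
    also have "\<dots> = complex_of_real (if i = j then 1 else 0)"
      unfolding of_real_sum[symmetric]
      by (rule arg_cong[where f = complex_of_real], rule schur_upper_inverse[OF c(2,1) _ ij], rule hs_off)
    finally show "(?M * ?C) $$ (i, j) = 1\<^sub>m N $$ (i, j)" using ij by (simp del: index_mult_mat(1))
  qed (use M in auto)
  then show ?thesis unfolding T_mat_def by (intro mat_inv_unique[OF M]) auto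
qed

lemma Tt_mat_eq:
  assumes w: "0 < w"
  shows "Tt_mat N n A psi psit (- complex_of_real w)
    = Matrix.mat n n (\<lambda>(i, j). complex_of_real (finv m (hs w) (N + i) (N + j) / sqrt w))" (is "_ = ?C")
proof -
  obtain c where c: "0 < c" "skew_diag (N + n) c (hs w)" using hs_skew[OF w] .
  let ?z = "- complex_of_real w"
  let ?M = "mat_inv (mat_diag n (\<lambda>i. psit i ?z)) - ?z \<cdot>\<^sub>m (transpose_mat (cmat A) * mat_diag N (\<lambda>j. psi j ?z) * cmat A)"
  have M: "?M \<in> carrier_mat n n" unfolding mat_inv_Psi[OF w] using cmat_A by auto
  have entry: "?M $$ (i, l) = complex_of_real (sqrt w * ((if i = l then hs w (N + i) (N + i) else 0)
      + (\<Sum>k<N. A $$ (k, i) * (1 / hs w k k) * A $$ (k, l))))" if ik: "i < n" "l < n" for i l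
  proof -
    have "?M $$ (i, l) = (if i = l then 1 / psit i ?z else 0)
        - ?z * (transpose_mat (cmat A) * mat_diag N (\<lambda>j. psi j ?z) * cmat A) $$ (i, l)"
      unfolding mat_inv_Psi[OF w] using ik cmat_A by (auto simp: mat_diag_def simp del: index_mult_mat(1))
    also have "\<dots> = complex_of_real ((if i = l then 1 / y w i else 0)
        + w * (1 / sqrt w * (\<Sum>k<N. A $$ (k, i) * (1 / hs w k k) * A $$ (k, l))))"
      unfolding AtPsiA_entry[OF w ik] using psi_x(2)[OF w ik(1)] by auto
    also have "w * (1 / sqrt w * (\<Sum>k<N. A $$ (k, i) * (1 / hs w k k) * A $$ (k, l)))
      = sqrt w * (\<Sum>k<N. A $$ (k, i) * (1 / hs w k k) * A $$ (k, l))"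
      by (rule mult_div_sqrt[OF w])
    also have "(if i = l then 1 / y w i else 0) = sqrt w * (if i = l then hs w (N + i) (N + i) else 0)"
      using w ik by (auto simp: hs_diag)
    finally show ?thesis by (simp only: distrib_left)
  qed
  have "?M * ?C = 1\<^sub>m n"
  proof (rule eq_matI)
    fix i j assume "i < dim_row (1\<^sub>m n :: complex mat)" "j < dim_col (1\<^sub>m n :: complex mat)"
    then have ij: "i < n" "j < n" by auto
    have "(?M * ?C) $$ (i, j) = (\<Sum>l<n. ?M $$ (i, l) * ?C $$ (l, j))"
      by (rule mult_mat_entry[OF M _ ij]) simp
    also have "\<dots> = (\<Sum>l<n. complex_of_real (((if i = l then hs w (N + i) (N + i) else 0)
      + (\<Sum>k<N. A $$ (k, i) * (1 / hs w k k) * A $$ (k, l))) * finv (N + n) (hs w) (N + l) (N + j)))"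
    proof (rule sum.cong[OF refl])
      fix l assume "l \<in> {..<n}"
      then have l: "l < n" by simp
      have "?M $$ (i, l) * ?C $$ (l, j) = complex_of_real (sqrt w * ((if i = l then hs w (N + i) (N + i) else 0)
      + (\<Sum>k<N. A $$ (k, i) * (1 / hs w k k) * A $$ (k, l))) * (finv m (hs w) (N + l) (N + j) / sqrt w))"
        unfolding entry[OF ij(1) l] using l ij by (simp only: index_mat(1) prod.case of_real_mult)
      also have "sqrt w * ((if i = l then hs w (N + i) (N + i) else 0)
      + (\<Sum>k<N. A $$ (k, i) * (1 / hs w k k) * A $$ (k, l))) * (finv m (hs w) (N + l) (N + j) / sqrt w)
        = ((if i = l then hs w (N + i) (N + i) else 0)
      + (\<Sum>k<N. A $$ (k, i) * (1 / hs w k k) * A $$ (k, l))) * finv (N + n) (hs w) (N + l) (N + j)"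
        using w by (simp only: m_def) (simp add: field_simps)
      finally show "?M $$ (i, l) * ?C $$ (l, j) = complex_of_real (((if i = l then hs w (N + i) (N + i) else 0)
      + (\<Sum>k<N. A $$ (k, i) * (1 / hs w k k) * A $$ (k, l))) * finv (N + n) (hs w) (N + l) (N + j))" .
    qed
    also have "\<dots> = complex_of_real (if i = j then 1 else 0)"
      unfolding of_real_sum[symmetric]
      by (rule arg_cong[where f = complex_of_real], rule schur_lower_inverse[OF c(2,1) _ ij], rule hs_off)
    finally show "(?M * ?C) $$ (i, j) = 1\<^sub>m n $$ (i, j)" using ij by (simp del: index_mult_mat(1))
  qed (use M in auto)
  then show ?thesis unfolding Tt_mat_def by (intro mat_inv_unique[OF M]) auto
qed


definition t :: "real \<Rightarrow> nat \<Rightarrow> real" where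
  "t r k = finv m (hs (r\<^sup>2)) k k"

lemma t_nonneg:
  assumes "0 < r" "k < m"
  shows "0 \<le> t r k"
proof -
  have "0 < r\<^sup>2" using assms by simp
  then obtain c where "0 < c" "skew_diag (N + n) c (hs (r\<^sup>2))" using hs_skew by blast
  then show ?thesis using finv_diag_nonneg[of "N + n" c "hs (r\<^sup>2)" k] assms by (simp add: t_def m_def)
qed

lemma T_diag: "0 < r \<Longrightarrow> i < N \<Longrightarrow> T_mat N n A psi psit (- complex_of_real (r\<^sup>2)) $$ (i, i) = complex_of_real (t r i / r)"
  by (subst T_mat_eq) (auto simp: t_def)

lemma Tt_diag: "0 < r \<Longrightarrow> l < n \<Longrightarrow> Tt_mat N n A psi psit (- complex_of_real (r\<^sup>2)) $$ (l, l) = complex_of_real (t r (N + l) / r)"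
  by (subst Tt_mat_eq) (auto simp: t_def)

definition q :: "real \<Rightarrow> nat \<Rightarrow> real" where
  "q r i = (\<Sum>j<m. S i j * t r j)"

lemma off_half_line: "0 < w \<Longrightarrow> - complex_of_real w \<notin> \<real>\<^sub>\<ge>\<^sub>0"
  by (auto simp: nonneg_Reals_def complex_eq_iff)

lemma reciprocal_eq:
  fixes r d x :: real
  assumes r: "0 < r" and d: "0 \<le> d" and x: "complex_of_real x = -1 / (- complex_of_real (r\<^sup>2) * (1 + complex_of_real d))"
  shows "1 / (sqrt (r\<^sup>2) * x) = r + r * d"
proof -
  have "-1 / (- complex_of_real (r\<^sup>2) * (1 + complex_of_real d)) = complex_of_real (1 / (r\<^sup>2 * (1 + d)))"
    by simp
  then have "x = 1 / (r\<^sup>2 * (1 + d))" using x by (simp only: of_real_eq_iff)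
  then show ?thesis using r d by (simp add: power2_eq_square field_simps)
qed

text \<open>At \<open>z = - r^2\<close> the equation reads
  \<open>psi i = 1 / (r\<^sup>2 * (1 + d))\<close>, which makes the diagonal entry
  \<open>r + r * d\<close>. The factor \<open>r\<close> in \<open>r * d\<close> cancels the
  \<open>1 / r\<close> between \<open>t\<close> and the entries of \<open>Tt_mat\<close>.\<close>

lemma hs_eq_upper:
  assumes r: "0 < r" and i: "i < N"
  shows "hs (r\<^sup>2) i i = r + q r i"
proof -
  have w: "0 < r\<^sup>2" using r by simp
  define d where "d = 1 / real n * (\<Sum>l<n. (sig i l)\<^sup>2 * (t r (N + l) / r))"
  have d0: "0 \<le> d" unfolding d_def using r t_nonneg[OF r] by (intro mult_nonneg_nonneg sum_nonneg divide_nonneg_nonneg) (auto simp: m_def)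
  have car: "Tt_mat N n A psi psit (- complex_of_real (r\<^sup>2)) \<in> carrier_mat n n" by (subst Tt_mat_eq[OF w]) simp
  have "mat_tr (Dt_mat n sig i * Tt_mat N n A psi psit (- complex_of_real (r\<^sup>2)))
      = (\<Sum>l<n. complex_of_real ((sig i l)\<^sup>2 * (t r (N + l) / r)))"
    unfolding mat_tr_def Dt_mat_def mat_diag_mult_left[OF car]
    by (intro sum.cong) (auto simp: Tt_diag[OF r] simp del: of_real_power)
  then have tr: "1 / of_nat n * mat_tr (Dt_mat n sig i * Tt_mat N n A psi psit (- complex_of_real (r\<^sup>2))) = complex_of_real d"
    by (simp add: d_def)
  have "complex_of_real (x (r\<^sup>2) i) = -1 / (- complex_of_real (r\<^sup>2) * (1 + complex_of_real d))"
    unfolding psi_x(1)[OF w i, symmetric] tr[symmetric]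
    using system off_half_line[OF w] i unfolding solves_system_def by blast
  from reciprocal_eq[OF r d0 this] have "hs (r\<^sup>2) i i = r + r * d" using i by (simp add: hs_diag)
  also have "r * d = q r i"
    unfolding q_def S_row_upper[OF i] d_def using r by (simp add: sum_distrib_left)
  finally show ?thesis .
qed

lemma hs_eq_lower:
  assumes r: "0 < r" and l: "l < n"
  shows "hs (r\<^sup>2) (N + l) (N + l) = r + q r (N + l)"
proof -
  have w: "0 < r\<^sup>2" using r by simp
  define d where "d = 1 / real n * (\<Sum>k<N. (sig k l)\<^sup>2 * (t r k / r))"
  have d0: "0 \<le> d" unfolding d_def using r t_nonneg[OF r] by (intro mult_nonneg_nonneg sum_nonneg divide_nonneg_nonneg) (auto simp: m_def)
  have car: "T_mat N n A psi psit (- complex_of_real (r\<^sup>2)) \<in> carrier_mat N N" by (subst T_mat_eq[OF w]) simp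
  have "mat_tr (D_mat N sig l * T_mat N n A psi psit (- complex_of_real (r\<^sup>2)))
      = (\<Sum>k<N. complex_of_real ((sig k l)\<^sup>2 * (t r k / r)))"
    unfolding mat_tr_def D_mat_def mat_diag_mult_left[OF car]
    by (intro sum.cong) (auto simp: T_diag[OF r] simp del: of_real_power)
  then have tr: "1 / of_nat n * mat_tr (D_mat N sig l * T_mat N n A psi psit (- complex_of_real (r\<^sup>2))) = complex_of_real d"
    by (simp add: d_def)
  have "complex_of_real (y (r\<^sup>2) l) = -1 / (- complex_of_real (r\<^sup>2) * (1 + complex_of_real d))"
    unfolding psi_x(2)[OF w l, symmetric] tr[symmetric]
    using system off_half_line[OF w] l unfolding solves_system_def by blast
  from reciprocal_eq[OF r d0 this] have "hs (r\<^sup>2) (N + l) (N + l) = r + r * d" by (simp add: hs_diag)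
  also have "r * d = q r (N + l)"
    unfolding q_def S_row_lower[OF l] d_def using r by (simp add: sum_distrib_left)
  finally show ?thesis .
qed

lemma index_cases:
  assumes "i < m"
  obtains "i < N" | l where "l < n" "i = N + l"
proof (cases "i < N")
  case False
  then have "i - N < n" "i = N + (i - N)" using assms by (auto simp: m_def)
  then show ?thesis using that by blast
qed (use that in blast)

lemma hs_eq: "0 < r \<Longrightarrow> i < m \<Longrightarrow> hs (r\<^sup>2) i i = r + q r i"
  by (metis index_cases hs_eq_upper hs_eq_lower)

text \<open>Solving \<open>hs_eq\<close> for \<open>q\<close> expresses it through a Stieltjes
  transform at \<open>- s\<^sup>2\<close>; this takes the place of an implicit function
  argument.\<close>

lemma q_differentiable:
  assumes r: "0 < r" and i: "i < m"
  shows "(\<lambda>r. q r i) differentiable (at r)"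
proof -
  have w: "0 < r\<^sup>2" using r by simp
  define f where "f = (\<lambda>w. Re ((if i < N then psi i else psit (i - N)) (- complex_of_real w)))"
  have cl: "(if i < N then psi i else psit (i - N)) \<in> stieltjes_class"
    using psi_class i by (auto simp: m_def)
  have "f differentiable (at (r\<^sup>2))"
    unfolding f_def by (rule stieltjes_negative_axis(3)[OF cl w])
  then obtain f' where f': "(f has_real_derivative f') (at (r\<^sup>2))" by (auto simp: real_differentiable_def)
  have fpos: "0 < f (r\<^sup>2)" unfolding f_def by (rule stieltjes_negative_axis(2)[OF cl w])
  have q: "q s i = 1 / (s * f (s\<^sup>2)) - s" if s: "0 < s" for s
    using hs_eq[OF s i] s by (cases "i < N") (simp_all add: hs_def f_def x_def y_def del: of_real_power)
  have "((\<lambda>s. f (s\<^sup>2)) has_real_derivative f' * (2 * r)) (at r)"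
    by (rule DERIV_chain2[where f = f and g = "\<lambda>s. s\<^sup>2", OF f']) (auto intro!: derivative_eq_intros)
  then have "((\<lambda>s. 1 / (s * f (s\<^sup>2)) - s) has_real_derivative
      (0 * (r * f (r\<^sup>2)) - 1 * (1 * f (r\<^sup>2) + f' * (2 * r) * r)) / ((r * f (r\<^sup>2)) * (r * f (r\<^sup>2))) - 1) (at r)"
    using r fpos by (intro DERIV_diff DERIV_ident DERIV_divide DERIV_const DERIV_mult) auto
  then have "((\<lambda>s. q s i) has_real_derivative
      (0 * (r * f (r\<^sup>2)) - 1 * (1 * f (r\<^sup>2) + f' * (2 * r) * r)) / ((r * f (r\<^sup>2)) * (r * f (r\<^sup>2))) - 1) (at r)"
    by (rule has_field_derivative_transform_within_open[of _ _ _ "{0<..}"]) (use r q in auto)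
  then show ?thesis by (auto simp: real_differentiable_def)
qed

lemma norm_sq: "vec_eucl_norm u \<le> a_max \<Longrightarrow> (\<Sum>i<dim_vec u. (u $ i)\<^sup>2) \<le> a_max\<^sup>2"
proof -
  assume u: "vec_eucl_norm u \<le> a_max"
  have s: "scalar_prod u u = (\<Sum>i<dim_vec u. (u $ i)\<^sup>2)"
    by (simp add: scalar_prod_def power2_eq_square atLeast0LessThan)
  have nn: "0 \<le> (\<Sum>i<dim_vec u. (u $ i)\<^sup>2)" by (intro sum_nonneg) auto
  have "sqrt (\<Sum>i<dim_vec u. (u $ i)\<^sup>2) \<le> a_max" using u by (simp only: vec_eucl_norm_def s)
  then have "(sqrt (\<Sum>i<dim_vec u. (u $ i)\<^sup>2))\<^sup>2 \<le> a_max\<^sup>2" using nn by (intro power_mono) auto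
  then show ?thesis using nn by simp
qed

text \<open>A row of \<open>B\<close> is a row of \<open>A\<close> or, up to sign, a column of
  \<open>A\<close>; both norms are bounded.\<close>

lemma row_B:
  assumes "i < m"
  shows "(\<Sum>j<m. (B i j)\<^sup>2) \<le> a_max\<^sup>2"
  using assms
proof (cases rule: index_cases)
  case 1
  then show ?thesis
    using norm_sq[OF rows[OF 1]] A unfolding m_def sum_block by (simp add: B_simps)
next
  case (2 l)
  then show ?thesis
    using norm_sq[OF cols[OF 2(1)]] A unfolding m_def sum_block by (simp add: B_simps)
qed

definition \<beta> :: real where "\<beta> = sig_max\<^sup>2 / real n"

lemma v_le: "p \<in> P \<Longrightarrow> v p \<le> \<beta>"
proof -
  assume "p \<in> P"
  then obtain i l where p: "p = (i, N + l)" "i < N" "l < n" by (auto simp: P_def)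
  have "\<bar>sig i l\<bar>\<^sup>2 \<le> sig_max\<^sup>2" using sig_le[OF p(2,3)] by (intro power_mono) auto
  then show "v p \<le> \<beta>" using p by (simp add: v_def \<beta>_def divide_right_mono)
qed

lemma S_nonneg: "0 \<le> S i j"
  by (auto simp: pair_mat_def v_def)

lemma S_row_le: "(\<Sum>j<m. S i j) \<le> real m * \<beta>"
proof -
  have "S i j \<le> \<beta>" for j using v_le by (auto simp: pair_mat_def \<beta>_def)
  then have "(\<Sum>j<m. S i j) \<le> (\<Sum>j<m. \<beta>)" by (intro sum_mono)
  then show ?thesis by simp
qed

text \<open>\<open>\<kappa>\<close> is kept free: the sublocale below takes the exact value
  \<open>m * \<beta>\<close>, while the limit needs a bound that does not depend on n.\<close>

lemma dyson: "real m * \<beta> \<le> \<kappa> \<Longrightarrow> dyson_family m B S \<kappa> (a_max\<^sup>2) t"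
proof
  assume \<kappa>: "real m * \<beta> \<le> \<kappa>"
  show "B i j = - B j i" for i j by (rule B_skew)
  show "i < m \<Longrightarrow> (\<Sum>j<m. (B i j)\<^sup>2) \<le> a_max\<^sup>2" for i by (rule row_B)
  show "0 \<le> S i j" for i j by (rule S_nonneg)
  show "S i j = S j i" for i j by (rule pair_mat_sym[OF P_sub])
  show "(\<Sum>j<m. S i j) \<le> \<kappa>" for i using S_row_le[of i] \<kappa> by linarith
  show "0 < r \<Longrightarrow> i < m \<Longrightarrow> 0 \<le> t r i" for r i by (rule t_nonneg)
  show "(\<lambda>r. \<Sum>j<m. S i j * t r j) differentiable (at r)" if "0 < r" "i < m" for r i
    using q_differentiable[OF that] by (simp only: q_def)
  show "t r i = finv m (add_diag (const_diag r B) (\<lambda>i. \<Sum>j<m. S i j * t r j)) i i" if r: "0 < r" "i < m" for r i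
  proof -
    have "finv m (hs (r\<^sup>2)) = finv m (add_diag (const_diag r B) (\<lambda>i. \<Sum>j<m. S i j * t r j))"
    proof (rule finv_cong)
      fix i j assume "i < m" "j < m"
      then show "hs (r\<^sup>2) i j = add_diag (const_diag r B) (\<lambda>i. \<Sum>j<m. S i j * t r j) i j"
        using hs_eq[OF r(1), of i] by (cases "i = j") (auto simp: hs_off add_diag_def const_diag_def q_def)
    qed
    then show ?thesis by (simp add: t_def)
  qed
qed

end

section \<open>The integral over the negative axis and its closed form\<close>

context deterministic_equivalent
begin

sublocale D: dyson_family m B S "real m * \<beta>" "a_max\<^sup>2" t
  by (rule dyson) simp

lemma q_eq: "D.q r i = q r i"
  by (simp add: D.q_def q_def)

lemma hs_hh: "0 < r \<Longrightarrow> i < m \<Longrightarrow> j < m \<Longrightarrow> hs (r\<^sup>2) i j = D.hh r i j"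
  using hs_eq[of r i] by (cases "i = j") (auto simp: D.hh_diag D.hh_offdiag q_eq hs_off)

lemma tq_upper: "(\<Sum>k<N. t r k * q r k) = (\<Sum>i<N. \<Sum>j<n. (sig i j)\<^sup>2 / real n * (t r i * t r (N + j)))"
proof (rule sum.cong[OF refl])
  fix i assume "i \<in> {..<N}"
  then have i: "i < N" by simp
  show "t r i * q r i = (\<Sum>j<n. (sig i j)\<^sup>2 / real n * (t r i * t r (N + j)))"
    unfolding q_def S_row_upper[OF i] by (simp add: sum_distrib_left mult_ac)
qed

lemma tq_lower: "(\<Sum>l<n. t r (N + l) * q r (N + l)) = (\<Sum>i<N. \<Sum>j<n. (sig i j)\<^sup>2 / real n * (t r i * t r (N + j)))"
proof -
  have "(\<Sum>l<n. t r (N + l) * q r (N + l)) = (\<Sum>l<n. \<Sum>i<N. (sig i l)\<^sup>2 / real n * (t r i * t r (N + l)))"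
  proof (rule sum.cong[OF refl])
    fix l assume "l \<in> {..<n}"
    then have l: "l < n" by simp
    show "t r (N + l) * q r (N + l) = (\<Sum>i<N. (sig i l)\<^sup>2 / real n * (t r i * t r (N + l)))"
      unfolding q_def S_row_lower[OF l] by (simp add: sum_distrib_left mult_ac)
  qed
  also have "\<dots> = (\<Sum>i<N. \<Sum>j<n. (sig i j)\<^sup>2 / real n * (t r i * t r (N + j)))" by (rule sum.swap)
  finally show ?thesis .
qed

text \<open>The derivative of \<open>D.\<Lambda>\<close> is the trace over all \<open>m\<close>
  indices, whereas the integrand of \<open>Cbar\<close> has only the first \<open>N\<close>. In
  \<open>trace_balance\<close> the terms \<open>t * q\<close> of the two blocks are the same double
  sum and cancel, which leaves a relation between the two partial traces.\<close>

lemma trace_blocks: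
  assumes r: "0 < r"
  shows "(\<Sum>i<m. t r i) = 2 * (\<Sum>k<N. t r k) - (real N - real n) / r"
proof -
  have "0 < r\<^sup>2" using r by simp
  then obtain c where c: "0 < c" "skew_diag (N + n) c (hs (r\<^sup>2))" using hs_skew by blast
  have "(\<Sum>k<N. hs (r\<^sup>2) k k * t r k - 1) = (\<Sum>l<n. hs (r\<^sup>2) (N + l) (N + l) * t r (N + l) - 1)"
    unfolding t_def m_def by (rule trace_balance[OF c(2,1)]) (rule hs_off)
  moreover have "(\<Sum>k<N. hs (r\<^sup>2) k k * t r k - 1) = r * (\<Sum>k<N. t r k) + (\<Sum>k<N. t r k * q r k) - real N"
  proof -
    have "(\<Sum>k<N. hs (r\<^sup>2) k k * t r k - 1) = (\<Sum>k<N. r * t r k + t r k * q r k - 1)"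
      by (intro sum.cong refl) (simp add: hs_eq_upper[OF r], simp add: algebra_simps)
    then show ?thesis by (simp only: sum_subtractf sum.distrib sum_distrib_left) simp
  qed
  moreover have "(\<Sum>l<n. hs (r\<^sup>2) (N + l) (N + l) * t r (N + l) - 1)
      = r * (\<Sum>l<n. t r (N + l)) + (\<Sum>l<n. t r (N + l) * q r (N + l)) - real n"
  proof -
    have "(\<Sum>l<n. hs (r\<^sup>2) (N + l) (N + l) * t r (N + l) - 1) = (\<Sum>l<n. r * t r (N + l) + t r (N + l) * q r (N + l) - 1)"
      by (intro sum.cong refl) (simp add: hs_eq_lower[OF r], simp add: algebra_simps)
    then show ?thesis by (simp only: sum_subtractf sum.distrib sum_distrib_left) simp
  qed
  ultimately have "r * (\<Sum>l<n. t r (N + l)) = r * (\<Sum>k<N. t r k) - (real N - real n)"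
    unfolding tq_upper tq_lower by linarith
  then have "(\<Sum>l<n. t r (N + l)) = (\<Sum>k<N. t r k) - (real N - real n) / r"
    using r by (simp add: field_simps)
  then show ?thesis unfolding m_def sum_block by simp
qed

text \<open>The antiderivative of \<open>- u\<close> that vanishes at infinity; the logarithm
  removes the leading growth of \<open>D.\<Lambda>\<close>.\<close>

definition V :: "real \<Rightarrow> real" where
  "V w = (D.\<Lambda> (sqrt w) - real m / 2 * ln w) / real N"

definition u :: "real \<Rightarrow> real" where
  "u w = 1 / w - 1 / real N * (\<Sum>k<N. t (sqrt w) k / sqrt w)"

lemma V_deriv:
  assumes w: "0 < w"
  shows "(V has_real_derivative - u w) (at w)"
proof -
  define r where "r = sqrt w"
  have r: "0 < r" "w = r * r" using w by (auto simp: r_def)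
  have "((\<lambda>w. D.\<Lambda> (sqrt w)) has_real_derivative (\<Sum>i<m. t r i) * (inverse (sqrt w) / 2)) (at w)"
  proof (rule DERIV_chain2[where f = D.\<Lambda> and g = sqrt])
    show "(D.\<Lambda> has_real_derivative (\<Sum>i<m. t r i)) (at (sqrt w))"
      unfolding r_def[symmetric] by (rule D.\<Lambda>_deriv[OF r(1)])
    show "(sqrt has_real_derivative inverse (sqrt w) / 2) (at w)" by (rule DERIV_real_sqrt[OF w])
  qed
  then have "(V has_real_derivative ((\<Sum>i<m. t r i) * (inverse (sqrt w) / 2) - real m / 2 * (1 / w)) / real N) (at w)"
    unfolding V_def[abs_def] by (rule DERIV_cdivide[OF DERIV_diff[OF _ DERIV_cmult[OF DERIV_ln_divide[OF w]]]])
  moreover have "((\<Sum>i<m. t r i) * (inverse (sqrt w) / 2) - real m / 2 * (1 / w)) / real N = - u w"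
  proof -
    define a where "a = (\<Sum>k<N. t r k)"
    have "u w = 1 / (r * r) - 1 / real N * (a / r)"
      unfolding u_def r_def[symmetric] a_def by (simp add: sum_divide_distrib r(2))
    moreover have "((\<Sum>i<m. t r i) * (inverse (sqrt w) / 2) - real m / 2 * (1 / w)) / real N
        = ((2 * a - (real N - real n) / r) * (inverse r / 2) - (real N + real n) / 2 * (1 / (r * r))) / real N"
      unfolding trace_blocks[OF r(1)] a_def[symmetric] r_def[symmetric] using r(2) by (simp add: m_def)
    moreover have "((2 * a - (real N - real n) / r) * (inverse r / 2) - (real N + real n) / 2 * (1 / (r * r))) / real N
        = - (1 / (r * r) - 1 / real N * (a / r))"
    proof -
      define i where "i = inverse r"
      have "(2 * a - (real N - real n) * i) * (i / 2) - (real N + real n) / 2 * (i * i) = a * i - real N * (i * i)"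
        by (simp add: field_simps)
      moreover have "(a * i - real N * (i * i)) / real N = - (i * i - 1 / real N * (a * i))"
        using N by (simp add: diff_divide_distrib)
      moreover have "1 / (r * r) = i * i" by (simp add: i_def divide_inverse)
      ultimately show ?thesis by (simp add: i_def[symmetric] divide_inverse[of _ r])
    qed
    ultimately show ?thesis by (simp only:)
  qed
  ultimately show ?thesis by (simp only:)
qed

lemma V_bounds:
  assumes w: "0 < w"
  shows "V w = (D.\<Lambda> (sqrt w) - real m * ln (sqrt w)) / real N"
    and "0 \<le> V w" "V w \<le> real m * (a_max\<^sup>2 + real m * \<beta>) / (2 * real N) / w"
proof -
  show e: "V w = (D.\<Lambda> (sqrt w) - real m * ln (sqrt w)) / real N"
    using w by (simp add: V_def ln_sqrt)
  have r: "0 < sqrt w" using w by simp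
  show "0 \<le> V w" unfolding e using D.\<Lambda>_bounds(1)[OF r] by (intro divide_nonneg_nonneg) auto
  have "V w \<le> real m * (a_max\<^sup>2 + real m * \<beta>) / (2 * (sqrt w)\<^sup>2) / real N"
    unfolding e using D.\<Lambda>_bounds(2)[OF r] by (intro divide_right_mono) auto
  also have "\<dots> = real m * (a_max\<^sup>2 + real m * \<beta>) / (2 * real N) / w" using w by simp
  finally show "V w \<le> real m * (a_max\<^sup>2 + real m * \<beta>) / (2 * real N) / w" .
qed

lemma V_tendsto: "(V \<longlongrightarrow> 0) at_top"
proof (rule Lim_null_comparison)
  show "eventually (\<lambda>w. norm (V w) \<le> real m * (a_max\<^sup>2 + real m * \<beta>) / (2 * real N) / w) at_top"
    by (rule eventually_mono[OF eventually_gt_at_top[of 0]]) (use V_bounds(2,3) in auto)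
  show "((\<lambda>w. real m * (a_max\<^sup>2 + real m * \<beta>) / (2 * real N) / w) \<longlongrightarrow> 0) at_top"
    by (rule real_tendsto_divide_at_top[OF tendsto_const filterlim_ident])
qed

lemma u_nonneg:
  assumes w: "0 < w"
  shows "0 \<le> u w"
proof -
  define r where "r = sqrt w"
  have r: "0 < r" "w = r * r" using w by (auto simp: r_def)
  have "(\<Sum>k<N. t r k / r) \<le> (\<Sum>k<N. (1 / r) / r)"
    using D.t_le[OF r(1)] r(1) by (intro sum_mono divide_right_mono) (auto simp: m_def)
  then have "1 / real N * (\<Sum>k<N. t r k / r) \<le> 1 / real N * (real N * (1 / r / r))"
    by (intro mult_left_mono) auto
  also have "\<dots> = 1 / w" using N r by simp
  finally show ?thesis by (simp add: u_def r_def)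
qed

text \<open>Supplies the measurability of the integrand; it rests on the continuity of
  \<open>t\<close>.\<close>

lemma u_continuous:
  assumes s: "0 < s"
  shows "continuous_on {s..} u"
proof -
  have t: "continuous_on {s..} (\<lambda>w. t (sqrt w) k)" if "k < N" for k
  proof (rule continuous_at_imp_continuous_on, rule ballI)
    fix w assume "w \<in> {s..}"
    then have w: "0 < sqrt w" using s by simp
    have "isCont (\<lambda>r. t r k) (sqrt w)"
      unfolding isCont_def using D.t_tendsto[OF w, of k] that by (simp add: m_def)
    then show "isCont (\<lambda>w. t (sqrt w) k) w"
      by (rule isCont_o2[rotated]) (rule isCont_real_sqrt)
  qed
  show ?thesis
    unfolding u_def[abs_def] using s
    by (intro continuous_on_diff continuous_on_divide continuous_on_mult continuous_on_sum t
        continuous_on_const continuous_on_id continuous_on_real_sqrt) auto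
qed

lemma integrand_eq:
  assumes w: "0 < w"
  shows "Cbar_integrand N n A psi psit w = complex_of_real (u w)"
proof -
  have "mat_tr (T_mat N n A psi psit (- complex_of_real w)) = (\<Sum>k<N. complex_of_real (t (sqrt w) k / sqrt w))"
    unfolding mat_tr_def T_mat_eq[OF w] using w by (intro sum.cong) (auto simp: t_def)
  then show ?thesis by (simp add: Cbar_integrand_def u_def)
qed

text \<open>The integrand is nonnegative and \<open>- V\<close> is an antiderivative with limit
  \<open>0\<close>, so the fundamental theorem for nonnegative functions on a half-line yields
  integrability and the value together.\<close>

lemma Cbar_eq:
  assumes s: "0 < s"
  shows "set_integrable lborel {s..} (Cbar_integrand N n A psi psit)"
    and "Cbar N n A psi psit s = complex_of_real (V s)"
proof -
  define f where "f = (\<lambda>w. indicator {s..} w *\<^sub>R u w)"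
  have f_meas: "f \<in> borel_measurable borel"
    unfolding f_def by (rule borel_measurable_continuous_on_indicator[OF _ u_continuous[OF s]]) auto
  have "(\<integral>\<^sup>+ w. ennreal (f w) * indicator {s..} w \<partial>lborel) = ennreal (0 - (- V s))"
  proof (rule nn_integral_FTC_atLeast[OF f_meas])
    fix w assume "s \<le> w"
    then show "((\<lambda>w. - V w) has_real_derivative f w) (at w)" "0 \<le> f w"
      using DERIV_minus[OF V_deriv[of w]] u_nonneg[of w] s by (auto simp: f_def)
  next
    show "((\<lambda>w. - V w) \<longlongrightarrow> 0) at_top" using tendsto_minus[OF V_tendsto] by simp
  qed
  moreover have "ennreal (f w) * indicator {s..} w = ennreal (f w)" for w
    by (auto simp: f_def indicator_def)
  ultimately have "(\<integral>\<^sup>+ w. ennreal (f w) \<partial>lborel) = ennreal (V s)" by simp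
  then have hb: "has_bochner_integral lborel f (V s)"
    using f_meas u_nonneg s V_bounds(2)[OF s]
    by (intro has_bochner_integral_nn_integral) (auto simp: f_def indicator_def)
  have "has_bochner_integral lborel (\<lambda>w. complex_of_real (f w)) (complex_of_real (V s))"
    by (rule has_bochner_integral_of_real[OF hb])
  moreover have "(\<lambda>w. complex_of_real (f w)) = (\<lambda>w. indicator {s..} w *\<^sub>R Cbar_integrand N n A psi psit w)"
    using integrand_eq s by (auto simp: f_def indicator_def)
  ultimately have *: "has_bochner_integral lborel (\<lambda>w. indicator {s..} w *\<^sub>R Cbar_integrand N n A psi psit w) (complex_of_real (V s))"
    by simp
  show "set_integrable lborel {s..} (Cbar_integrand N n A psi psit)"
    unfolding set_integrable_def using * by (simp add: has_bochner_integral_iff)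
  show "Cbar N n A psi psit s = complex_of_real (V s)"
    unfolding Cbar_def set_lebesgue_integral_def using * by (simp add: has_bochner_integral_iff)
qed

text \<open>The Schur determinant splits \<open>fdet m (hs s)\<close> into the two determinants of
  the formula, whose factors \<open>(1 / r) ^ N\<close> and \<open>(1 / r) ^ n\<close> absorb the
  term \<open>m ln r\<close> of \<open>V\<close>. The double sum, with its prefactor, is half the
  quadratic form of \<open>t\<close>, in which every pair is counted twice.\<close>

lemma Cbar_formula:
  assumes s: "0 < s"
  defines "z \<equiv> - complex_of_real s"
  shows "Cbar N n A psi psit s =
      1 / of_nat N * ln (Determinant.det ((1 / complex_of_real s) \<cdot>\<^sub>m mat_inv (mat_diag N (\<lambda>i. psi i z))
          + cmat A * mat_diag n (\<lambda>j. psit j z) * transpose_mat (cmat A)))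
    + 1 / of_nat N * ln (Determinant.det ((1 / complex_of_real s) \<cdot>\<^sub>m mat_inv (mat_diag n (\<lambda>j. psit j z))))
    - complex_of_real s / (of_nat n * of_nat N) *
        (\<Sum>i<N. \<Sum>j<n. complex_of_real ((sig i j)\<^sup>2) * T_mat N n A psi psit z $$ (i, i) * Tt_mat N n A psi psit z $$ (j, j))"
proof -
  define r where "r = sqrt s"
  have r: "0 < r" "s = r\<^sup>2" "sqrt s = r" using s by (auto simp: r_def)
  obtain c where c: "0 < c" "skew_diag (N + n) c (hs s)" using hs_skew[OF s] .
  define E where "E = (\<lambda>i k. (if i = k then hs s i i else 0) + (\<Sum>l<n. A $$ (i, l) * (1 / hs s (N + l) (N + l)) * A $$ (k, l)))"
  define p where "p = (\<Prod>l<n. hs s (N + l) (N + l))"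
  have det: "fdet m (hs s) = fdet N E * p"
    unfolding m_def E_def p_def by (rule schur_det[OF c(2,1)]) (rule hs_off)
  have det_pos: "0 < fdet m (hs s)" unfolding m_def by (rule skew_diag_det_pos[OF c(2,1)])
  have p_pos: "0 < p" unfolding p_def using hs_pos[OF s] by (intro prod_pos) (auto simp: m_def)
  have E_pos: "0 < fdet N E" using det det_pos p_pos by (simp add: zero_less_mult_iff)
  have 1: "(1 / complex_of_real s) \<cdot>\<^sub>m mat_inv (mat_diag N (\<lambda>i. psi i z))
      + cmat A * mat_diag n (\<lambda>j. psit j z) * transpose_mat (cmat A)
    = map_mat complex_of_real (fmat N (\<lambda>i k. 1 / r * E i k))" (is "?l = ?r")
  proof (rule eq_matI)
    fix i k assume "i < dim_row ?r" "k < dim_col ?r"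
    then have ik: "i < N" "k < N" by auto
    have "?l $$ (i, k) = (1 / complex_of_real s) * (if i = k then 1 / psi i z else 0)
      + (cmat A * mat_diag n (\<lambda>j. psit j z) * transpose_mat (cmat A)) $$ (i, k)"
      unfolding z_def mat_inv_Psi[OF s] using ik cmat_A by (auto simp: mat_diag_def simp del: index_mult_mat(1))
    also have "\<dots> = complex_of_real ((1 / s) * (if i = k then 1 / x s i else 0)
      + 1 / r * (\<Sum>l<n. A $$ (i, l) * (1 / hs s (N + l) (N + l)) * A $$ (k, l)))"
      unfolding z_def APsiA_entry[OF s ik] r(3) using psi_x(1)[OF s ik(1)] by auto
    also have "(1 / s) * (if i = k then 1 / x s i else 0) = 1 / r * (if i = k then hs s i i else 0)"
      using ik r(1) by (simp add: hs_diag r(3)) (simp add: r(2) power2_eq_square)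
    also have "1 / r * (if i = k then hs s i i else 0) + 1 / r * (\<Sum>l<n. A $$ (i, l) * (1 / hs s (N + l) (N + l)) * A $$ (k, l))
      = 1 / r * E i k" unfolding E_def by (simp only: distrib_left)
    finally show "?l $$ (i, k) = ?r $$ (i, k)" using ik by simp
  qed (use cmat_A in \<open>auto simp: z_def mat_inv_Psi[OF s]\<close>)
  have d1: "Determinant.det ?l = complex_of_real ((1 / r) ^ N * fdet N E)"
    unfolding 1 of_real_hom.hom_det by (simp only: fdet_scale[symmetric]) (simp only: fdet_def)
  have 2: "(1 / complex_of_real s) \<cdot>\<^sub>m mat_inv (mat_diag n (\<lambda>j. psit j z))
    = mat_diag n (\<lambda>l. complex_of_real (1 / r * hs s (N + l) (N + l)))" (is "?l2 = _")
  proof (rule eq_matI)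
    fix i k assume "i < dim_row (mat_diag n (\<lambda>l. complex_of_real (1 / r * hs s (N + l) (N + l))))"
      "k < dim_col (mat_diag n (\<lambda>l. complex_of_real (1 / r * hs s (N + l) (N + l))))"
    then have ik: "i < n" "k < n" by (auto simp: mat_diag_def)
    show "?l2 $$ (i, k) = mat_diag n (\<lambda>l. complex_of_real (1 / r * hs s (N + l) (N + l))) $$ (i, k)"
      unfolding z_def mat_inv_Psi[OF s] using ik psi_x(2)[OF s ik(2)] r(1)
      by (auto simp: mat_diag_def hs_diag r(3)) (simp add: r(2) power2_eq_square)
  qed (simp_all add: z_def mat_inv_Psi[OF s] carrier_matD[OF mat_diag_dim])
  have d2: "Determinant.det ?l2 = complex_of_real ((1 / r) ^ n * p)"
    unfolding 2 det_mat_diag p_def by (simp add: prod_dividef power_divide)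
  \<comment> \<open>Both determinants are positive reals, so the principal branch of the complex
    logarithm is the real one.\<close>
  have ln1: "ln (Determinant.det ?l) = complex_of_real (ln (fdet N E) - real N * ln r)"
    unfolding d1 using E_pos r(1) by (subst Ln_of_real) (auto simp: ln_mult ln_realpow ln_div power_divide)
  have ln2: "ln (Determinant.det ?l2) = complex_of_real (ln p - real n * ln r)"
    unfolding d2 using p_pos r(1) by (subst Ln_of_real) (auto simp: ln_mult ln_realpow ln_div power_divide)
  define W where "W = (\<Sum>i<N. \<Sum>j<n. (sig i j)\<^sup>2 / real n * (t r i * t r (N + j)))"
  have sum3: "(\<Sum>i<N. \<Sum>j<n. complex_of_real ((sig i j)\<^sup>2) * T_mat N n A psi psit z $$ (i, i) * Tt_mat N n A psi psit z $$ (j, j))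
    = complex_of_real (real n / s * W)"
  proof -
    have "(\<Sum>i<N. \<Sum>j<n. complex_of_real ((sig i j)\<^sup>2) * T_mat N n A psi psit z $$ (i, i) * Tt_mat N n A psi psit z $$ (j, j))
      = (\<Sum>i<N. \<Sum>j<n. complex_of_real ((sig i j)\<^sup>2 * (t r i / r) * (t r (N + j) / r)))"
    proof (intro sum.cong refl)
      fix i j assume "i \<in> {..<N}" "j \<in> {..<n}"
      then have "T_mat N n A psi psit z $$ (i, i) = complex_of_real (t r i / r)"
        "Tt_mat N n A psi psit z $$ (j, j) = complex_of_real (t r (N + j) / r)"
        unfolding z_def r(2) by (simp_all only: T_diag[OF r(1)] Tt_diag[OF r(1)] lessThan_iff)
      then show "complex_of_real ((sig i j)\<^sup>2) * T_mat N n A psi psit z $$ (i, i) * Tt_mat N n A psi psit z $$ (j, j)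
        = complex_of_real ((sig i j)\<^sup>2 * (t r i / r) * (t r (N + j) / r))" by simp
    qed
    also have "\<dots> = complex_of_real (\<Sum>i<N. \<Sum>j<n. (sig i j)\<^sup>2 * (t r i / r) * (t r (N + j) / r))" by simp
    also have "(\<Sum>i<N. \<Sum>j<n. (sig i j)\<^sup>2 * (t r i / r) * (t r (N + j) / r)) = real n / s * W"
      unfolding W_def sum_distrib_left using n r(1)
      by (intro sum.cong refl) (simp add: r(2) power2_eq_square)
    finally show ?thesis .
  qed
  have "(\<Sum>i<m. t r i * D.q r i) = 2 * W"
  proof -
    have "(\<Sum>i<m. t r i * D.q r i) = (\<Sum>i<N. t r i * q r i) + (\<Sum>l<n. t r (N + l) * q r (N + l))"
      unfolding q_eq by (simp only: m_def sum_block)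
    then show ?thesis unfolding tq_upper tq_lower W_def by simp
  qed
  moreover have "fdet m (D.hh r) = fdet m (hs s)"
    unfolding r(2) by (rule fdet_cong) (rule hs_hh[OF r(1), symmetric])
  ultimately have "D.\<Lambda> r = ln (fdet N E * p) - W" by (simp add: D.\<Lambda>_def det)
  then have "V s = (ln (fdet N E) + ln p - W - real m * ln r) / real N"
    using V_bounds(1)[OF s] E_pos p_pos by (simp add: r(3) ln_mult)
  also have "\<dots> = 1 / real N * (ln (fdet N E) - real N * ln r) + 1 / real N * (ln p - real n * ln r)
      - s / (real n * real N) * (real n / s * W)"
  proof -
    have "s / (real n * real N) * (real n / s * W) = W / real N" using n s by simp
    moreover have "(real N * ln r) / real N = ln r" using N by simp
    ultimately show ?thesis
      by (simp add: m_def add_divide_distrib diff_divide_distrib distrib_right)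
  qed
  finally have "complex_of_real (V s) = 1 / of_nat N * complex_of_real (ln (fdet N E) - real N * ln r)
      + 1 / of_nat N * complex_of_real (ln p - real n * ln r)
      - complex_of_real s / (of_nat n * of_nat N) * complex_of_real (real n / s * W)"
    by (simp only: of_real_add of_real_diff of_real_mult of_real_divide of_real_1 of_real_of_nat_eq)
  then show ?thesis unfolding Cbar_eq(2)[OF s] ln1 ln2 sum3 .
qed

end

subsection \<open>The capacity\<close>

locale capacity_model = deterministic_equivalent N n A sig psi psit sig_max a_max + prob_space M
  for N n A sig psi psit sig_max a_max and M :: "'w measure" +
  fixes X :: "nat \<Rightarrow> nat \<Rightarrow> 'w \<Rightarrow> real" and c1 c3 :: real
  assumes indep: "indep_vars (\<lambda>_. borel) (\<lambda>p. X (fst p) (snd p - N)) P"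
    and X1: "\<And>i j. i < N \<Longrightarrow> j < n \<Longrightarrow> integrable M (X i j)"
    and X2: "\<And>i j. i < N \<Longrightarrow> j < n \<Longrightarrow> integrable M (\<lambda>\<omega>. (X i j \<omega>)\<^sup>2)"
    and X3: "\<And>i j. i < N \<Longrightarrow> j < n \<Longrightarrow> integrable M (\<lambda>\<omega>. \<bar>X i j \<omega>\<bar> ^ 3)"
    and X_mean: "\<And>i j. i < N \<Longrightarrow> j < n \<Longrightarrow> (\<integral>\<omega>. X i j \<omega> \<partial>M) = 0"
    and X_var: "\<And>i j. i < N \<Longrightarrow> j < n \<Longrightarrow> (\<integral>\<omega>. (X i j \<omega>)\<^sup>2 \<partial>M) = 1"
    and X_abs: "\<And>i j. i < N \<Longrightarrow> j < n \<Longrightarrow> (\<integral>\<omega>. \<bar>X i j \<omega>\<bar> \<partial>M) \<le> c1"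
    and X_third: "\<And>i j. i < N \<Longrightarrow> j < n \<Longrightarrow> (\<integral>\<omega>. \<bar>X i j \<omega>\<bar> ^ 3 \<partial>M) \<le> c3"
begin

definition Y :: "nat \<times> nat \<Rightarrow> 'w \<Rightarrow> real" where
  "Y p \<omega> = sig (fst p) (snd p - N) / sqrt (real n) * X (fst p) (snd p - N) \<omega>"

text \<open>Outside \<open>P\<close> a point mass is put in, because \<open>real_noise\<close> asks
  for a distribution at every index.\<close>

definition \<mu> :: "nat \<times> nat \<Rightarrow> real measure" where
  "\<mu> p = (if p \<in> P then distr M borel (Y p) else return borel 0)"

text \<open>The factor \<open>c1 + c3\<close> lets one constant bound both the third moments and the
  products of a variance and a first moment.\<close>

definition \<gamma> :: real where
  "\<gamma> = sig_max ^ 3 * (c1 + c3) / (real n * sqrt (real n))"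

lemma P_index: "p \<in> P \<Longrightarrow> fst p < N" "p \<in> P \<Longrightarrow> snd p - N < n"
  by (auto simp: P_def)

lemma X_meas: "i < N \<Longrightarrow> j < n \<Longrightarrow> X i j \<in> borel_measurable M"
  using X1 by blast

lemma Y_meas: "p \<in> P \<Longrightarrow> Y p \<in> borel_measurable M"
  unfolding Y_def[abs_def] using X_meas[OF P_index] by measurable

lemma Y_indep: "indep_vars (\<lambda>_. borel) Y P"
  unfolding Y_def[abs_def]
  by (rule indep_vars_compose2[OF indep, where Y = "\<lambda>p u. sig (fst p) (snd p - N) / sqrt (real n) * u"]) measurable

lemma \<mu>_noise: "real_distribution (\<mu> p)"
proof (cases "p \<in> P")
  case True
  then show ?thesis using Y_meas by (simp add: \<mu>_def real_distribution_distr)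
next
  case False
  interpret R: prob_space "return borel (0::real)" by (rule prob_space_return) simp
  show ?thesis using False by (simp add: \<mu>_def real_distribution_def real_distribution_axioms_def R.prob_space_axioms)
qed

lemma sig_max_nonneg: "0 \<le> sig_max"
proof -
  have "0 < N" "0 < n" using N n by auto
  then have "\<bar>sig 0 0\<bar> \<le> sig_max" by (rule sig_le)
  then show ?thesis by linarith
qed

lemma c_nonneg: "0 \<le> c1" "0 \<le> c3"
proof -
  have "0 < N" "0 < n" using N n by auto
  have "0 \<le> (\<integral>\<omega>. \<bar>X 0 0 \<omega>\<bar> \<partial>M)" "0 \<le> (\<integral>\<omega>. \<bar>X 0 0 \<omega>\<bar> ^ 3 \<partial>M)" by (intro integral_nonneg_AE, simp)+
  then show "0 \<le> c1" "0 \<le> c3"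
    using X_abs[OF \<open>0 < N\<close> \<open>0 < n\<close>] X_third[OF \<open>0 < N\<close> \<open>0 < n\<close>] by linarith+
qed

lemma scale_bound:
  assumes p: "p \<in> P"
  shows "\<bar>sig (fst p) (snd p - N) / sqrt (real n)\<bar> ^ 3 \<le> sig_max ^ 3 / (real n * sqrt (real n))"
proof -
  have "\<bar>sig (fst p) (snd p - N) / sqrt (real n)\<bar> ^ 3 = \<bar>sig (fst p) (snd p - N)\<bar> ^ 3 / (real n * sqrt (real n))"
    by (simp add: abs_divide power_divide power3_eq_cube)
  also have "\<dots> \<le> sig_max ^ 3 / (real n * sqrt (real n))"
    using sig_le[OF P_index[OF p]] by (intro divide_right_mono power_mono) auto
  finally show ?thesis .
qed

lemma \<mu>_integrable:
  fixes f :: "real \<Rightarrow> real"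
  assumes "p \<in> P" "f \<in> borel_measurable borel"
  shows "integrable (\<mu> p) f \<longleftrightarrow> integrable M (\<lambda>\<omega>. f (Y p \<omega>))"
    and "(\<integral>u. f u \<partial>\<mu> p) = (\<integral>\<omega>. f (Y p \<omega>) \<partial>M)"
  using assms Y_meas by (simp_all add: \<mu>_def integrable_distr_eq integral_distr)

lemma random_family:
  assumes \<kappa>: "real m * \<beta> \<le> \<kappa>"
  shows "random_family \<mu> m P B \<beta> \<gamma> \<kappa> (a_max\<^sup>2) v"
proof (intro random_family.intro real_noise.intro random_family_axioms.intro)
  fix p assume p: "p \<in> P"
  define s where "s = sig (fst p) (snd p - N) / sqrt (real n)"
  note ij = P_index[OF p]
  have Ys: "Y p \<omega> = s * X (fst p) (snd p - N) \<omega>" for \<omega> by (simp add: Y_def s_def)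
  have s2: "s\<^sup>2 = v p" by (simp add: s_def v_def power_divide)
  have s3: "\<bar>s\<bar> ^ 3 \<le> sig_max ^ 3 / (real n * sqrt (real n))" unfolding s_def by (rule scale_bound[OF p])
  have b0: "0 \<le> sig_max ^ 3 / (real n * sqrt (real n))" using sig_max_nonneg by simp
  show "integrable (\<mu> p) (\<lambda>u. u)" using X1[OF ij] by (simp add: \<mu>_integrable[OF p] Ys)
  show "integrable (\<mu> p) (\<lambda>u. u\<^sup>2)" using X2[OF ij] by (simp add: \<mu>_integrable[OF p] Ys power_mult_distrib)
  show "integrable (\<mu> p) (\<lambda>u. \<bar>u\<bar> ^ 3)" using X3[OF ij] by (simp add: \<mu>_integrable[OF p] Ys abs_mult power_mult_distrib)
  show "(\<integral>u. u \<partial>\<mu> p) = 0" using X_mean[OF ij] by (simp add: \<mu>_integrable[OF p] Ys)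
  show "(\<integral>u. u\<^sup>2 \<partial>\<mu> p) = v p" using X_var[OF ij] s2 by (simp add: \<mu>_integrable[OF p] Ys power_mult_distrib)
  show "v p \<le> \<beta>" by (rule v_le[OF p])
  have "(\<integral>u. \<bar>u\<bar> ^ 3 \<partial>\<mu> p) = \<bar>s\<bar> ^ 3 * (\<integral>\<omega>. \<bar>X (fst p) (snd p - N) \<omega>\<bar> ^ 3 \<partial>M)"
    by (simp add: \<mu>_integrable[OF p] Ys abs_mult power_mult_distrib)
  also have "\<dots> \<le> sig_max ^ 3 / (real n * sqrt (real n)) * (c1 + c3)"
    using s3 b0 X_third[OF ij] c_nonneg by (intro mult_mono) auto
  finally show "(\<integral>u. \<bar>u\<bar> ^ 3 \<partial>\<mu> p) \<le> \<gamma>" by (simp add: \<gamma>_def)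
  have "v p * (\<integral>u. \<bar>u\<bar> \<partial>\<mu> p) = (s\<^sup>2 * \<bar>s\<bar>) * (\<integral>\<omega>. \<bar>X (fst p) (snd p - N) \<omega>\<bar> \<partial>M)"
    by (simp add: \<mu>_integrable[OF p] Ys abs_mult s2)
  also have "s\<^sup>2 * \<bar>s\<bar> = \<bar>s\<bar> ^ 3" by (simp add: power3_eq_cube power2_eq_square)
  also have "\<bar>s\<bar> ^ 3 * (\<integral>\<omega>. \<bar>X (fst p) (snd p - N) \<omega>\<bar> \<partial>M) \<le> sig_max ^ 3 / (real n * sqrt (real n)) * (c1 + c3)"
    using s3 b0 X_abs[OF ij] c_nonneg by (intro mult_mono) auto
  finally show "v p * (\<integral>u. \<bar>u\<bar> \<partial>\<mu> p) \<le> \<gamma>" by (simp add: \<gamma>_def)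
next
  show "P \<subseteq> {(i, j). i < j \<and> j < m}" by (rule P_sub)
  show "B i j = - B j i" for i j by (rule B_skew)
  show "i < m \<Longrightarrow> (\<Sum>j<m. (B i j)\<^sup>2) \<le> a_max\<^sup>2" for i by (rule row_B)
  show "real_distribution (\<mu> i)" for i by (rule \<mu>_noise)
  show "0 \<le> \<beta>" by (simp add: \<beta>_def)
  show "0 \<le> \<gamma>" using sig_max_nonneg c_nonneg by (simp add: \<gamma>_def)
  show "real m * \<beta> \<le> \<kappa>" by (rule \<kappa>)
qed

sublocale R: random_family \<mu> m P B \<beta> \<gamma> "real m * \<beta>" "a_max\<^sup>2" v
  by (rule random_family) simp

text \<open>Restricted to \<open>P\<close> so that its values lie in the space of the product
  measure, whose points are undefined outside \<open>P\<close>.\<close>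

definition Z :: "'w \<Rightarrow> nat \<times> nat \<Rightarrow> real" where
  "Z \<omega> = (\<lambda>p\<in>P. Y p \<omega>)"

lemma P_nonempty: "P \<noteq> {}"
proof -
  have "(0, N) \<in> P" using N n by (simp add: P_iff)
  then show ?thesis by blast
qed

text \<open>Independence of the entries means that their joint law is the product measure on which
  the estimates were proved.\<close>

lemma Z_distr: "distr M (PiM P (\<lambda>_. borel)) Z = R.PM"
proof -
  have "distr M (PiM P (\<lambda>_. borel)) (\<lambda>\<omega>. \<lambda>p\<in>P. Y p \<omega>) = (\<Pi>\<^sub>M p\<in>P. distr M borel (Y p))"
    using indep_vars_iff_distr_eq_PiM'[OF P_nonempty, where M' = "\<lambda>_. borel" and X = Y] Y_meas Y_indep by simp
  also have "\<dots> = R.PM" by (intro PiM_cong) (auto simp: \<mu>_def)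
  finally show ?thesis by (simp add: Z_def[abs_def])
qed

lemma Z_meas: "Z \<in> measurable M (PiM P (\<lambda>_. borel))"
  unfolding Z_def[abs_def] by (rule measurable_restrict) (rule Y_meas)

lemma log_det_eq:
  assumes s: "0 < s"
  shows "log_det N n A sig X s \<omega> = ln (fdet m (const_diag (sqrt s) (R.Bx (Z \<omega>)))) - real m * ln (sqrt s)"
proof -
  define r where "r = sqrt s"
  have r: "0 < r" "s = r * r" using s by (auto simp: r_def)
  define \<Sigma> where "\<Sigma> = Sigma_mat N n A sig X \<omega>"
  have car: "\<Sigma> \<in> carrier_mat N n" using A by (simp add: \<Sigma>_def Sigma_mat_def)
  \<comment> \<open>The block model is taken with the random matrix in place of \<open>A\<close>;
    its matrix \<open>B\<close> is then \<open>R.Bx (Z \<omega>)\<close> on the first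
    \<open>m\<close> indices.\<close>
  interpret BS: block_model N n \<Sigma> by unfold_locales (rule car)
  have entry: "\<Sigma> $$ (i, l) = A $$ (i, l) + Z \<omega> (i, N + l)" if "i < N" "l < n" for i l
    using that A by (simp add: \<Sigma>_def Sigma_mat_def Z_def Y_def P_iff)
  have BB: "BS.B i j = R.Bx (Z \<omega>) i j" if ij: "i < m" "j < m" for i j
    using ij(1)
  proof (cases rule: index_cases)
    case 1
    show ?thesis using ij(2)
    proof (cases rule: index_cases)
      case (2 l)
      then show ?thesis using 1 by (simp add: R.Bx_def B_simps BS.B_simps entry pair_mat_def P_iff)
    qed (use 1 in \<open>simp add: R.Bx_def B_simps BS.B_simps pair_mat_def P_iff\<close>)
  next
    case (2 l)
    show ?thesis using ij(2)
    proof (cases rule: index_cases)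
      case 1
      then show ?thesis using 2 by (simp add: R.Bx_def B_simps BS.B_simps entry pair_mat_def P_iff)
    qed (use 2 in \<open>simp add: R.Bx_def B_simps BS.B_simps pair_mat_def P_iff\<close>)
  qed
  have sk: "skew_diag (N + n) r (const_diag r BS.B)"
    by (rule skew_diag_const_diag) (rule BS.B_skew)
  define E where "E = (\<lambda>i k. (if i = k then 1 else 0) + 1 / s * (\<Sum>l<n. \<Sigma> $$ (i, l) * \<Sigma> $$ (k, l)))"
  have "fdet m (const_diag r (R.Bx (Z \<omega>))) = fdet (N + n) (const_diag r BS.B)"
    unfolding m_def by (rule fdet_cong) (simp add: const_diag_def BB m_def)
  also have "\<dots> = fdet N (\<lambda>i k. (if i = k then r else 0) + (\<Sum>l<n. \<Sigma> $$ (i, l) * (1 / r) * \<Sigma> $$ (k, l))) * r ^ n"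
  proof -
    have "fdet (N + n) (const_diag r BS.B) = fdet N (\<lambda>i k. (if i = k then const_diag r BS.B i i else 0)
        + (\<Sum>l<n. \<Sigma> $$ (i, l) * (1 / const_diag r BS.B (N + l) (N + l)) * \<Sigma> $$ (k, l)))
      * (\<Prod>l<n. const_diag r BS.B (N + l) (N + l))"
      by (rule BS.schur_det[OF sk r(1)]) (simp add: const_diag_def)
    then show ?thesis unfolding const_diag_diag by simp
  qed
  also have "(\<lambda>i k. (if i = k then r else 0) + (\<Sum>l<n. \<Sigma> $$ (i, l) * (1 / r) * \<Sigma> $$ (k, l))) = (\<lambda>i k. r * E i k)"
    using r(1) unfolding E_def r(2) by (intro ext) (simp add: distrib_left sum_distrib_left sum_divide_distrib)
  also have "fdet N (\<lambda>i k. r * E i k) = r ^ N * fdet N E" by (rule fdet_scale)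
  finally have d: "fdet m (const_diag r (R.Bx (Z \<omega>))) = r ^ m * fdet N E" by (simp add: m_def power_add)
  have "0 < fdet m (const_diag r (R.Bx (Z \<omega>)))"
    by (rule skew_diag_det_pos[OF skew_diag_const_diag[OF R.Bx_offdiag] r(1)])
  then have E0: "0 < fdet N E" unfolding d using r(1) by (simp add: zero_less_mult_iff)
  have "1\<^sub>m N + (1 / s) \<cdot>\<^sub>m (\<Sigma> * transpose_mat \<Sigma>) = fmat N E"
  proof (rule eq_matI)
    fix i k assume "i < dim_row (fmat N E)" "k < dim_col (fmat N E)"
    then have ik: "i < N" "k < N" by auto
    have "(\<Sigma> * transpose_mat \<Sigma>) $$ (i, k) = (\<Sum>l<n. \<Sigma> $$ (i, l) * transpose_mat \<Sigma> $$ (l, k))"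
      by (rule mult_mat_entry[of _ N n _ N]) (use car ik in auto)
    also have "\<dots> = (\<Sum>l<n. \<Sigma> $$ (i, l) * \<Sigma> $$ (k, l))"
      using car ik by (intro sum.cong refl) simp
    finally show "(1\<^sub>m N + (1 / s) \<cdot>\<^sub>m (\<Sigma> * transpose_mat \<Sigma>)) $$ (i, k) = fmat N E $$ (i, k)"
      using ik car by (simp add: E_def del: index_mult_mat(1))
  qed (use car in auto)
  then have "log_det N n A sig X s \<omega> = ln (fdet N E)"
    by (simp add: log_det_def \<Sigma>_def[symmetric] fdet_def)
  moreover have "ln (fdet m (const_diag r (R.Bx (Z \<omega>)))) = real m * ln r + ln (fdet N E)"
    unfolding d using r(1) E0 by (simp add: ln_mult ln_realpow)
  ultimately show ?thesis by (simp add: r_def)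
qed

lemma log_det_integrable:
  assumes s: "0 < s"
  shows "integrable M (log_det N n A sig X s)"
    and "C_cap M N n A sig X s = (R.L (sqrt s) - real m * ln (sqrt s)) / real N"
proof -
  let ?f = "\<lambda>x. ln (fdet m (const_diag (sqrt s) (R.Bx x)))"
  have r: "0 < sqrt s" using s by simp
  have sets: "sets R.PM = sets (PiM P (\<lambda>_. borel))" by (rule sets_PiM_cong) auto
  have meas: "?f \<in> borel_measurable (PiM P (\<lambda>_. borel))"
    using R.ln_fdet_Bx_meas measurable_cong_sets[OF sets refl] by blast
  have "integrable (distr M (PiM P (\<lambda>_. borel)) Z) ?f" unfolding Z_distr by (rule R.ln_fdet_Bx_integrable[OF r])
  then have int: "integrable M (\<lambda>\<omega>. ?f (Z \<omega>))" by (subst (asm) integrable_distr_eq[OF Z_meas meas])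
  have L: "R.L (sqrt s) = (\<integral>\<omega>. ?f (Z \<omega>) \<partial>M)"
    unfolding R.L_def Z_distr[symmetric] by (rule integral_distr[OF Z_meas meas])
  show "integrable M (log_det N n A sig X s)"
    unfolding log_det_eq[OF s, abs_def] using int by simp
  show "C_cap M N n A sig X s = (R.L (sqrt s) - real m * ln (sqrt s)) / real N"
    unfolding C_cap_def log_det_eq[OF s] L using int by (simp add: prob_space)
qed

lemma capacity_approx:
  assumes \<kappa>: "real m * \<beta> \<le> \<kappa>" and s: "0 < s" and r1: "sqrt s \<le> r1" and small: "\<beta> * R.\<Theta> (sqrt s) \<le> sqrt s / 2"
  shows "\<bar>C_cap M N n A sig X s - V s\<bar>
    \<le> (real m * (a_max\<^sup>2 + \<kappa>) / r1\<^sup>2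
        + (r1 - sqrt s) * (R.\<Theta> (sqrt s) * (1 + 2 * \<kappa> * (1 / sqrt s + \<kappa> / sqrt s ^ 3)\<^sup>2))) / real N"
proof -
  have r: "0 < sqrt s" using s by simp
  have "C_cap M N n A sig X s - V s = (R.L (sqrt s) - D.\<Lambda> (sqrt s)) / real N"
    unfolding log_det_integrable(2)[OF s] V_bounds(1)[OF s] by (simp add: diff_divide_distrib)
  then have eq: "\<bar>C_cap M N n A sig X s - V s\<bar> = \<bar>R.L (sqrt s) - D.\<Lambda> (sqrt s)\<bar> / real N"
    by (simp add: abs_divide)
  have "\<bar>R.L (sqrt s) - D.\<Lambda> (sqrt s)\<bar> \<le> real m * (a_max\<^sup>2 + \<kappa>) / r1\<^sup>2
        + (r1 - sqrt s) * (R.\<Theta> (sqrt s) * (1 + 2 * \<kappa> * (1 / sqrt s + \<kappa> / sqrt s ^ 3)\<^sup>2))"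
    by (rule random_family.L_approx[OF random_family[OF \<kappa>] dyson[OF \<kappa>] r r1 small])
  then show ?thesis unfolding eq by (rule divide_right_mono) simp
qed

end

section \<open>Transfer of independence and passage to the limit\<close>

lemma (in prob_space) indep_vars_reindex_inj:
  assumes X: "indep_vars M' X (f ` I)" and f: "inj_on f I"
  shows "indep_vars (\<lambda>i. M' (f i)) (\<lambda>i. X (f i)) I"
  unfolding indep_vars_def2 indep_sets_def
proof (intro conjI ballI allI impI)
  fix i assume "i \<in> I"
  then show "random_variable (M' (f i)) (X (f i))"
      "{X (f i) -` A \<inter> space M |A. A \<in> sets (M' (f i))} \<subseteq> events"
    using X by (auto simp: indep_vars_def2 intro: measurable_sets)
next
  fix J A assume J: "J \<subseteq> I" "J \<noteq> {}" "finite J"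
    and A: "A \<in> (\<Pi> j\<in>J. {X (f j) -` B \<inter> space M |B. B \<in> sets (M' (f j))})"
  have inj: "inj_on f J" by (rule inj_on_subset[OF f J(1)])
  \<comment> \<open>Events indexed by \<open>J\<close> are carried to the image of \<open>J\<close>
    by the inverse of \<open>f\<close>, where the product formula is available.\<close>
  define A' where "A' = (\<lambda>k. A (the_inv_into J f k))"
  have A': "A' (f j) = A j" if "j \<in> J" for j by (simp add: A'_def the_inv_into_f_f[OF inj that])
  have "indep_sets (\<lambda>i. {X i -` B \<inter> space M |B. B \<in> sets (M' i)}) (f ` I)"
    using X by (simp add: indep_vars_def2)
  then have "prob (\<Inter>k\<in>f ` J. A' k) = (\<Prod>k\<in>f ` J. prob (A' k))"
    by (rule indep_setsD) (use J A A' in auto)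
  moreover have "(\<Prod>k\<in>f ` J. prob (A' k)) = (\<Prod>j\<in>J. prob (A j))"
    by (simp add: prod.reindex[OF inj] A')
  moreover have "(\<Inter>k\<in>f ` J. A' k) = (\<Inter>j\<in>J. A j)" by (simp add: A')
  ultimately show "prob (\<Inter>j\<in>J. A j) = (\<Prod>j\<in>J. prob (A j))" by simp
qed

text \<open>For given \<open>\<epsilon>\<close> the cut-off \<open>x\<close> is fixed first, from
  the term without n, and only then is n taken large; \<open>K1\<close> and \<open>K2\<close> must
  therefore not depend on \<open>x\<close>.\<close>

lemma tendsto_zero_two_scale:
  fixes e :: "nat \<Rightarrow> real"
  assumes bound: "\<And>x. r \<le> x \<Longrightarrow> eventually (\<lambda>n. \<bar>e n\<bar> \<le> K1 / x\<^sup>2 + (x - r) * (K2 / sqrt (real n))) sequentially"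
  shows "e \<longlonglongrightarrow> 0"
proof (rule LIMSEQ_I)
  fix \<epsilon> :: real assume \<epsilon>: "0 < \<epsilon>"
  have "((\<lambda>x::real. K1 / x\<^sup>2) \<longlongrightarrow> 0) at_top"
    by (intro real_tendsto_divide_at_top[OF tendsto_const] filterlim_pow_at_top filterlim_ident) simp
  then have "eventually (\<lambda>x. K1 / x\<^sup>2 < \<epsilon> / 2) at_top" using \<epsilon> by (intro order_tendstoD(2)) auto
  then have "eventually (\<lambda>x. K1 / x\<^sup>2 < \<epsilon> / 2 \<and> r \<le> x) at_top"
    using eventually_ge_at_top[of r] by eventually_elim simp
  then obtain x where x: "K1 / x\<^sup>2 < \<epsilon> / 2" "r \<le> x"
    using eventually_happens'[OF trivial_limit_at_top_linorder] by blast
  have "((\<lambda>n. (x - r) * (K2 / sqrt (real n))) \<longlonglongrightarrow> (x - r) * 0)"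
    by (intro tendsto_mult tendsto_const real_tendsto_divide_at_top[OF tendsto_const]
        filterlim_compose[OF sqrt_at_top] filterlim_real_sequentially)
  then have "eventually (\<lambda>n. (x - r) * (K2 / sqrt (real n)) < \<epsilon> / 2) sequentially"
    using \<epsilon> by (intro order_tendstoD(2)) auto
  then have "eventually (\<lambda>n. \<bar>e n\<bar> < \<epsilon>) sequentially"
    using bound[OF x(2)] by eventually_elim (use x(1) in linarith)
  then show "\<exists>no. \<forall>n\<ge>no. norm (e n - 0) < \<epsilon>" by (simp add: eventually_sequentially)
qed

context capacity_model
begin

lemma ratio_nonneg:
  assumes "real m \<le> b * real n"
  shows "0 \<le> b"
proof (rule ccontr)
  assume "\<not> 0 \<le> b"
  then have "b * real n < 0" using n by (simp add: mult_neg_pos)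
  then show False using assms by linarith
qed

text \<open>In terms of \<open>w = sqrt n\<close>, \<open>\<beta>\<close> is of order w^-2,
  \<open>\<gamma>\<close> of order w^-3 and \<open>m\<close> at most \<open>b * (w * w)\<close>.
  Each of the three terms then retains one factor \<open>w\<close>.\<close>

lemma \<Theta>_le:
  assumes b: "real m \<le> b * real n" and r: "0 < r"
  shows "R.\<Theta> r \<le> (2 * b\<^sup>2 * sig_max ^ 3 / r ^ 4 + b * sqrt b * sig_max\<^sup>2 / r ^ 3
      + 24 * b\<^sup>2 * (sig_max ^ 3 * (c1 + c3)) / r ^ 4) * sqrt (real n)"
proof -
  define w where "w = sqrt (real n)"
  have w: "0 < w" "real n = w * w" using n by (auto simp: w_def)
  have m2: "(real m)\<^sup>2 \<le> (b * real n)\<^sup>2" using b by (intro power_mono) auto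
  have ms: "real m * sqrt (real m) \<le> (b * real n) * sqrt (b * real n)"
    using b by (intro mult_mono) auto
  have \<beta>w: "\<beta> = sig_max\<^sup>2 / (w * w)" by (simp add: \<beta>_def w(2))
  have s\<beta>: "sqrt \<beta> = sig_max / w"
    using sig_max_nonneg w(1) by (simp add: \<beta>w real_sqrt_divide)
  have \<gamma>w: "\<gamma> = sig_max ^ 3 * (c1 + c3) / (w * w * w)" using w(1) by (simp add: \<gamma>_def w_def[symmetric] w(2))
  have \<beta>0: "0 \<le> \<beta>" by (simp add: \<beta>_def)
  have \<gamma>0: "0 \<le> \<gamma>" by (rule R.\<gamma>0)
  have 1: "2 * (real m)\<^sup>2 * \<beta> * sqrt \<beta> / r ^ 4 \<le> 2 * b\<^sup>2 * sig_max ^ 3 / r ^ 4 * w"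
  proof -
    have "2 * (real m)\<^sup>2 * \<beta> * sqrt \<beta> / r ^ 4 \<le> 2 * (b * real n)\<^sup>2 * \<beta> * sqrt \<beta> / r ^ 4"
      using m2 r \<beta>0 by (intro divide_right_mono mult_right_mono mult_left_mono) auto
    also have "\<dots> = 2 * b\<^sup>2 * sig_max ^ 3 / r ^ 4 * w"
      unfolding s\<beta> unfolding \<beta>w w(2) using w(1) by (simp add: power2_eq_square power3_eq_cube)
    finally show ?thesis .
  qed
  have 2: "real m * sqrt (real m) * \<beta> / r ^ 3 \<le> b * sqrt b * sig_max\<^sup>2 / r ^ 3 * w"
  proof -
    have "real m * sqrt (real m) * \<beta> / r ^ 3 \<le> (b * real n) * sqrt (b * real n) * \<beta> / r ^ 3"
      using ms r \<beta>0 by (intro divide_right_mono mult_right_mono) auto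
    also have "\<dots> = b * sqrt b * sig_max\<^sup>2 / r ^ 3 * w"
      unfolding \<beta>w real_sqrt_mult w_def[symmetric] using w(1) by (simp add: w(2))
    finally show ?thesis .
  qed
  have 3: "24 * (real m)\<^sup>2 * \<gamma> / r ^ 4 \<le> 24 * b\<^sup>2 * (sig_max ^ 3 * (c1 + c3)) / r ^ 4 * w"
  proof -
    have "24 * (real m)\<^sup>2 * \<gamma> / r ^ 4 \<le> 24 * (b * real n)\<^sup>2 * \<gamma> / r ^ 4"
      using m2 r \<gamma>0 by (intro divide_right_mono mult_right_mono mult_left_mono) auto
    also have "\<dots> = 24 * b\<^sup>2 * (sig_max ^ 3 * (c1 + c3)) / r ^ 4 * w"
      unfolding \<gamma>w w(2) using w(1) by (simp add: power2_eq_square)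
    finally show ?thesis .
  qed
  show ?thesis unfolding R.\<Theta>_def w_def[symmetric] distrib_right using 1 2 3 by linarith
qed

text \<open>The constants depend only on \<open>b\<close>, \<open>d\<close>, \<open>s\<close>, the
  moments and the bounds on the data, so that n enters just through \<open>sqrt n\<close>. Dividing
  by \<open>N \<ge> d * n\<close> turns the factor \<open>sqrt n\<close> of
  \<open>R.\<Theta>\<close> into \<open>1 / sqrt n\<close>.\<close>

lemma capacity_rate:
  assumes b: "real m \<le> b * real n" and d: "0 < d" "d * real n \<le> real N" "real m \<le> b / d * real N"
    and s: "0 < s" and r1: "sqrt s \<le> r1"
  defines "\<kappa> \<equiv> b * sig_max\<^sup>2" and "r \<equiv> sqrt s"
  defines "k \<equiv> 2 * b\<^sup>2 * sig_max ^ 3 / r ^ 4 + b * sqrt b * sig_max\<^sup>2 / r ^ 3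
      + 24 * b\<^sup>2 * (sig_max ^ 3 * (c1 + c3)) / r ^ 4"
  assumes small: "sig_max\<^sup>2 * k / sqrt (real n) \<le> r / 2"
  shows "\<bar>C_cap M N n A sig X s - V s\<bar> \<le> b / d * (a_max\<^sup>2 + \<kappa>) / r1\<^sup>2
    + (r1 - r) * (k * (1 + 2 * \<kappa> * (1 / r + \<kappa> / r ^ 3)\<^sup>2) / d / sqrt (real n))"
proof -
  define w where "w = sqrt (real n)"
  have w: "0 < w" "real n = w * w" using n by (auto simp: w_def)
  have r: "0 < r" using s by (simp add: r_def)
  have \<Theta>: "R.\<Theta> r \<le> k * w" unfolding k_def w_def by (rule \<Theta>_le[OF b r])
  have \<Theta>0: "0 \<le> R.\<Theta> r"
    unfolding R.\<Theta>_def using r R.\<beta>0 R.\<gamma>0 by (intro add_nonneg_nonneg divide_nonneg_nonneg mult_nonneg_nonneg) auto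
  have b0: "0 \<le> b" by (rule ratio_nonneg[OF b])
  have \<kappa>0: "0 \<le> \<kappa>" using b0 by (simp add: \<kappa>_def)
  have \<kappa>: "real m * \<beta> \<le> \<kappa>"
  proof -
    have "real m * \<beta> \<le> (b * real n) * \<beta>" using b by (intro mult_right_mono) (auto simp: \<beta>_def)
    also have "\<dots> = \<kappa>" using n by (simp add: \<beta>_def \<kappa>_def)
    finally show ?thesis .
  qed
  have "\<beta> * R.\<Theta> r \<le> \<beta> * (k * w)" using \<Theta> by (intro mult_left_mono) (auto simp: \<beta>_def)
  also have "\<dots> = sig_max\<^sup>2 * k / w" using w by (simp add: \<beta>_def)
  also have "\<dots> \<le> r / 2" using small by (simp add: w_def)
  finally have sm: "\<beta> * R.\<Theta> r \<le> r / 2" .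
  define l where "l = 1 + 2 * \<kappa> * (1 / r + \<kappa> / r ^ 3)\<^sup>2"
  have l0: "0 \<le> l" unfolding l_def using \<kappa>0 by simp
  have N0: "0 < real N" using N by simp
  define q where "q = a_max\<^sup>2 + \<kappa>"
  have "\<bar>C_cap M N n A sig X s - V s\<bar> \<le> (real m * (a_max\<^sup>2 + \<kappa>) / r1\<^sup>2 + (r1 - r) * (R.\<Theta> r * l)) / real N"
    unfolding r_def l_def by (rule capacity_approx[OF \<kappa> s r1 sm[unfolded r_def]])
  also have "\<dots> = real m / real N * ((a_max\<^sup>2 + \<kappa>) / r1\<^sup>2) + (r1 - r) * (R.\<Theta> r / real N * l)"
    by (simp add: q_def[symmetric] add_divide_distrib)
  also have "\<dots> \<le> b / d * ((a_max\<^sup>2 + \<kappa>) / r1\<^sup>2) + (r1 - r) * (k / d / w * l)"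
  proof (intro add_mono mult_right_mono mult_left_mono)
    show "real m / real N \<le> b / d" using d(3) N0 by (simp add: pos_divide_le_eq)
    show "R.\<Theta> r / real N \<le> k / d / w"
    proof -
      have "R.\<Theta> r / real N \<le> (k * w) / (d * real n)"
        using \<Theta> \<Theta>0 d n by (intro frac_le) auto
      also have "\<dots> = k / d / w" using w by simp
      finally show ?thesis .
    qed
  qed (use \<kappa>0 l0 r1 in \<open>auto simp: r_def\<close>)
  finally show ?thesis by (simp add: l_def[symmetric] w_def[symmetric] q_def[symmetric])
qed

end

text \<open>Integrability is part of the conclusion because the integral of a non-integrable
  function is \<open>0\<close> by convention, which would deprive the statements about
  \<open>C_cap\<close> and \<open>Cbar\<close> of their meaning.\<close>

theorem theorem4p1:
  fixes M :: "'w measure"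
    and N :: "nat \<Rightarrow> nat"
    and c eps sig_max a_max :: real
    and X :: "nat \<Rightarrow> nat \<Rightarrow> nat \<Rightarrow> 'w \<Rightarrow> real"
    and sig :: "nat \<Rightarrow> nat \<Rightarrow> nat \<Rightarrow> real"
    and A :: "nat \<Rightarrow> real mat"
    and psi psit :: "nat \<Rightarrow> nat \<Rightarrow> complex \<Rightarrow> complex"
  assumes prob: "prob_space M"
    and N_pos: "\<And>n. 1 \<le> n \<Longrightarrow> 1 \<le> N n"
    and c_pos: "0 < c"
    and ratio: "(\<lambda>n. real (N n) / real n) \<longlonglongrightarrow> c"
    and A1_indep: "prob_space.indep_vars M (\<lambda>_. borel) (\<lambda>(n, i, j). X n i j) (index_set N)"
    and A1_ident: "\<And>n i j n' i' j'. (n, i, j) \<in> index_set N \<Longrightarrow> (n', i', j') \<in> index_set N \<Longrightarrow>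
        distr M borel (X n i j) = distr M borel (X n' i' j')"
    and A1_centered: "\<And>n i j. (n, i, j) \<in> index_set N \<Longrightarrow> (LINT \<omega>|M. X n i j \<omega>) = 0"
    and A1_variance: "\<And>n i j. (n, i, j) \<in> index_set N \<Longrightarrow> (LINT \<omega>|M. (X n i j \<omega>)\<^sup>2) = 1"
    and eps_pos: "0 < eps"
    and A1_moment: "\<And>n i j. (n, i, j) \<in> index_set N \<Longrightarrow>
        integrable M (\<lambda>\<omega>. \<bar>X n i j \<omega>\<bar> powr (4 + eps))"
    and A2: "\<And>n i j. (n, i, j) \<in> index_set N \<Longrightarrow> \<bar>sig n i j\<bar> \<le> sig_max"
    and A3_dim: "\<And>n. 1 \<le> n \<Longrightarrow> A n \<in> carrier_mat (N n) n"
    and A3_cols: "\<And>n k. 1 \<le> n \<Longrightarrow> k < n \<Longrightarrow> vec_eucl_norm (col (A n) k) \<le> a_max"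
    and A3_rows: "\<And>n l. 1 \<le> n \<Longrightarrow> l < N n \<Longrightarrow> vec_eucl_norm (Matrix.row (A n) l) \<le> a_max"
    and system: "\<And>n. 1 \<le> n \<Longrightarrow> solves_system (N n) n (A n) (sig n) (psi n) (psit n)"
  shows "\<forall>s>0.
     (\<forall>n\<ge>1. integrable M (log_det (N n) n (A n) (sig n) (X n) s) \<and>
        set_integrable lborel {s..} (Cbar_integrand (N n) n (A n) (psi n) (psit n))) \<and>
     (\<lambda>n. complex_of_real (C_cap M (N n) n (A n) (sig n) (X n) s)
        - Cbar (N n) n (A n) (psi n) (psit n) s) \<longlonglongrightarrow> 0 \<and>
     (\<forall>n\<ge>1.
        let z = - complex_of_real s;
            Psi = mat_diag (N n) (\<lambda>i. psi n i z);
            Psit = mat_diag n (\<lambda>j. psit n j z);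
            T = T_mat (N n) n (A n) (psi n) (psit n) z;
            Tt = Tt_mat (N n) n (A n) (psi n) (psit n) z
        in Cbar (N n) n (A n) (psi n) (psit n) s =
             1 / of_nat (N n) * ln (Determinant.det ((1 / complex_of_real s) \<cdot>\<^sub>m mat_inv Psi
                 + cmat (A n) * Psit * transpose_mat (cmat (A n))))
           + 1 / of_nat (N n) * ln (Determinant.det ((1 / complex_of_real s) \<cdot>\<^sub>m mat_inv Psit))
           - complex_of_real s / (of_nat n * of_nat (N n)) *
               (\<Sum>i<N n. \<Sum>j<n. complex_of_real ((sig n i j)\<^sup>2) * T $$ (i, i) * Tt $$ (j, j)))"
proof (intro allI impI, goal_cases)
  case s: (1 s)
  interpret prob_space M by (rule prob)
  have i1: "(1, 0, 0) \<in> index_set N" using N_pos[of 1] by (simp add: index_set_def)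
  have meas: "X n i j \<in> borel_measurable M" if "(n, i, j) \<in> index_set N" for n i j
    using A1_indep that by (fastforce simp: indep_vars_def2)
  \<comment> \<open>Since the entries are identically distributed, the moments of this one entry are
    those of all entries, for every n.\<close>
  define c1 where "c1 = (\<integral>\<omega>. \<bar>X 1 0 0 \<omega>\<bar> \<partial>M)"
  define c3 where "c3 = (\<integral>\<omega>. \<bar>X 1 0 0 \<omega>\<bar> ^ 3 \<partial>M)"
  have same: "(\<integral>\<omega>. f (X n i j \<omega>) \<partial>M) = (\<integral>\<omega>. f (X 1 0 0 \<omega>) \<partial>M)"
    if ij: "(n, i, j) \<in> index_set N" and f: "f \<in> borel_measurable borel" for n i j and f :: "real \<Rightarrow> real"
    using integral_distr[OF meas[OF ij] f] integral_distr[OF meas[OF i1] f] A1_ident[OF ij i1] by simp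
  have power_int: "integrable M (\<lambda>\<omega>. \<bar>X n i j \<omega>\<bar> ^ k)" if ij: "(n, i, j) \<in> index_set N" and k: "k \<le> 4" for n i j k
  proof (rule Bochner_Integration.integrable_bound)
    show "integrable M (\<lambda>\<omega>. 1 + \<bar>X n i j \<omega>\<bar> powr (4 + eps))" using A1_moment[OF ij] by simp
    show "(\<lambda>\<omega>. \<bar>X n i j \<omega>\<bar> ^ k) \<in> borel_measurable M" using meas[OF ij] by measurable
    have "\<bar>u\<bar> ^ k \<le> 1 + \<bar>u\<bar> powr (4 + eps)" for u :: real
    proof (cases "\<bar>u\<bar> \<le> 1")
      case True
      then show ?thesis using power_le_one[of "\<bar>u\<bar>" k] by (simp add: add_increasing2)
    next
      case False
      then have "\<bar>u\<bar> ^ k = \<bar>u\<bar> powr real k" by (simp add: powr_realpow)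
      also have "\<dots> \<le> \<bar>u\<bar> powr (4 + eps)" using False k eps_pos by (intro powr_mono) auto
      finally show ?thesis by simp
    qed
    then show "AE \<omega> in M. norm (\<bar>X n i j \<omega>\<bar> ^ k) \<le> norm (1 + \<bar>X n i j \<omega>\<bar> powr (4 + eps))"
      by simp
  qed
  have capacity: "capacity_model (N n) n (A n) (sig n) (psi n) (psit n) sig_max a_max M (X n) c1 c3"
    if n: "1 \<le> n" for n
  proof -
    have index: "(n, i, j) \<in> index_set N" if "i < N n" "j < n" for i j
      using n that by (simp add: index_set_def)
    note data = A3_dim[OF n] N_pos[OF n] n system[OF n] A2[OF index] A3_cols[OF n] A3_rows[OF n]
    interpret E: deterministic_equivalent "N n" n "A n" "sig n" "psi n" "psit n" sig_max a_max
      by (intro deterministic_equivalent.intro block_model.intro deterministic_equivalent_axioms.intro) (fact data)+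
    \<comment> \<open>Positions of the noise in the block matrix, translated back to the triples
      over which independence is assumed.\<close>
    define g where "g = (\<lambda>p :: nat \<times> nat. (n, fst p, snd p - N n))"
    have inj: "inj_on g E.P" by (auto simp: g_def inj_on_def E.P_iff)
    have img: "g ` E.P \<subseteq> index_set N"
    proof (rule image_subsetI)
      fix p assume "p \<in> E.P"
      then have "fst p < N n" "snd p - N n < n" by (auto simp: E.P_def)
      then show "g p \<in> index_set N" unfolding g_def by (rule index)
    qed
    have indep: "indep_vars (\<lambda>_. borel) (\<lambda>p. X n (fst p) (snd p - N n)) E.P"
      using indep_vars_reindex_inj[where M' = "\<lambda>_. borel", OF indep_vars_subset[OF A1_indep img] inj]
      by (simp add: g_def)
    show ?thesis
    proof (intro capacity_model.intro capacity_model_axioms.intro)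
      fix i j assume "i < N n" "j < n"
      then have ij: "(n, i, j) \<in> index_set N" by (rule index)
      show "integrable M (X n i j)"
        using power_int[OF ij, of 1] meas[OF ij] by (simp add: integrable_abs_iff)
      show "integrable M (\<lambda>\<omega>. (X n i j \<omega>)\<^sup>2)" using power_int[OF ij, of 2] by simp
      show "integrable M (\<lambda>\<omega>. \<bar>X n i j \<omega>\<bar> ^ 3)" using power_int[OF ij, of 3] by simp
      show "(\<integral>\<omega>. \<bar>X n i j \<omega>\<bar> \<partial>M) \<le> c1" using same[OF ij, of abs] by (simp add: c1_def)
      show "(\<integral>\<omega>. \<bar>X n i j \<omega>\<bar> ^ 3 \<partial>M) \<le> c3" using same[OF ij, of "\<lambda>u. \<bar>u\<bar> ^ 3"] by (simp add: c3_def)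
      show "(\<integral>\<omega>. X n i j \<omega> \<partial>M) = 0" by (rule A1_centered[OF ij])
      show "(\<integral>\<omega>. (X n i j \<omega>)\<^sup>2 \<partial>M) = 1" by (rule A1_variance[OF ij])
    qed (fact E.deterministic_equivalent_axioms prob indep)+
  qed
  define U where "U = (\<lambda>n. deterministic_equivalent.V (N n) n (A n) (sig n) (psi n) (psit n) s)"
  define e where "e = (\<lambda>n. C_cap M (N n) n (A n) (sig n) (X n) s - U n)"
  define r where "r = sqrt s"
  \<comment> \<open>Eventually N / n lies between \<open>c / 2\<close> and \<open>2 * c\<close>,
    hence \<open>N + n \<le> (1 + 2 * c) * n\<close> and \<open>d * n \<le> N\<close>.\<close>
  define b where "b = 1 + 2 * c"
  define d where "d = c / 2"
  define \<kappa> where "\<kappa> = b * sig_max\<^sup>2"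
  define k where "k = 2 * b\<^sup>2 * sig_max ^ 3 / r ^ 4 + b * sqrt b * sig_max\<^sup>2 / r ^ 3
      + 24 * b\<^sup>2 * (sig_max ^ 3 * (c1 + c3)) / r ^ 4"
  have r: "0 < r" using s by (simp add: r_def)
  have "(\<lambda>n. sig_max\<^sup>2 * k / sqrt (real n)) \<longlonglongrightarrow> 0"
    by (intro real_tendsto_divide_at_top[OF tendsto_const]
        filterlim_compose[OF sqrt_at_top] filterlim_real_sequentially)
  then have small: "eventually (\<lambda>n. sig_max\<^sup>2 * k / sqrt (real n) < r / 2) sequentially"
    using r by (intro order_tendstoD(2)) auto
  have above: "eventually (\<lambda>n. c / 2 < real (N n) / real n) sequentially"
    and below: "eventually (\<lambda>n. real (N n) / real n < 2 * c) sequentially"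
    using c_pos by (intro order_tendstoD[OF ratio], simp)+
  have "e \<longlonglongrightarrow> 0"
  proof (rule tendsto_zero_two_scale)
    fix x assume x: "r \<le> x"
    show "eventually (\<lambda>n. \<bar>e n\<bar> \<le> b / d * (a_max\<^sup>2 + \<kappa>) / x\<^sup>2
        + (x - r) * (k * (1 + 2 * \<kappa> * (1 / r + \<kappa> / r ^ 3)\<^sup>2) / d / sqrt (real n))) sequentially"
      using small above below eventually_ge_at_top[of 1]
    proof eventually_elim
      case (elim n)
      interpret capacity_model "N n" n "A n" "sig n" "psi n" "psit n" sig_max a_max M "X n" c1 c3
        by (rule capacity[OF elim(4)])
      have Nn: "c / 2 * real n < real (N n)" "real (N n) < 2 * c * real n"
        using elim by (simp_all add: pos_less_divide_eq pos_divide_less_eq)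
      have "real (N n + n) \<le> b * real n" using Nn(2) by (simp add: b_def distrib_right)
      moreover have "real (N n + n) \<le> b / d * real (N n)"
      proof -
        have "b / d * real (N n) = 2 / c * real (N n) + 4 * real (N n)"
          using c_pos by (simp add: b_def d_def field_simps)
        moreover have "real n \<le> 2 / c * real (N n)" using Nn(1) c_pos by (simp add: field_simps)
        ultimately show ?thesis by simp
      qed
      ultimately show ?case
        unfolding e_def U_def \<kappa>_def k_def r_def
        using c_pos Nn(1) s x elim(1)
        by (intro capacity_rate) (auto simp: m_def d_def k_def r_def)
    qed
  qed
  then have "(\<lambda>n. complex_of_real (e n)) \<longlonglongrightarrow> complex_of_real 0" by (rule tendsto_of_real)
  moreover have "eventually (\<lambda>n. complex_of_real (e n) = complex_of_real (C_cap M (N n) n (A n) (sig n) (X n) s)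
      - Cbar (N n) n (A n) (psi n) (psit n) s) sequentially"
    using eventually_ge_at_top[of 1]
  proof eventually_elim
    case (elim n)
    interpret capacity_model "N n" n "A n" "sig n" "psi n" "psit n" sig_max a_max M "X n" c1 c3
      by (rule capacity[OF elim])
    show ?case using Cbar_eq(2)[OF s] by (simp add: e_def U_def)
  qed
  ultimately have lim: "(\<lambda>n. complex_of_real (C_cap M (N n) n (A n) (sig n) (X n) s)
      - Cbar (N n) n (A n) (psi n) (psit n) s) \<longlonglongrightarrow> 0"
    by (simp add: Lim_transform_eventually)
  show ?case
  proof (intro conjI allI impI lim, goal_cases)
    case n: (1 n)
    interpret capacity_model "N n" n "A n" "sig n" "psi n" "psit n" sig_max a_max M "X n" c1 c3
      by (rule capacity[OF n])
    show ?case by (rule log_det_integrable(1)[OF s])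
  next
    case n: (2 n)
    interpret capacity_model "N n" n "A n" "sig n" "psi n" "psit n" sig_max a_max M "X n" c1 c3
      by (rule capacity[OF n])
    show ?case by (rule Cbar_eq(1)[OF s])
  next
    case n: (3 n)
    interpret capacity_model "N n" n "A n" "sig n" "psi n" "psit n" sig_max a_max M "X n" c1 c3
      by (rule capacity[OF n])
    show ?case unfolding Let_def by (rule Cbar_formula[OF s])
  qed
qed

end
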